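(* Let $T$ be a triangle with vertices $y_1,y_2,y_3$, let $r\in(1,3/2)$, and let $M\in\{t_1(r),t_2(r),t_3(r)\}$. Let $\gamma_n(r,M)$ be the domination number of the $r$-factor proportional-edge proximity catch digraph with $M$-vertex regions on $n$ iid points uniformly distributed on $T$. Then $P(\gamma_n(r,M)=2)\to p_r$ as $n\to\infty$, where $p_r\in(0,1)$ is $$p_r=\int_0^\infty\!\!\int_0^\infty \frac{64\,r^2}{9\,(r-1)^2}\,w_1w_3\,\exp\!\left(-\frac{4r}{3(r-1)}\bigl(w_1^2+w_3^2+2r(r-1)\,w_1w_3\bigr)\right)dw_3\,dw_1 .$$
   Context: Let $y_1,y_2,y_3\in\mathbb{R}^2$ be non-collinear, $T$ the closed triangle with these vertices, $e_j$ the edge opposite $y_j$, and $b_j(x)$ the barycentric coordinate of $x\in T$ with respect to $y_j$. For $r\in[1,3/2]$ define $\mathscr{T}_r:=\{x\in T: b_j(x)\ge 1-1/r \text{ for } j=1,2,3\}$, the triangle bounded by the lines $q_j$ parallel to $e_j$ with $d(y_j,e_j)=r\,d(y_j,q_j)$; its vertices are $t_1(r),t_2(r),t_3(r)$, where $t_j(r)$ has barycentric coordinates $b_j=2/r-1$ and $b_k=1-1/r$ for $k\neq j$. For $M$ in the interior of $T$ and $k=1,2,3$, let $M_k$ be the point where the line through $y_k$ and $M$ meets $e_k$; the $M$-vertex region $R_M(y_j)$ is the closed quadrilateral with vertices $y_j,M_k,M,M_l$, $\{j,k,l\}=\{1,2,3\}$. For $x\in T\setminus\{y_1,y_2,y_3\}$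 let $v(x)=y_j$ where $x\in R_M(y_j)$ (arbitrary choice on common boundaries). For such $x$ with $v(x)=y_j$, $N^r_{PE}(x,M)=\{z\in T: 1-b_j(z)\le r(1-b_j(x))\}$ (the intersection with $T$ of the triangle similar to $T$ with vertex $y_j$ whose opposite side is parallel to $e_j$ at $r$ times the distance from $y_j$ to the line through $x$ parallel to $e_j$); $N^r_{PE}(y_j,M)=\{y_j\}$. The digraph on $\{X_1,\dots,X_n\}$ has an arc $X_i\to X_j$ ($i\ne j$) iff $X_j\in N^r_{PE}(X_i,M)$; the domination number is the minimum cardinality of a vertex set $S$ such that every vertex is in $S$ or is the head of an arc from $S$. *)

theory Defs
  imports "HOL-Probability.Probability" "Graph_Theory.Digraph"
begin

definition closed_triangle :: "(3 \<Rightarrow> real^2) \<Rightarrow> (real^2) set" where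
  "closed_triangle y = convex hull (range y)"

definition edge_opposite :: "(3 \<Rightarrow> real^2) \<Rightarrow> 3 \<Rightarrow> (real^2) set" where
  "edge_opposite y j = convex hull (y ` (UNIV - {j}))"

text \<open>For non-collinear \<open>y\<close> the barycentric coordinates exist uniquely at every point of the plane.\<close>

definition barycentric :: "(3 \<Rightarrow> real^2) \<Rightarrow> real^2 \<Rightarrow> 3 \<Rightarrow> real" where
  "barycentric y x = (THE b. (\<Sum>j\<in>UNIV. b j) = 1 \<and> x = (\<Sum>j\<in>UNIV. b j *\<^sub>R y j))"

text \<open>
  The vertices of the triangle \<open>{x \<in> closed_triangle y. \<forall>j. barycentric y x j \<ge> 1 - 1 / r}\<close>, given by
  their barycentric coordinates \<open>2 / r - 1\<close> (at \<open>y j\<close>) and \<open>1 - 1 / r\<close> (at the other two vertices).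
\<close>

definition tr_vertex :: "(3 \<Rightarrow> real^2) \<Rightarrow> real \<Rightarrow> 3 \<Rightarrow> real^2" where
  "tr_vertex y r j = (2 / r - 1) *\<^sub>R y j + (\<Sum>k\<in>UNIV - {j}. (1 - 1 / r) *\<^sub>R y k)"

text \<open>The point \<open>M\<^sub>k\<close> where the line through \<open>y k\<close> and \<open>M\<close> meets the opposite edge.\<close>

definition cevian_foot :: "(3 \<Rightarrow> real^2) \<Rightarrow> real^2 \<Rightarrow> 3 \<Rightarrow> real^2" where
  "cevian_foot y M k = (THE p. p \<in> affine hull {y k, M} \<and> p \<in> edge_opposite y k)"

text \<open>
  The quadrilateral with vertices \<open>y\<^sub>j, M\<^sub>k, M, M\<^sub>l\<close> is convex whenever \<open>M\<close> is interior
  to the triangle, so it is the convex hull of its vertices.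
\<close>

definition vertex_region :: "(3 \<Rightarrow> real^2) \<Rightarrow> real^2 \<Rightarrow> 3 \<Rightarrow> (real^2) set" where
  "vertex_region y M j = convex hull ({y j, M} \<union> cevian_foot y M ` (UNIV - {j}))"

text \<open>
  A choice of the index of \<open>v(x)\<close>. It is arbitrary, not even assumed measurable, on the common
  boundaries of the regions, and unconstrained at the vertices and outside the triangle. Events
  defined through \<open>v\<close> are then measurable only with respect to the completed probability measure.
\<close>

definition vertex_choice :: "(3 \<Rightarrow> real^2) \<Rightarrow> real^2 \<Rightarrow> (real^2 \<Rightarrow> 3) \<Rightarrow> bool" where
  "vertex_choice y M v \<longleftrightarrow> (\<forall>x \<in> closed_triangle y - range y. x \<in> vertex_region y M (v x))"

text \<open>The dependence of the proximity region on \<open>M\<close> is only through the choice \<open>v\<close>.\<close>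

definition PE_region :: "(3 \<Rightarrow> real^2) \<Rightarrow> real \<Rightarrow> (real^2 \<Rightarrow> 3) \<Rightarrow> real^2 \<Rightarrow> (real^2) set" where
  "PE_region y r v x =
    (if x \<in> range y then {x}
     else {z \<in> closed_triangle y.
             1 - barycentric y z (v x) \<le> r * (1 - barycentric y x (v x))})"

definition PE_digraph ::
  "(3 \<Rightarrow> real^2) \<Rightarrow> real \<Rightarrow> (real^2 \<Rightarrow> 3) \<Rightarrow> (real^2) set \<Rightarrow> (real^2, (real^2) \<times> (real^2)) pre_digraph" where
  "PE_digraph y r v V =
    \<lparr>verts = V,
     arcs = {(x, z). x \<in> V \<and> z \<in> V \<and> x \<noteq> z \<and> z \<in> PE_region y r v x},
     tail = fst, head = snd\<rparr>"

definition dominating_set :: "('a, 'b) pre_digraph \<Rightarrow> 'a set \<Rightarrow> bool" where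
  "dominating_set G S \<longleftrightarrow>
    S \<subseteq> verts G \<and> (\<forall>w \<in> verts G. w \<in> S \<or> (\<exists>u \<in> S. (u, w) \<in> arcs_ends G))"

text \<open>Meaningful for finite digraphs only: infinite sets have cardinality \<open>0\<close> here.\<close>

definition domination_number :: "('a, 'b) pre_digraph \<Rightarrow> nat" where
  "domination_number G = (LEAST k. \<exists>S. dominating_set G S \<and> card S = k)"

definition limit_prob :: "real \<Rightarrow> real" where
  "limit_prob r =
    (LBINT w1=0..\<infinity>. (LBINT w3=0..\<infinity>.
       64 * r\<^sup>2 / (9 * (r - 1)\<^sup>2) * w1 * w3 *
       exp (- (4 * r / (3 * (r - 1))) * (w1\<^sup>2 + w3\<^sup>2 + 2 * r * (r - 1) * w1 * w3))))"

end

theory Submission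
  imports Defs "HOL-Real_Asymp.Real_Asymp"
begin

text \<open>
  Let \<open>M = t\<^sub>c\<close> and let \<open>p, q\<close> be the other two labels. A point of the vertex region of
  \<open>y\<^sub>p\<close> catches everything except a strip along \<open>e\<^sub>p\<close> whose width is proportional to
  \<open>u = b\<^sub>p(x) - (1 - 1/r)\<close>; likewise for \<open>y\<^sub>q\<close>, whereas every point of the region of \<open>y\<^sub>c\<close>
  misses a strip of fixed width along \<open>e\<^sub>c\<close>. The smallest \<open>u\<close> is of order \<open>n\<^sup>-\<^sup>1\<^sup>/\<^sup>2\<close>, so a single
  strip has area of order \<open>n\<^sup>-\<^sup>1\<^sup>/\<^sup>2\<close> and contains a sample point with probability tending to 1.
  Hence one point does not dominate, and two points can do so only if one lies in the region of
  \<open>y\<^sub>p\<close> and the other in that of \<open>y\<^sub>q\<close>. Then the two closest points to \<open>e\<^sub>p\<close> and \<open>e\<^sub>q\<close> (with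
  excesses \<open>u\<close> and \<open>v\<close>) dominate as well, which means that the intersection of their strips,
  a parallelogram at \<open>y\<^sub>c\<close> of relative area \<open>2 r\<^sup>2 u v\<close>, contains no sample point.
  Summing over the ordered pairs of indices gives \<open>n (n - 1)\<close> times an integral of
  \<open>(1 - uncaught_mass r u v)\<^sup>n\<^sup>-\<^sup>2\<close>, and the substitution \<open>u = 2 w\<^sub>1 / sqrt (3 n)\<close>,
  \<open>v = 2 w\<^sub>3 / sqrt (3 n)\<close> with dominated convergence yields the limit.
\<close>

section \<open>The limiting integral\<close>

text \<open>At \<open>M = t_c\<close> both \<open>b_p\<close> and \<open>b_q\<close> equal
  \<open>1 - 1/r\<close>, the value with \<open>r (1 - b_p) = 1\<close>: the strip missed by a point
  of the region of \<open>y_p\<close> has width \<open>r u\<close> and closes up exactly at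
  \<open>M\<close>. As \<open>M\<close> is a corner of that region, excess below \<open>u\<close>
  has probability of order \<open>u^2\<close>, which explains the scale \<open>n^(-1/2)\<close>. In
  the region of \<open>y_c\<close>, \<open>r (1 - b_c)\<close> stays below \<open>2r - 2\<close>,
  and \<open>2r - 2 < 1\<close> because \<open>r < 3/2\<close>; hence the fixed strip. Both wedges
  and the parallelogram have mass of order \<open>1/n\<close> on this scale. The wedge terms alone
  would give a limit of 1, and the parallelogram lowers it. The two extremal points are dependent,
  but no joint law of order statistics is computed: extremality is itself the absence of sample
  points from part of a wedge. For fixed indices all conditions then say that \<open>n - 2\<close>
  independent points avoid one set, and the extremal pair is unique off ties, so the sum over
  indices is exact. The mass formulas hold only near \<open>M\<close>, hence a window
  \<open>\<delta>\<close>, which is empty of sample points with exponentially small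
  probability.\<close>

definition limit_density :: "real \<Rightarrow> real \<Rightarrow> real \<Rightarrow> real" where
  "limit_density r w1 w3 = 64 * r\<^sup>2 / (9 * (r - 1)\<^sup>2) * w1 * w3 *
       exp (- (4 * r / (3 * (r - 1))) * (w1\<^sup>2 + w3\<^sup>2 + 2 * r * (r - 1) * w1 * w3))"

text \<open>The iterated integral becomes one integral over the plane, so that strict comparison and
  dominated convergence concern a single nonnegative function.\<close>

definition limit_density_pos :: "real \<Rightarrow> real \<times> real \<Rightarrow> real" where
  "limit_density_pos r p = indicator ({0<..} \<times> {0<..}) p * limit_density r (fst p) (snd p)"

text \<open>Weibull density of shape 2, with tail \<open>exp (- a * w\<^sup>2)\<close>: the limit
  law of one rescaled smallest excess, because the wedge mass is quadratic in the excess.\<close>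

definition weibull_density :: "real \<Rightarrow> real \<Rightarrow> real" where
  "weibull_density a w = indicator {0<..} w * (2 * a * w * exp (- a * w\<^sup>2))"

lemma weibull_density_nonneg: "0 < a \<Longrightarrow> 0 \<le> weibull_density a w"
  by (auto simp: weibull_density_def indicator_def)

lemma weibull_density_measurable [measurable]: "weibull_density a \<in> borel_measurable borel"
  unfolding weibull_density_def by measurable

lemma limit_density_pos_measurable [measurable]:
  "limit_density_pos r \<in> borel_measurable borel"
proof -
  have "limit_density_pos r \<in> borel_measurable (borel \<Otimes>\<^sub>M borel)"
    unfolding limit_density_pos_def limit_density_def by measurable
  then show ?thesis by (simp only: borel_prod)
qed

lemma nn_integral_weibull_density:
  assumes "0 < a"
  shows "(\<integral>\<^sup>+w. ennreal (weibull_density a w) \<partial>lborel) = 1"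
proof -
  have "(\<integral>\<^sup>+w. ennreal (weibull_density a w) \<partial>lborel)
      = (\<integral>\<^sup>+w. ennreal (2 * a * w * exp (- a * w\<^sup>2)) * indicator {0..} w \<partial>lborel)"
    by (rule nn_integral_cong) (auto simp: weibull_density_def indicator_def)
  also have "\<dots> = ennreal (0 - (- exp (- a * 0\<^sup>2)))"
  proof (rule nn_integral_FTC_atLeast)
    show "DERIV (\<lambda>w. - exp (- a * w\<^sup>2)) x :> 2 * a * x * exp (- a * x\<^sup>2)" for x
      by (auto intro!: derivative_eq_intros)
    show "((\<lambda>w. - exp (- a * w\<^sup>2)) \<longlongrightarrow> 0) at_top"
      using assms by real_asymp
  qed (use assms in auto)
  finally show ?thesis by simp
qed

lemma nn_integral_weibull_density_pair:
  assumes "0 < a"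
  shows "(\<integral>\<^sup>+p. ennreal (weibull_density a (fst p) * weibull_density a (snd p)) \<partial>(lborel :: (real \<times> real) measure)) = 1"
proof -
  have "(\<integral>\<^sup>+p. ennreal (weibull_density a (fst p) * weibull_density a (snd p)) \<partial>(lborel :: (real \<times> real) measure))
    = (\<integral>\<^sup>+x. \<integral>\<^sup>+y. ennreal (weibull_density a x) * ennreal (weibull_density a y) \<partial>lborel \<partial>lborel)"
    using assms
    by (subst lborel_prod[symmetric], subst lborel.nn_integral_fst[symmetric])
       (auto simp: ennreal_mult weibull_density_nonneg)
  also have "\<dots> = 1"
    using assms by (simp add: nn_integral_cmult nn_integral_multc nn_integral_weibull_density)
  finally show ?thesis .
qed

lemma integrable_weibull_density_pair:
  assumes "0 < a"
  shows "integrable (lborel :: (real \<times> real) measure) (\<lambda>p. weibull_density a (fst p) * weibull_density a (snd p))"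
proof (rule integrableI_nonneg)
  have "(\<lambda>p. weibull_density a (fst p) * weibull_density a (snd p)) \<in> borel_measurable (borel \<Otimes>\<^sub>M borel)"
    by measurable
  then show "(\<lambda>p. weibull_density a (fst p) * weibull_density a (snd p)) \<in> borel_measurable lborel"
    by (simp add: borel_prod)
qed (use assms in \<open>auto simp: weibull_density_nonneg nn_integral_weibull_density_pair\<close>)

lemma limit_density_pos_nonneg: 
  assumes "1 < r" shows "0 \<le> limit_density_pos r p"
  using assms by (auto simp: limit_density_pos_def limit_density_def indicator_def)

text \<open>The factor \<open>r - 1\<close> cancels from the cross term of the exponent and leaves
  \<open>8 * r\<^sup>2 / 3\<close>, the contribution of the parallelogram. What remains is a product
  of two probability densities; the damping factor is at most 1, which yields integrability and the
  upper bound.\<close>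

lemma limit_density_pos_eq_weibull:
  assumes "1 < r"
  shows "limit_density_pos r p = weibull_density (4 * r / (3 * (r - 1))) (fst p) * weibull_density (4 * r / (3 * (r - 1))) (snd p)
    * exp (- (8 * r\<^sup>2 / 3) * fst p * snd p)"
proof -
  have "- (4 * r / (3 * (r - 1))) * ((fst p)\<^sup>2 + (snd p)\<^sup>2 + 2 * r * (r - 1) * fst p * snd p)
     = - (4 * r / (3 * (r - 1))) * (fst p)\<^sup>2 + (- (4 * r / (3 * (r - 1))) * (snd p)\<^sup>2) + (- (8 * r\<^sup>2 / 3) * fst p * snd p)"
  proof -
    define c where "c = 4 * r / (3 * (r - 1))"
    have "c * (r - 1) = 4 * r / 3"
      using assms by (simp add: c_def field_simps)
    moreover have "c * (2 * r * (r - 1) * fst p * snd p) = (c * (r - 1)) * (2 * r * fst p * snd p)"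
      by (simp only: mult_ac)
    ultimately have "c * (2 * r * (r - 1) * fst p * snd p) = 4 * r / 3 * (2 * r * fst p * snd p)"
      by simp
    then show ?thesis unfolding c_def[symmetric]
      by (simp add: algebra_simps power2_eq_square)
  qed
  moreover have "64 * r\<^sup>2 / (9 * (r - 1)\<^sup>2) = (2 * (4 * r / (3 * (r - 1)))) * (2 * (4 * r / (3 * (r - 1))))"
    using assms by (simp add: field_simps power2_eq_square)
  ultimately have "limit_density r (fst p) (snd p) = (2 * (4 * r / (3 * (r - 1)))) * (2 * (4 * r / (3 * (r - 1)))) * fst p * snd p
     * (exp (- (4 * r / (3 * (r - 1))) * (fst p)\<^sup>2) * exp (- (4 * r / (3 * (r - 1))) * (snd p)\<^sup>2) * exp (- (8 * r\<^sup>2 / 3) * fst p * snd p))"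
    unfolding limit_density_def by (simp only: exp_add mult.assoc)
  then show ?thesis
    unfolding limit_density_pos_def weibull_density_def
    by (auto simp: mem_Times_iff indicator_def)
qed

lemma limit_density_pos_le_weibull:
  assumes "1 < r" and "a = 4 * r / (3 * (r - 1))"
  shows "limit_density_pos r p \<le> weibull_density a (fst p) * weibull_density a (snd p)"
proof -
  have "0 < a" using assms by simp
  then show ?thesis
    unfolding limit_density_pos_eq_weibull[OF assms(1)] assms(2)[symmetric]
    using assms(1) by (auto simp: weibull_density_def indicator_def intro!: mult_left_le)
qed

lemma integrable_limit_density_pos:
  assumes "1 < r" shows "integrable lborel (limit_density_pos r)"
proof (rule Bochner_Integration.integrable_bound[OF integrable_weibull_density_pair])
  show "0 < 4 * r / (3 * (r - 1))" using assms by simp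
  show "AE p in lborel. norm (limit_density_pos r p)
    \<le> norm (weibull_density (4 * r / (3 * (r - 1))) (fst p) * weibull_density (4 * r / (3 * (r - 1))) (snd p))"
  proof (intro AE_I2)
    fix p :: "real \<times> real"
    show "norm (limit_density_pos r p)
      \<le> norm (weibull_density (4 * r / (3 * (r - 1))) (fst p) * weibull_density (4 * r / (3 * (r - 1))) (snd p))"
      using limit_density_pos_le_weibull[OF assms refl, of p] limit_density_pos_nonneg[OF assms, of p]
      unfolding real_norm_def by linarith
  qed
qed auto

lemma limit_prob_eq_integral:
  assumes "1 < r" shows "limit_prob r = (LINT p|lborel. limit_density_pos r p)"
proof -
  have "(LINT p|lborel. limit_density_pos r p) = (LINT x|lborel. LINT y|lborel. limit_density_pos r (x, y))"
    by (subst lborel_prod[symmetric], subst lborel_pair.integral_fst'[symmetric])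
       (use integrable_limit_density_pos[OF assms] in \<open>auto simp: lborel_prod\<close>)
  also have "\<dots> = limit_prob r"
    unfolding limit_prob_def interval_lebesgue_integral_0_infty set_lebesgue_integral_def
    unfolding limit_density_pos_def limit_density_def
    by (intro Bochner_Integration.integral_cong refl) (auto simp: indicator_def)
  finally show ?thesis by simp
qed

lemma emeasure_open_quadrant_nonzero: "emeasure lborel ({0<..} \<times> {0<..} :: (real \<times> real) set) \<noteq> 0"
proof -
  have "emeasure lborel (box (0::real\<times>real) (1,1)) \<le> emeasure lborel ({0<..} \<times> {0<..} :: (real \<times> real) set)"
    by (rule emeasure_mono) (auto simp: box_def Basis_prod_def borel_prod[symmetric])
  moreover have "emeasure lborel (box (0::real\<times>real) (1,1)) = 1"
    by (subst emeasure_lborel_box) (auto simp: Basis_prod_def)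
  ultimately show ?thesis by auto
qed

text \<open>Both strict bounds on \<open>limit_prob\<close> end here: equality would make a
  nonnegative function with integral 0 vanish almost everywhere, although it is positive on the
  whole quadrant.\<close>

lemma not_AE_open_quadrant:
  assumes "AE p in (lborel :: (real \<times> real) measure). p \<notin> {0<..} \<times> {0<..}"
  shows False
proof -
  have "({0<..} \<times> {0<..} :: (real \<times> real) set) \<in> sets lborel"
    by (simp add: open_Times)
  then have "emeasure lborel ({0<..} \<times> {0<..} :: (real \<times> real) set) = 0"
    using assms by (subst (asm) AE_iff_measurable[OF _ refl]) auto
  with emeasure_open_quadrant_nonzero show False by simp
qed

lemma limit_prob_pos:
  assumes "1 < r" shows "0 < limit_prob r"
proof -
  have "limit_prob r \<ge> 0"
    unfolding limit_prob_eq_integral[OF assms]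
    by (rule Bochner_Integration.integral_nonneg) (simp add: limit_density_pos_nonneg[OF assms])
  moreover have "limit_prob r \<noteq> 0"
  proof
    assume "limit_prob r = 0"
    then have "AE p in lborel. limit_density_pos r p = 0"
      unfolding limit_prob_eq_integral[OF assms]
      by (subst (asm) integral_nonneg_eq_0_iff_AE)
         (use assms in \<open>auto simp: integrable_limit_density_pos limit_density_pos_nonneg\<close>)
    then have "AE p in (lborel :: (real \<times> real) measure). p \<notin> {0<..} \<times> {0<..}"
      by eventually_elim (use assms in \<open>auto simp: limit_density_pos_def limit_density_def indicator_def\<close>)
    then show False by (rule not_AE_open_quadrant)
  qed
  ultimately show ?thesis by simp
qed

text \<open>Without the damping factor the integral is 1, and that factor is strictly below 1 on the
  open quadrant.\<close>

lemma limit_prob_less_1: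
  assumes "1 < r" shows "limit_prob r < 1"
proof -
  define a where "a = 4 * r / (3 * (r - 1))"
  have a: "0 < a" using assms by (simp add: a_def)
  let ?g = "\<lambda>p :: real \<times> real. weibull_density a (fst p) * weibull_density a (snd p)"
  have int: "integrable lborel ?g" using a by (rule integrable_weibull_density_pair)
  have "(LINT p|lborel. ?g p) = 1"
    using nn_integral_weibull_density_pair[OF a] nn_integral_eq_integral[OF int] a
    by (simp add: weibull_density_nonneg)
  have le: "limit_density_pos r p \<le> ?g p" for p
    using assms a_def by (rule limit_density_pos_le_weibull)
  have "limit_prob r \<le> 1"
    unfolding limit_prob_eq_integral[OF assms] \<open>(LINT p|lborel. ?g p) = 1\<close>[symmetric]
    by (rule integral_mono) (use int le integrable_limit_density_pos[OF assms] in auto)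
  moreover have "limit_prob r \<noteq> 1"
  proof
    assume "limit_prob r = 1"
    then have "(LINT p|lborel. ?g p - limit_density_pos r p) = 0"
      using int integrable_limit_density_pos[OF assms] \<open>(LINT p|lborel. ?g p) = 1\<close>
      by (simp add: limit_prob_eq_integral[OF assms])
    then have "AE p in lborel. ?g p - limit_density_pos r p = 0"
      by (subst (asm) integral_nonneg_eq_0_iff_AE)
         (use assms int le in \<open>auto simp: integrable_limit_density_pos\<close>)
    then have "AE p in (lborel :: (real \<times> real) measure). p \<notin> {0<..} \<times> {0<..}"
    proof eventually_elim
      case (elim p)
      show ?case
      proof
        assume p: "p \<in> {0<..} \<times> {0<..}"
        then have "0 < ?g p" using a by (auto simp: weibull_density_def)
        moreover have "exp (- (8 * r\<^sup>2 / 3) * fst p * snd p) < 1" using p assms by auto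
        ultimately have "limit_density_pos r p < ?g p"
          unfolding limit_density_pos_eq_weibull[OF assms] a_def[symmetric]
          by (simp add: mult_less_cancel_left2)
        with elim show False by simp
      qed
    qed
    then show False by (rule not_AE_open_quadrant)
  qed
  ultimately show ?thesis by simp
qed

section \<open>Scaling limit of the two-point integral\<close>

lemma nn_integral_scale_pair:
  fixes f :: "real \<times> real \<Rightarrow> ennreal"
  assumes [measurable]: "f \<in> borel_measurable borel" and "0 < c"
  shows "(\<integral>\<^sup>+u. \<integral>\<^sup>+v. f (u, v) \<partial>lborel \<partial>lborel) = (\<integral>\<^sup>+p. ennreal (c\<^sup>2) * f (c * fst p, c * snd p) \<partial>lborel)"
proof -
  have [measurable]: "f \<in> borel_measurable (borel \<Otimes>\<^sub>M borel)"
    by (simp add: borel_prod)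
  have "(\<integral>\<^sup>+u. \<integral>\<^sup>+v. f (u, v) \<partial>lborel \<partial>lborel)
      = ennreal c * (\<integral>\<^sup>+u. \<integral>\<^sup>+v. f (c * u, v) \<partial>lborel \<partial>lborel)"
    using assms by (subst nn_integral_real_affine[where c = c and t = 0]) auto
  also have "\<dots> = ennreal c * (\<integral>\<^sup>+u. ennreal c * (\<integral>\<^sup>+v. f (c * u, c * v) \<partial>lborel) \<partial>lborel)"
    using assms by (subst nn_integral_real_affine[where c = c and t = 0]) auto
  also have "\<dots> = (\<integral>\<^sup>+u. \<integral>\<^sup>+v. ennreal (c\<^sup>2) * f (c * u, c * v) \<partial>lborel \<partial>lborel)"
    using assms by (simp add: nn_integral_cmult ennreal_mult power2_eq_square mult.assoc)
  also have "\<dots> = (\<integral>\<^sup>+p. ennreal (c\<^sup>2) * f (c * fst p, c * snd p) \<partial>(lborel \<Otimes>\<^sub>M lborel))"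
    by (subst lborel.nn_integral_fst[symmetric]) auto
  finally show ?thesis by (simp add: lborel_prod)
qed

text \<open>For \<open>u, v\<close> small, the probability that a uniform point lies in the set \<open>uncaught\<close> below.\<close>

definition uncaught_mass :: "real \<Rightarrow> real \<Rightarrow> real \<Rightarrow> real" where
  "uncaught_mass r u v = r / (r - 1) * u\<^sup>2 + r / (r - 1) * v\<^sup>2 + 2 * r\<^sup>2 * u * v"

text \<open>The linear factors are the densities of the excesses of two uniform points falling into
  the wedges, and the power is the probability that the other \<open>n - 2\<close> points avoid the
  uncaught set.\<close>

definition pair_integrand :: "real \<Rightarrow> real \<Rightarrow> nat \<Rightarrow> real \<times> real \<Rightarrow> real" where
  "pair_integrand r \<delta> n p = indicator ({0<..\<delta>} \<times> {0<..\<delta>}) p * (2 * (r / (r - 1)) * fst p) * (2 * (r / (r - 1)) * snd p)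
     * (1 - uncaught_mass r (fst p) (snd p)) ^ (n - 2)"

lemma pair_integrand_measurable [measurable]: "pair_integrand r \<delta> n \<in> borel_measurable borel"
proof -
  have "pair_integrand r \<delta> n \<in> borel_measurable (borel \<Otimes>\<^sub>M borel)"
    unfolding pair_integrand_def uncaught_mass_def by measurable
  then show ?thesis by (simp add: borel_prod)
qed

text \<open>The hypothesis \<open>le1\<close> keeps the base \<open>1 - uncaught_mass r u v\<close>
  nonnegative, so that \<open>1 - x \<le> exp (- x)\<close> may be raised to a power to produce the
  dominating function.\<close>

lemma tendsto_pair_integrand:
  assumes r: "1 < r" and "0 < \<delta>"
    and le1: "\<And>u v. 0 < u \<Longrightarrow> u \<le> \<delta> \<Longrightarrow> 0 < v \<Longrightarrow> v \<le> \<delta> \<Longrightarrow> uncaught_mass r u v \<le> 1"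
  shows "(\<lambda>n. ennreal (real n * (real n - 1)) * (\<integral>\<^sup>+u. \<integral>\<^sup>+v. ennreal (pair_integrand r \<delta> n (u, v)) \<partial>lborel \<partial>lborel))
    \<longlonglongrightarrow> ennreal (limit_prob r)"
\<comment> \<open>The shift turns the truncated \<open>n - 2\<close> into \<open>N + 1\<close>, and
  \<open>(N + 1) / (N + 3) \<ge> 1/3\<close> then holds for all \<open>N\<close>, so one exponential
  dominates every term.\<close>
proof (rule LIMSEQ_offset[where k = 3])
  define a where "a = r / (r - 1)"
  have a: "0 < a" using r by (simp add: a_def)
  \<comment> \<open>With this scale \<open>n\<close> times the uncaught mass is
    \<open>4/3 * Q p\<close>, which is the exponent in \<open>limit_prob\<close>.\<close>
  define c where "c N = 2 / sqrt (3 * (real N + 3))" for N :: nat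
  have c: "0 < c N" for N by (simp add: c_def)
  have c2: "(c N)\<^sup>2 = 4 / (3 * (real N + 3))" for N by (simp add: c_def power_divide)
  define h where "h N p = (real N + 3) * (real N + 2) * ((c N)\<^sup>2 * pair_integrand r \<delta> (N + 3) (c N * fst p, c N * snd p))"
    for N p
  define Q where "Q p = uncaught_mass r (fst p) (snd p)" for p :: "real \<times> real"
  have Q_scale: "uncaught_mass r (c N * fst p) (c N * snd p) = (c N)\<^sup>2 * Q p" for N p
    by (simp add: Q_def uncaught_mass_def algebra_simps power2_eq_square)
  have h_eq: "h N p = (if 0 < fst p \<and> 0 < snd p \<and> c N * fst p \<le> \<delta> \<and> c N * snd p \<le> \<delta>
      then (real N + 2) / (real N + 3) * (64 / 9) * a\<^sup>2 * fst p * snd p * (1 - 4 / 3 * Q p / (real N + 3)) ^ (N + 1) else 0)"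
    for N p
  proof -
    have "(real N + 3) * (real N + 2) * ((c N)\<^sup>2 * ((2 * a * (c N * fst p)) * (2 * a * (c N * snd p)) * X))
       = (real N + 2) / (real N + 3) * (64 / 9) * a\<^sup>2 * fst p * snd p * X" for X
    proof -
      have "(real N + 3) * (real N + 2) * ((c N)\<^sup>2 * ((2 * a * (c N * fst p)) * (2 * a * (c N * snd p)) * X))
        = (real N + 3) * (real N + 2) * ((c N)\<^sup>2 * (c N)\<^sup>2) * 4 * a\<^sup>2 * fst p * snd p * X"
        by (simp add: power2_eq_square algebra_simps)
      \<comment> \<open>Two factors \<open>c N\<close> come from the Jacobian and two from the
        linear densities; together they are \<open>16 / (9 * n\<^sup>2)\<close> with
        \<open>n = N + 3\<close>, against the prefactor \<open>n * (n - 1)\<close>.\<close>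
      also have "(real N + 3) * (real N + 2) * ((c N)\<^sup>2 * (c N)\<^sup>2) = (real N + 2) / (real N + 3) * (16 / 9)"
        unfolding c2 by (simp add: divide_simps) (simp add: algebra_simps)
      finally show ?thesis by simp
    qed
    moreover have "1 - uncaught_mass r (c N * fst p) (c N * snd p) = 1 - 4 / 3 * Q p / (real N + 3)"
      unfolding Q_scale c2 by simp
    ultimately show ?thesis
      unfolding h_def pair_integrand_def a_def[symmetric] using c[of N]
      by (auto simp: indicator_def zero_less_mult_iff)
  qed
  have h_nonneg: "0 \<le> h N p" for N p
  proof (cases "0 < fst p \<and> 0 < snd p \<and> c N * fst p \<le> \<delta> \<and> c N * snd p \<le> \<delta>")
    case True
    then have "uncaught_mass r (c N * fst p) (c N * snd p) \<le> 1"
      using c[of N] by (intro le1) auto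
    then have "0 \<le> 1 - 4 / 3 * Q p / (real N + 3)"
      unfolding Q_scale c2 by simp
    then show ?thesis unfolding h_eq using True a by simp
  next
    case False
    then show ?thesis unfolding h_eq by (simp only: if_False)
  qed
  \<comment> \<open>The rate \<open>4 * a / 9\<close> is \<open>4/3 * a\<close> times the loss
    \<open>1/3\<close> in the exponent. The factor 9 restores the prefactor, since
    \<open>9 * (8 * a / 9)\<^sup>2 = 64 / 9 * a\<^sup>2\<close>.\<close>
  let ?w = "\<lambda>p. 9 * (weibull_density (4 * a / 9) (fst p) * weibull_density (4 * a / 9) (snd p))"
  have h_le: "h N p \<le> ?w p" for N p
  proof (cases "0 < fst p \<and> 0 < snd p \<and> c N * fst p \<le> \<delta> \<and> c N * snd p \<le> \<delta>")
    case True
    then have "uncaught_mass r (c N * fst p) (c N * snd p) \<le> 1"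
      using c[of N] by (intro le1) auto
    then have y: "0 \<le> 1 - 4 / 3 * Q p / (real N + 3)"
      unfolding Q_scale c2 by simp
    have Q: "a * (fst p)\<^sup>2 + a * (snd p)\<^sup>2 \<le> Q p"
      unfolding Q_def uncaught_mass_def a_def[symmetric] using True by simp
    then have Q0: "0 \<le> Q p" using a by (smt (verit) mult_nonneg_nonneg zero_le_power2)
    have "(1 - 4 / 3 * Q p / (real N + 3)) ^ (N + 1) \<le> exp (- (4 / 3 * Q p / (real N + 3))) ^ (N + 1)"
      using y exp_ge_add_one_self[of "- (4 / 3 * Q p / (real N + 3))"] by (intro power_mono) auto
    also have "\<dots> = exp (- (4 / 3 * Q p * ((real N + 1) / (real N + 3))))"
      unfolding exp_of_nat_mult[symmetric] by (intro arg_cong[where f = exp]) (simp add: field_simps)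
    also have "\<dots> \<le> exp (- (4 / 3 * Q p * (1 / 3)))"
    proof -
      have "1 / 3 \<le> (real N + 1) / (real N + 3)" by (simp add: field_simps)
      then have "4 / 3 * Q p * (1 / 3) \<le> 4 / 3 * Q p * ((real N + 1) / (real N + 3))"
        using Q0 by (intro mult_left_mono) auto
      then show ?thesis by simp
    qed
    also have "\<dots> \<le> exp (- (4 * a / 9) * (fst p)\<^sup>2) * exp (- (4 * a / 9) * (snd p)\<^sup>2)"
      unfolding exp_add[symmetric] using Q by simp
    finally have X: "(1 - 4 / 3 * Q p / (real N + 3)) ^ (N + 1) \<le> exp (- (4 * a / 9) * (fst p)\<^sup>2) * exp (- (4 * a / 9) * (snd p)\<^sup>2)" .
    have "h N p \<le> 1 * ((64 / 9) * a\<^sup>2 * fst p * snd p * (exp (- (4 * a / 9) * (fst p)\<^sup>2) * exp (- (4 * a / 9) * (snd p)\<^sup>2)))"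
    proof -
      have "h N p = (real N + 2) / (real N + 3) * ((64 / 9) * a\<^sup>2 * fst p * snd p * (1 - 4 / 3 * Q p / (real N + 3)) ^ (N + 1))"
        unfolding h_eq using True by simp
      also have "\<dots> \<le> 1 * ((64 / 9) * a\<^sup>2 * fst p * snd p * (exp (- (4 * a / 9) * (fst p)\<^sup>2) * exp (- (4 * a / 9) * (snd p)\<^sup>2)))"
        using X True y a by (intro mult_mono) auto
      finally show ?thesis .
    qed
    also have "\<dots> = ?w p"
      using True by (simp add: weibull_density_def power2_eq_square)
    finally show ?thesis .
  next
    case False
    then show ?thesis unfolding h_eq using a weibull_density_nonneg[of "4 * a / 9"] by (simp only: if_False) simp
  qed
  have h_lim: "(\<lambda>N. h N p) \<longlonglongrightarrow> limit_density_pos r p" for p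
  proof (cases "0 < fst p \<and> 0 < snd p")
    case True
    have c0: "c \<longlonglongrightarrow> 0" unfolding c_def by real_asymp
    \<comment> \<open>Any fixed point eventually lies inside the rescaled window, so the limit does
      not depend on \<open>\<delta>\<close>.\<close>
    have "eventually (\<lambda>N. c N * x < \<delta>) sequentially" for x
      using tendsto_mult[OF c0 tendsto_const[of x]] \<open>0 < \<delta>\<close> by (simp add: order_tendsto_iff)
    from this[of "fst p"] this[of "snd p"]
    have "eventually (\<lambda>N. h N p = (real N + 2) / (real N + 3) * ((64 / 9) * a\<^sup>2 * fst p * snd p)
        * (1 - 4 / 3 * Q p / (real N + 3)) ^ (N + 1)) sequentially"
      by eventually_elim (use True in \<open>simp add: h_eq\<close>)
    moreover have "(\<lambda>N. (real N + 2) / (real N + 3) * ((64 / 9) * a\<^sup>2 * fst p * snd p)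
        * (1 - 4 / 3 * Q p / (real N + 3)) ^ (N + 1)) \<longlonglongrightarrow> 1 * ((64 / 9) * a\<^sup>2 * fst p * snd p) * exp (- (4 / 3 * Q p))"
    proof (intro tendsto_intros)
      show "(\<lambda>N. (real N + 2) / (real N + 3)) \<longlonglongrightarrow> 1" by real_asymp
      show "(\<lambda>N. (1 - 4 / 3 * Q p / (real N + 3)) ^ (N + 1)) \<longlonglongrightarrow> exp (- (4 / 3 * Q p))"
        by real_asymp
    qed
    moreover have "1 * ((64 / 9) * a\<^sup>2 * fst p * snd p) * exp (- (4 / 3 * Q p)) = limit_density_pos r p"
    proof -
      have "4 / 3 * Q p = 4 * r / (3 * (r - 1)) * ((fst p)\<^sup>2 + (snd p)\<^sup>2 + 2 * r * (r - 1) * fst p * snd p)"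
      proof -
        have "a * (r - 1) = r" using r by (simp add: a_def)
        moreover have "a * (2 * r * (r - 1) * fst p * snd p) = (a * (r - 1)) * (2 * r * fst p * snd p)"
          by (simp only: mult_ac)
        ultimately have "a * (2 * r * (r - 1) * fst p * snd p) = r * (2 * r * fst p * snd p)"
          by simp
        moreover have c_eq: "4 * r / (3 * (r - 1)) = 4 / 3 * a" by (simp add: a_def)
        ultimately show ?thesis unfolding Q_def uncaught_mass_def a_def[symmetric] c_eq
          by (simp add: algebra_simps power2_eq_square)
      qed
      then have "limit_density r (fst p) (snd p) = 64 * r\<^sup>2 / (9 * (r - 1)\<^sup>2) * fst p * snd p * exp (- (4 / 3 * Q p))"
        unfolding limit_density_def by (simp only: mult_minus_left)
      moreover have "64 / 9 * a\<^sup>2 = 64 * r\<^sup>2 / (9 * (r - 1)\<^sup>2)"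
        by (simp add: a_def power_divide)
      ultimately show ?thesis using True
        by (simp add: limit_density_pos_def mem_Times_iff del: times_divide_eq_left)
    qed
    ultimately show ?thesis by (simp add: tendsto_cong)
  next
    case False
    then have "h N p = 0" for N by (auto simp: h_eq)
    moreover have "limit_density_pos r p = 0"
      using False by (auto simp: limit_density_pos_def mem_Times_iff)
    ultimately show ?thesis by simp
  qed
  have h_meas [measurable]: "h N \<in> borel_measurable borel" for N
  proof -
    have [measurable]: "pair_integrand r \<delta> (N + 3) \<in> borel_measurable (borel \<Otimes>\<^sub>M borel)"
      by (simp add: borel_prod)
    have "h N \<in> borel_measurable (borel \<Otimes>\<^sub>M borel)" unfolding h_def by measurable
    then show ?thesis by (simp add: borel_prod)
  qed
  have "(\<lambda>N. \<integral>\<^sup>+p. ennreal (h N p) \<partial>lborel) \<longlonglongrightarrow> (\<integral>\<^sup>+p. ennreal (limit_density_pos r p) \<partial>lborel)"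
  proof (rule nn_integral_dominated_convergence[where w = "\<lambda>p. ennreal (?w p)"])
    have w: "integrable lborel ?w"
      using integrable_weibull_density_pair[of "4 * a / 9"] a by simp
    then show "(\<lambda>p. ennreal (?w p)) \<in> borel_measurable lborel"
      by (intro measurable_compose[OF borel_measurable_integrable measurable_ennreal])
    show "(\<integral>\<^sup>+p. ennreal (?w p) \<partial>lborel) < \<infinity>"
      using a by (subst nn_integral_eq_integral[OF w]) (auto simp: weibull_density_nonneg)
  qed (auto intro!: ennreal_leI h_le h_lim)
  also have "(\<integral>\<^sup>+p. ennreal (limit_density_pos r p) \<partial>lborel) = ennreal (limit_prob r)"
    unfolding limit_prob_eq_integral[OF r]
    by (rule nn_integral_eq_integral) (use r in \<open>auto simp: integrable_limit_density_pos limit_density_pos_nonneg\<close>)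
  also have "(\<lambda>N. \<integral>\<^sup>+p. ennreal (h N p) \<partial>lborel) = (\<lambda>N. ennreal (real (N + 3) * (real (N + 3) - 1)) *
      (\<integral>\<^sup>+u. \<integral>\<^sup>+v. ennreal (pair_integrand r \<delta> (N + 3) (u, v)) \<partial>lborel \<partial>lborel))"
  proof
    fix N
    have [measurable]: "pair_integrand r \<delta> (N + 3) \<in> borel_measurable (borel \<Otimes>\<^sub>M borel)"
      by (simp add: borel_prod)
    have "(\<lambda>p. ennreal ((c N)\<^sup>2) * ennreal (pair_integrand r \<delta> (N + 3) (c N * fst p, c N * snd p))) \<in> borel_measurable (borel \<Otimes>\<^sub>M borel)"
      by measurable
    then have meas: "(\<lambda>p. ennreal ((c N)\<^sup>2) * ennreal (pair_integrand r \<delta> (N + 3) (c N * fst p, c N * snd p))) \<in> borel_measurable borel"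
      by (simp add: borel_prod)
    have 1: "real (N + 3) * (real (N + 3) - 1) = (real N + 3) * (real N + 2)" by simp
    show "(\<integral>\<^sup>+p. ennreal (h N p) \<partial>lborel) = ennreal (real (N + 3) * (real (N + 3) - 1)) *
      (\<integral>\<^sup>+u. \<integral>\<^sup>+v. ennreal (pair_integrand r \<delta> (N + 3) (u, v)) \<partial>lborel \<partial>lborel)"
      unfolding 1
      by (subst nn_integral_scale_pair[OF _ c[of N]], measurable)
         (subst nn_integral_cmult[symmetric],
           use meas in \<open>simp_all add: h_def ennreal_mult'[symmetric] ennreal_mult''[symmetric]\<close>)
  qed
  finally show "(\<lambda>n. ennreal (real (n + 3) * (real (n + 3) - 1)) * (\<integral>\<^sup>+u. \<integral>\<^sup>+v. ennreal (pair_integrand r \<delta> (n + 3) (u, v)) \<partial>lborel \<partial>lborel))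
    \<longlonglongrightarrow> ennreal (limit_prob r)" .
qed

section \<open>Independent families\<close>

text \<open>Conditioning on the block \<open>I\<close>: given \<open>g\<close> of that block, the
  variables in \<open>J\<close> are still independent with law \<open>D\<close>, so their common
  condition contributes a power. A general \<open>g\<close> serves both one distinguished point
  (\<open>emeasure_single\<close>) and two (\<open>emeasure_pair\<close>).\<close>

lemma (in prob_space) emeasure_indep_all_in:
  assumes ind: "indep_vars (\<lambda>_. N) Z UNIV"
    and D: "\<And>i. distr M N (Z i) = D"
    and IJ: "I \<inter> J = {}" "finite J" "I \<noteq> {}"
    and g: "g \<in> PiM I (\<lambda>_. N) \<rightarrow>\<^sub>M L"
    and Q [measurable]: "Q \<in> sets L" and B [measurable]: "B \<in> sets (L \<Otimes>\<^sub>M N)"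
  shows "emeasure M {\<omega>\<in>space M. g (\<lambda>i\<in>I. Z i \<omega>) \<in> Q \<and> (\<forall>j\<in>J. (g (\<lambda>i\<in>I. Z i \<omega>), Z j \<omega>) \<in> B)}
    = (\<integral>\<^sup>+y. indicator Q y * emeasure D {z \<in> space N. (y, z) \<in> B} ^ card J \<partial>(distr M L (\<lambda>\<omega>. g (\<lambda>i\<in>I. Z i \<omega>))))"
proof -
  have Z [measurable]: "Z i \<in> M \<rightarrow>\<^sub>M N" for i
    using ind by (simp add: indep_vars_def)
  have sD [measurable_cong]: "sets D = sets N" using D[of undefined] by (metis sets_distr)
  have spD: "space D = space N" using sD by (rule sets_eq_imp_space_eq)
  have pD: "prob_space D" using prob_space_distr[OF Z] D by metis
  interpret D: prob_space D by fact
  let ?X = "\<lambda>\<omega>. \<lambda>i\<in>I. Z i \<omega>"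
  let ?Y = "\<lambda>\<omega>. g (\<lambda>i\<in>I. Z i \<omega>)" and ?R = "\<lambda>\<omega>. \<lambda>j\<in>J. Z j \<omega>"
  have [measurable]: "?Y \<in> M \<rightarrow>\<^sub>M L"
    using g by (rule measurable_compose[rotated]) measurable
  have "indep_var (PiM I (\<lambda>_. N)) (\<lambda>\<omega>. \<lambda>i\<in>I. Z i \<omega>) (PiM J (\<lambda>_. N)) ?R"
    by (rule indep_var_restrict[OF ind]) (use IJ in auto)
  then have dist: "distr M (PiM I (\<lambda>_. N)) ?X \<Otimes>\<^sub>M distr M (PiM J (\<lambda>_. N)) ?R
      = distr M (PiM I (\<lambda>_. N) \<Otimes>\<^sub>M PiM J (\<lambda>_. N)) (\<lambda>\<omega>. (?X \<omega>, ?R \<omega>))"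
    unfolding indep_var_distribution_eq by blast
  have RD: "distr M (PiM J (\<lambda>_. N)) ?R = PiM J (\<lambda>_. D)"
  proof (cases "J = {}")
    \<comment> \<open>For empty \<open>J\<close> both sides are probability measures on a one-point
      space. The case occurs in \<open>emeasure_pair_event\<close> when
      \<open>n = 2\<close>.\<close>
    case True
    interpret R: prob_space "distr M (PiM J (\<lambda>_. N)) ?R" by (rule prob_space_distr) measurable
    show ?thesis
    proof (rule measure_eqI)
      fix A assume A: "A \<in> sets (distr M (PiM J (\<lambda>_. N)) ?R)"
      then have "A = {} \<or> A = space (distr M (PiM J (\<lambda>_. N)) ?R)"
        using True sets.sets_into_space[OF A] by (auto simp: space_PiM_empty)
      then show "emeasure (distr M (PiM J (\<lambda>_. N)) ?R) A = emeasure (PiM J (\<lambda>_. D)) A"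
        using R.emeasure_space_1 True by (auto simp: space_PiM_empty emeasure_PiM_empty)
    qed (simp add: True sets_PiM_empty)
  next
    case False
    have "indep_vars (\<lambda>_. N) Z J" using ind by (rule indep_vars_subset) simp
    then show ?thesis
      using indep_vars_iff_distr_eq_PiM'[where I = J and M' = "\<lambda>_. N" and X = Z] False Z by (simp add: D)
  qed
  interpret PJ: prob_space "PiM J (\<lambda>_. D)" by (rule prob_space_PiM) (rule pD)
  let ?E = "{p \<in> space (PiM I (\<lambda>_. N) \<Otimes>\<^sub>M PiM J (\<lambda>_. D)). g (fst p) \<in> Q \<and> (\<forall>j\<in>J. (g (fst p), snd p j) \<in> B)}"
  have E [measurable]: "?E \<in> sets (PiM I (\<lambda>_. N) \<Otimes>\<^sub>M PiM J (\<lambda>_. D))"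
  proof (intro sets.sets_Collect_conj sets.sets_Collect_finite_All IJ)
    have gf: "(\<lambda>p. g (fst p)) \<in> PiM I (\<lambda>_. N) \<Otimes>\<^sub>M PiM J (\<lambda>_. D) \<rightarrow>\<^sub>M L"
      by (rule measurable_compose[OF measurable_fst g])
    show "{p \<in> space (PiM I (\<lambda>_. N) \<Otimes>\<^sub>M PiM J (\<lambda>_. D)). g (fst p) \<in> Q} \<in> sets (PiM I (\<lambda>_. N) \<Otimes>\<^sub>M PiM J (\<lambda>_. D))"
      using measurable_sets[OF gf Q] by (simp add: vimage_def Int_def conj_commute)
    fix j assume j: "j \<in> J"
    have "(\<lambda>p. snd p j) \<in> PiM I (\<lambda>_. N) \<Otimes>\<^sub>M PiM J (\<lambda>_. D) \<rightarrow>\<^sub>M D"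
      by (rule measurable_compose[OF measurable_snd measurable_component_singleton[OF j]])
    then have "(\<lambda>p. snd p j) \<in> PiM I (\<lambda>_. N) \<Otimes>\<^sub>M PiM J (\<lambda>_. D) \<rightarrow>\<^sub>M N"
      by (simp add: measurable_cong_sets[OF refl sD])
    with gf have "(\<lambda>p. (g (fst p), snd p j)) \<in> PiM I (\<lambda>_. N) \<Otimes>\<^sub>M PiM J (\<lambda>_. D) \<rightarrow>\<^sub>M L \<Otimes>\<^sub>M N"
      by (rule measurable_Pair)
    from measurable_sets[OF this B]
    show "{p \<in> space (PiM I (\<lambda>_. N) \<Otimes>\<^sub>M PiM J (\<lambda>_. D)). (g (fst p), snd p j) \<in> B} \<in> sets (PiM I (\<lambda>_. N) \<Otimes>\<^sub>M PiM J (\<lambda>_. D))"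
      by (simp add: vimage_def Int_def conj_commute)
  qed
  have sPJ: "sets (PiM J (\<lambda>_. N)) = sets (PiM J (\<lambda>_. D))"
    by (intro sets_PiM_cong) (auto simp: sD)
  define F where "F y = indicator Q y * emeasure D {z \<in> space N. (y, z) \<in> B} ^ card J" for y
  have [measurable]: "F \<in> borel_measurable L"
  proof -
    have "B \<subseteq> space L \<times> space N"
      using sets.sets_into_space[OF B] by (simp add: space_pair_measure)
    then have "{z \<in> space N. (y, z) \<in> B} = Pair y -` B" for y
      by auto
    then have "F = (\<lambda>y. indicator Q y * emeasure D (Pair y -` B) ^ card J)"
      by (simp add: F_def fun_eq_iff)
    moreover have "B \<in> sets (L \<Otimes>\<^sub>M D)"
      using B by (simp add: sets_pair_measure_cong[OF refl sD])
    ultimately show ?thesis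
      using D.measurable_emeasure_Pair[of B L] by simp
  qed
  have "{\<omega>\<in>space M. ?Y \<omega> \<in> Q \<and> (\<forall>j\<in>J. (?Y \<omega>, Z j \<omega>) \<in> B)} = (\<lambda>\<omega>. (?X \<omega>, ?R \<omega>)) -` ?E \<inter> space M"
    using measurable_space[OF Z]
    by (auto simp: space_pair_measure space_PiM spD PiE_def)
  then have "emeasure M {\<omega>\<in>space M. ?Y \<omega> \<in> Q \<and> (\<forall>j\<in>J. (?Y \<omega>, Z j \<omega>) \<in> B)}
     = emeasure (distr M (PiM I (\<lambda>_. N) \<Otimes>\<^sub>M PiM J (\<lambda>_. N)) (\<lambda>\<omega>. (?X \<omega>, ?R \<omega>))) ?E"
    by (subst emeasure_distr) (auto simp: sets_pair_measure_cong[OF refl sPJ])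
  also have "\<dots> = emeasure (distr M (PiM I (\<lambda>_. N)) ?X \<Otimes>\<^sub>M PiM J (\<lambda>_. D)) ?E"
    unfolding dist[symmetric] RD ..
  also have "\<dots> = (\<integral>\<^sup>+x. emeasure (PiM J (\<lambda>_. D)) (Pair x -` ?E) \<partial>distr M (PiM I (\<lambda>_. N)) ?X)"
    by (rule PJ.emeasure_pair_measure_alt) simp
  also have "\<dots> = (\<integral>\<^sup>+x. F (g x) \<partial>distr M (PiM I (\<lambda>_. N)) ?X)"
  proof (rule nn_integral_cong)
    fix x assume "x \<in> space (distr M (PiM I (\<lambda>_. N)) ?X)"
    then have x: "x \<in> space (PiM I (\<lambda>_. N))" by simp
    then have y: "g x \<in> space L" using measurable_space[OF g] by blast
    have [measurable]: "{z \<in> space N. (g x, z) \<in> B} \<in> sets N" using y by measurable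
    show "emeasure (PiM J (\<lambda>_. D)) (Pair x -` ?E) = F (g x)"
    proof (cases "g x \<in> Q")
      case True
      then have "Pair x -` ?E = PiE J (\<lambda>_. {z \<in> space N. (g x, z) \<in> B})"
        using x by (auto simp: space_pair_measure space_PiM[of J] spD PiE_def Pi_def)
      moreover have "emeasure (PiM J (\<lambda>_. D)) (PiE J (\<lambda>_. {z \<in> space N. (g x, z) \<in> B}))
          = (\<Prod>j\<in>J. emeasure D {z \<in> space N. (g x, z) \<in> B})"
      proof -
        interpret product_prob_space "\<lambda>_. D" J by unfold_locales
        show ?thesis using IJ by (intro emeasure_PiM) (auto simp: sD)
      qed
      ultimately show ?thesis using True by (simp add: F_def)
    qed (simp add: F_def)
  qed
  also have "\<dots> = (\<integral>\<^sup>+y. F y \<partial>distr M L ?Y)"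
    using g by (subst (1 2) nn_integral_distr) auto
  finally show ?thesis unfolding F_def .
qed

section \<open>Uniform points on the standard simplex\<close>

lemma borel_measurable_fst_real [measurable (raw)]:
  fixes f :: "'a \<Rightarrow> real \<times> real"
  shows "f \<in> borel_measurable M \<Longrightarrow> (\<lambda>x. fst (f x)) \<in> borel_measurable M"
  by (rule measurable_compose[OF _ borel_measurable_continuous_onI]) (auto intro: continuous_intros)

lemma borel_measurable_snd_real [measurable (raw)]:
  fixes f :: "'a \<Rightarrow> real \<times> real"
  shows "f \<in> borel_measurable M \<Longrightarrow> (\<lambda>x. snd (f x)) \<in> borel_measurable M"
  by (rule measurable_compose[OF _ borel_measurable_continuous_onI]) (auto intro: continuous_intros)

definition std_simplex :: "(real \<times> real) set" where
  "std_simplex = {z. 0 \<le> fst z \<and> 0 \<le> snd z \<and> fst z + snd z \<le> 1}"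

definition unif_simplex :: "(real \<times> real) measure" where
  "unif_simplex = uniform_measure lborel std_simplex"

lemma std_simplex_sets [measurable]: "std_simplex \<in> sets borel"
proof -
  have "{z \<in> space (borel \<Otimes>\<^sub>M borel). 0 \<le> (fst z :: real) \<and> 0 \<le> (snd z :: real) \<and> fst z + snd z \<le> 1} \<in> sets (borel \<Otimes>\<^sub>M borel)"
    by measurable
  then show ?thesis by (simp add: borel_prod std_simplex_def)
qed

lemma sets_unif_simplex [measurable_cong, simp]: "sets unif_simplex = sets borel"
  by (simp add: unif_simplex_def)

lemma space_unif_simplex [simp]: "space unif_simplex = UNIV"
  by (simp add: unif_simplex_def)

lemma nn_integral_lborel_pair:
  fixes f :: "real \<times> real \<Rightarrow> ennreal"
  assumes "f \<in> borel_measurable borel"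
  shows "(\<integral>\<^sup>+z. f z \<partial>lborel) = (\<integral>\<^sup>+x. \<integral>\<^sup>+y. f (x, y) \<partial>lborel \<partial>lborel)"
proof -
  have "f \<in> borel_measurable (lborel \<Otimes>\<^sub>M lborel)"
    using assms by (simp add: lborel_prod)
  from lborel.nn_integral_fst[OF this] show ?thesis by (simp add: lborel_prod)
qed

lemma emeasure_lborel_Times:
  fixes A B :: "real set"
  assumes "A \<in> sets borel" "B \<in> sets borel"
  shows "emeasure lborel (A \<times> B) = emeasure lborel A * emeasure lborel B"
  using lborel.emeasure_pair_measure_Times[of A lborel B] assms by (simp add: lborel_prod)

lemma emeasure_std_simplex: "emeasure lborel std_simplex = ennreal (1 / 2)"
proof -
  have "emeasure lborel std_simplex = (\<integral>\<^sup>+z. indicator std_simplex z \<partial>lborel)"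
    by simp
  also have "\<dots> = (\<integral>\<^sup>+x. \<integral>\<^sup>+y. indicator std_simplex (x, y) \<partial>lborel \<partial>lborel)"
    by (rule nn_integral_lborel_pair) simp
  also have "\<dots> = (\<integral>\<^sup>+x. ennreal (1 - x) * indicator {0..1} x \<partial>lborel)"
  proof (rule nn_integral_cong)
    fix x :: real
    have "(\<integral>\<^sup>+y. indicator std_simplex (x, y) \<partial>lborel) = (\<integral>\<^sup>+y. indicator {0..1} x * indicator {0..1 - x} y \<partial>lborel)"
      by (rule nn_integral_cong) (auto simp: std_simplex_def indicator_def)
    also have "\<dots> = indicator {0..1} x * emeasure lborel {0..1 - x}"
      by (simp add: nn_integral_cmult)
    also have "\<dots> = ennreal (1 - x) * indicator {0..1} x"
      by (auto simp: indicator_def)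
    finally show "(\<integral>\<^sup>+y. indicator std_simplex (x, y) \<partial>lborel) = ennreal (1 - x) * indicator {0..1} x" .
  qed
  also have "\<dots> = ennreal ((1 - 1\<^sup>2 / 2) - (0 - 0\<^sup>2 / 2))"
    by (rule nn_integral_FTC_Icc[where F = "\<lambda>x. x - x\<^sup>2 / 2"])
       (auto intro!: derivative_eq_intros)
  finally show ?thesis by simp
qed

lemma nn_integral_unif_simplex:
  assumes [measurable]: "f \<in> borel_measurable borel"
  shows "(\<integral>\<^sup>+z. f z \<partial>unif_simplex) = 2 * (\<integral>\<^sup>+z. f z * indicator std_simplex z \<partial>lborel)"
proof -
  have "inverse (ennreal (1 / 2)) = 2"
    by (subst inverse_ennreal) (auto simp flip: ennreal_numeral)
  then show ?thesis
    unfolding unif_simplex_def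
    by (subst nn_integral_uniform_measure)
       (auto simp: emeasure_std_simplex divide_ennreal_def mult.commute)
qed

lemma emeasure_unif_simplex:
  assumes [measurable]: "A \<in> sets borel"
  shows "emeasure unif_simplex A = 2 * emeasure lborel (A \<inter> std_simplex)"
proof -
  have "emeasure unif_simplex A = (\<integral>\<^sup>+z. indicator A z \<partial>unif_simplex)" by simp
  also have "\<dots> = 2 * (\<integral>\<^sup>+z. indicator A z * indicator std_simplex z \<partial>lborel)"
    by (rule nn_integral_unif_simplex) simp
  also have "(\<lambda>z. indicator A z * indicator std_simplex z) = (indicator (A \<inter> std_simplex) :: _ \<Rightarrow> ennreal)"
    by (auto simp: indicator_def)
  finally show ?thesis by simp
qed

lemma prob_space_unif_simplex: "prob_space unif_simplex"
  unfolding unif_simplex_def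
  by (rule prob_space_uniform_measure) (auto simp: emeasure_std_simplex)

interpretation unif_simplex: prob_space unif_simplex by (rule prob_space_unif_simplex)

lemma swap_measurable [measurable]: "prod.swap \<in> borel \<rightarrow>\<^sub>M (borel :: (real \<times> real) measure)"
proof -
  have "(\<lambda>z. (snd z, fst z)) \<in> borel \<rightarrow>\<^sub>M (borel :: (real \<times> real) measure)"
    by measurable
  then show ?thesis by (simp add: prod.swap_def[abs_def])
qed

lemma distr_swap_lborel: "distr lborel borel prod.swap = (lborel :: (real \<times> real) measure)"
proof -
  have "lborel \<Otimes>\<^sub>M lborel = distr (lborel \<Otimes>\<^sub>M lborel) (lborel \<Otimes>\<^sub>M (lborel :: real measure)) (\<lambda>(x, y). (y, x :: real))"
    by (rule lborel_pair.distr_pair_swap)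
  moreover have "prod.swap = (\<lambda>(x, y). (y, x :: real))" by (auto simp: fun_eq_iff)
  ultimately show ?thesis
    by (metis distr_cong lborel_prod sets_lborel)
qed

text \<open>The simplex is symmetric under exchange of \<open>p\<close> and \<open>q\<close>; this
  invariance transfers every fact about \<open>W1\<close> to \<open>W2\<close>.\<close>

lemma distr_swap_unif_simplex: "distr unif_simplex borel prod.swap = unif_simplex"
proof (rule measure_eqI)
  fix A assume "A \<in> sets (distr unif_simplex borel prod.swap)"
  then have [measurable]: "A \<in> sets borel" by simp
  have [measurable]: "prod.swap -` A \<in> sets borel"
    using measurable_sets[OF swap_measurable, of A] by simp
  have "emeasure (distr unif_simplex borel prod.swap) A = emeasure unif_simplex (prod.swap -` A)"
    by (subst emeasure_distr) auto
  also have "\<dots> = 2 * emeasure lborel (prod.swap -` (A \<inter> std_simplex))"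
  proof -
    have "prod.swap -` A \<inter> std_simplex = prod.swap -` (A \<inter> std_simplex)" by (auto simp: std_simplex_def)
    then show ?thesis by (simp add: emeasure_unif_simplex)
  qed
  also have "emeasure lborel (prod.swap -` (A \<inter> std_simplex)) = emeasure (distr lborel borel prod.swap) (A \<inter> std_simplex)"
    by (subst emeasure_distr) auto
  also have "2 * \<dots> = emeasure unif_simplex A"
    unfolding distr_swap_lborel by (simp add: emeasure_unif_simplex)
  finally show "emeasure (distr unif_simplex borel prod.swap) A = emeasure unif_simplex A" .
qed simp

lemma nn_integral_unif_simplex_swap:
  assumes "f \<in> borel_measurable borel"
  shows "(\<integral>\<^sup>+z. f (prod.swap z) \<partial>unif_simplex) = (\<integral>\<^sup>+z. f z \<partial>unif_simplex)"
  using nn_integral_distr[of prod.swap unif_simplex borel f] assms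
  by (simp add: distr_swap_unif_simplex)

lemma emeasure_unif_simplex_swap:
  assumes "A \<in> sets borel"
  shows "emeasure unif_simplex (prod.swap -` A) = emeasure unif_simplex A"
  using emeasure_distr[of prod.swap unif_simplex borel A] assms
  by (simp add: distr_swap_unif_simplex)

lemma uncaught_mass_nonneg: "1 < r \<Longrightarrow> 0 \<le> u \<Longrightarrow> 0 \<le> v \<Longrightarrow> 0 \<le> uncaught_mass r u v"
  by (simp add: uncaught_mass_def)

text \<open>
  In the coordinates \<open>(b\<^sub>p, b\<^sub>q)\<close> the triangle is \<open>std_simplex\<close>, the point \<open>M\<close> is \<open>(m, m)\<close>, and
  \<open>C1\<close>, \<open>C2\<close>, \<open>C3\<close> are the open vertex regions of \<open>y\<^sub>p\<close>, \<open>y\<^sub>q\<close>, \<open>y\<^sub>c\<close>. The wedges \<open>W1\<close> and \<open>W2\<close>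
  are the parts of \<open>C1\<close> and \<open>C2\<close> near \<open>M\<close>. The slice of \<open>W1\<close> at height \<open>u\<close> above \<open>m\<close> has
  length \<open>a u\<close>. The bounds on \<open>\<delta>\<close> keep the wedges inside the simplex and away from the strips
  that their points leave uncaught.
\<close>

locale pe_window =
  fixes r \<delta> :: real
  assumes r1: "1 < r" and r2: "r < 3/2"
    and \<delta>_pos: "0 < \<delta>" and \<delta>1: "\<delta> \<le> (1 - 1 / r)\<^sup>2" and \<delta>2: "r * \<delta> \<le> (3 - 2 * r) / 2"
begin

section \<open>Vertex regions in coordinates and the wedges at \<open>M\<close>\<close>

definition "m = 1 - 1 / r"

definition "a = r / (r - 1)"

lemma a_pos: "0 < a" using r1 by (simp add: a_def)

lemma m_pos: "0 < m" and m_less: "m < 1 / 3" and r_m: "r * m = r - 1"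
  using r1 r2 by (auto simp: m_def field_simps)

text \<open>From \<open>\<delta> \<le> m\<^sup>2\<close> and \<open>r * m = r - 1\<close>. Later
  \<open>r * \<delta> < m\<close> separates the parallelogram from the wedges, and
  \<open>\<delta> \<le> (r - 1) * m\<close> keeps the wedges inside the simplex.\<close>

lemma r_\<delta>: "r * \<delta> \<le> (r - 1) * m" "r * \<delta> < m" "\<delta> < m" "\<delta> \<le> (r - 1) * m"
proof -
  have "r * \<delta> \<le> r * m\<^sup>2" using \<delta>1 r1 by (simp add: m_def)
  then show *: "r * \<delta> \<le> (r - 1) * m" by (simp add: r_m[symmetric] power2_eq_square mult.assoc)
  have "(r - 1) * m < 1 * m" using r2 m_pos by (intro mult_strict_right_mono) auto
  with * show **: "r * \<delta> < m" by simp
  have "1 * \<delta> \<le> r * \<delta>" using r1 \<delta>_pos by (intro mult_right_mono) auto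
  with * ** show "\<delta> < m" "\<delta> \<le> (r - 1) * m" by auto
qed

text \<open>The inequalities name sides of two cevians. The line through \<open>y_c\<close> and
  \<open>M\<close> is the diagonal. On the line through \<open>y_q\<close> and \<open>M\<close> the
  ratio of \<open>b_p\<close> to \<open>b_c\<close> is \<open>(r - 1) / (2 - r)\<close>, which with
  \<open>b_c = 1 - b_p - b_q\<close> becomes \<open>fst z + (r - 1) * snd z = r - 1\<close>.\<close>

definition C1 :: "(real \<times> real) set" where
  "C1 = {z. snd z < fst z \<and> r - 1 < fst z + (r - 1) * snd z}"

definition C2 :: "(real \<times> real) set" where
  "C2 = prod.swap -` C1"

definition C3 :: "(real \<times> real) set" where
  "C3 = {z. fst z + (r - 1) * snd z < r - 1 \<and> snd z + (r - 1) * fst z < r - 1}"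

definition W1 :: "(real \<times> real) set" where
  "W1 = {z \<in> C1. fst z \<le> m + \<delta>}"

definition W2 :: "(real \<times> real) set" where
  "W2 = prod.swap -` W1"

lemma C1_sets [measurable]: "C1 \<in> sets borel"
proof -
  have "{z \<in> space (borel \<Otimes>\<^sub>M borel). snd z < fst z \<and> r - 1 < fst z + (r - 1) * snd z} \<in> sets (borel \<Otimes>\<^sub>M borel)"
    by measurable
  then show ?thesis by (simp add: borel_prod C1_def)
qed

lemma C2_sets [measurable]: "C2 \<in> sets borel"
  using measurable_sets[OF swap_measurable C1_sets] by (simp add: C2_def)

lemma C3_sets [measurable]: "C3 \<in> sets borel"
proof -
  have "{z \<in> space (borel \<Otimes>\<^sub>M borel). fst z + (r - 1) * snd z < r - 1 \<and> snd z + (r - 1) * fst z < r - 1} \<in> sets (borel \<Otimes>\<^sub>M borel)"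
    by measurable
  then show ?thesis by (simp add: borel_prod C3_def)
qed

lemma W1_sets [measurable]: "W1 \<in> sets borel"
proof -
  have "{z \<in> space (borel \<Otimes>\<^sub>M borel). snd z < fst z \<and> r - 1 < fst z + (r - 1) * snd z \<and> fst z \<le> m + \<delta>} \<in> sets (borel \<Otimes>\<^sub>M borel)"
    by measurable
  then show ?thesis by (simp add: borel_prod W1_def C1_def)
qed

lemma W2_sets [measurable]: "W2 \<in> sets borel"
  using measurable_sets[OF swap_measurable W1_sets] by (simp add: W2_def)

lemma W1_iff: "(x, y) \<in> W1 \<longleftrightarrow> x \<le> m + \<delta> \<and> 1 - x / (r - 1) < y \<and> y < x"
proof -
  have "r - 1 < x + (r - 1) * y \<longleftrightarrow> 1 - x / (r - 1) < y"
    using r1 by (simp add: field_simps)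
  then show ?thesis by (auto simp: W1_def C1_def)
qed

text \<open>\<open>M\<close> is the lowest corner of the region: the two inequalities of
  \<open>C1\<close> combine to \<open>r - 1 < r * fst z\<close>. Hence every excess is
  positive.\<close>

lemma C1_fst: "z \<in> C1 \<Longrightarrow> m < fst z"
proof -
  assume "z \<in> C1"
  then have *: "snd z < fst z" "r - 1 < fst z + (r - 1) * snd z" by (auto simp: C1_def)
  have "(r - 1) * snd z < (r - 1) * fst z" using * r1 by (intro mult_strict_left_mono) auto
  with * have "r * m < r * fst z" by (simp add: r_m algebra_simps)
  then show ?thesis using r1 by simp
qed

lemma W1_fst: "z \<in> W1 \<Longrightarrow> m < fst z \<and> fst z \<le> m + \<delta>"
  using C1_fst by (auto simp: W1_def)

lemma W2_snd: "z \<in> W2 \<Longrightarrow> m < snd z \<and> snd z \<le> m + \<delta>"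
  using W1_fst[of "prod.swap z"] by (auto simp: W2_def)

lemma W1_subset: "W1 \<subseteq> std_simplex"
proof
  fix z assume z: "z \<in> W1"
  then have *: "fst z \<le> m + \<delta>" "1 - fst z / (r - 1) < snd z" "snd z < fst z"
    using W1_iff[of "fst z" "snd z"] by auto
  \<comment> \<open>The lower end \<open>1 - fst z / (r - 1)\<close> of the slice is nonnegative as
    long as \<open>fst z \<le> r - 1\<close>, and \<open>r - 1 = m + (r - 1) * m\<close>.\<close>
  have "fst z / (r - 1) \<le> (m + (r - 1) * m) / (r - 1)"
    using * r_\<delta> r1 by (intro divide_right_mono) auto
  also have "(m + (r - 1) * m) / (r - 1) = 1" using r1 r_m by (simp add: algebra_simps)
  finally have "0 \<le> snd z" using * by simp
  moreover have "0 \<le> fst z" using W1_fst[OF z] m_pos by simp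
  moreover have "fst z + snd z \<le> 1" 
  proof -
    \<comment> \<open>\<open>m + \<delta> < 1/3 + 1/9 < 1/2\<close>, and
      \<open>snd z < fst z\<close>, so the sum stays below 1.\<close>
    have "\<delta> \<le> m\<^sup>2" using \<delta>1 by (simp add: m_def)
    also have "m\<^sup>2 \<le> (1/3)\<^sup>2" using m_less m_pos by (intro power_mono) auto
    finally show ?thesis using * m_less by (simp add: power2_eq_square)
  qed
  ultimately show "z \<in> std_simplex" by (simp add: std_simplex_def)
qed

text \<open>Tonelli along slices: both sides of the wedge pass through \<open>(m, m)\<close>, so the
  slice at excess \<open>u\<close> has length proportional to \<open>u\<close>, with factor
  \<open>1 + 1 / (r - 1) = a\<close>. The 2 is the density of the uniform law on a simplex of area
  1/2.\<close>

lemma nn_integral_W1: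
  assumes [measurable]: "F \<in> borel_measurable borel"
  shows "(\<integral>\<^sup>+z. indicator W1 z * F (fst z) \<partial>unif_simplex)
     = (\<integral>\<^sup>+u. ennreal (indicator {0<..\<delta>} u * (2 * a * u)) * F (m + u) \<partial>lborel)"
proof -
  have [measurable]: "(\<lambda>z. F (fst z)) \<in> borel_measurable (borel :: (real \<times> real) measure)"
  proof -
    have "(\<lambda>z. F (fst z)) \<in> borel_measurable (borel \<Otimes>\<^sub>M (borel :: real measure))" by measurable
    then show ?thesis by (simp add: borel_prod)
  qed
  have "(\<integral>\<^sup>+z. indicator W1 z * F (fst z) \<partial>unif_simplex)
      = 2 * (\<integral>\<^sup>+z. indicator W1 z * F (fst z) * indicator std_simplex z \<partial>lborel)"
    by (rule nn_integral_unif_simplex) measurable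
  also have "(\<integral>\<^sup>+z. indicator W1 z * F (fst z) * indicator std_simplex z \<partial>lborel)
      = (\<integral>\<^sup>+z. indicator W1 z * F (fst z) \<partial>lborel)"
    by (rule nn_integral_cong) (use W1_subset in \<open>auto simp: indicator_def\<close>)
  also have "\<dots> = (\<integral>\<^sup>+x. \<integral>\<^sup>+y. indicator W1 (x, y) * F (fst (x, y)) \<partial>lborel \<partial>lborel)"
    by (rule nn_integral_lborel_pair) measurable
  also have "\<dots> = (\<integral>\<^sup>+x. ennreal (indicator {m<..m + \<delta>} x * (a * (x - m))) * F x \<partial>lborel)"
  proof (rule nn_integral_cong)
    fix x :: real
    have len: "x - (1 - x / (r - 1)) = a * (x - m)"
      using r1 by (simp add: a_def m_def field_simps)
    have "(\<integral>\<^sup>+y. indicator W1 (x, y) * F (fst (x, y)) \<partial>lborel)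
        = (\<integral>\<^sup>+y. (F x * indicator {..m + \<delta>} x) * indicator {1 - x / (r - 1)<..<x} y \<partial>lborel)"
      by (rule nn_integral_cong) (auto simp: W1_iff indicator_def)
    also have "\<dots> = F x * indicator {..m + \<delta>} x * emeasure lborel {1 - x / (r - 1)<..<x}"
      by (simp add: nn_integral_cmult)
    also have "\<dots> = ennreal (indicator {m<..m + \<delta>} x * (a * (x - m))) * F x"
    proof (cases "m < x")
      case True
      then have "1 - x / (r - 1) \<le> x" using len a_pos by (smt (verit) mult_pos_pos)
      then show ?thesis using True len by (auto simp: indicator_def mult.commute)
    next
      case False
      then have "x \<le> 1 - x / (r - 1)" using len a_pos
        by (smt (verit) mult_nonneg_nonneg mult_minus_right)
      then show ?thesis using False by (auto simp: indicator_def)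
    qed
    finally show "(\<integral>\<^sup>+y. indicator W1 (x, y) * F (fst (x, y)) \<partial>lborel)
       = ennreal (indicator {m<..m + \<delta>} x * (a * (x - m))) * F x" .
  qed
  also have "\<dots> = (\<integral>\<^sup>+u. ennreal (indicator {0<..\<delta>} u * (a * u)) * F (m + u) \<partial>lborel)"
    by (subst nn_integral_real_affine[where c = 1 and t = m]) (auto simp: indicator_def intro!: nn_integral_cong)
  also have "2 * \<dots> = (\<integral>\<^sup>+u. 2 * (ennreal (indicator {0<..\<delta>} u * (a * u)) * F (m + u)) \<partial>lborel)"
    by (subst nn_integral_cmult) auto
  also have "\<dots> = (\<integral>\<^sup>+u. ennreal (indicator {0<..\<delta>} u * (2 * a * u)) * F (m + u) \<partial>lborel)"
  proof (rule nn_integral_cong)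
    fix u :: real
    have "2 * ennreal (indicator {0<..\<delta>} u * (a * u)) = ennreal (2 * (indicator {0<..\<delta>} u * (a * u)))"
      using a_pos by (subst ennreal_mult) (auto simp: indicator_def)
    also have "2 * (indicator {0<..\<delta>} u * (a * u)) = indicator {0<..\<delta>} u * (2 * a * u)"
      by (simp add: indicator_def)
    finally show "2 * (ennreal (indicator {0<..\<delta>} u * (a * u)) * F (m + u)) = ennreal (indicator {0<..\<delta>} u * (2 * a * u)) * F (m + u)"
      by (metis mult.assoc)
  qed
  finally show ?thesis .
qed

lemma nn_integral_W2:
  assumes [measurable]: "F \<in> borel_measurable borel"
  shows "(\<integral>\<^sup>+z. indicator W2 z * F (snd z) \<partial>unif_simplex)
     = (\<integral>\<^sup>+u. ennreal (indicator {0<..\<delta>} u * (2 * a * u)) * F (m + u) \<partial>lborel)"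
proof -
  have [measurable]: "(\<lambda>z. F (fst z)) \<in> borel_measurable (borel :: (real \<times> real) measure)"
  proof -
    have "(\<lambda>z. F (fst z)) \<in> borel_measurable (borel \<Otimes>\<^sub>M (borel :: real measure))" by measurable
    then show ?thesis by (simp add: borel_prod)
  qed
  have "(\<integral>\<^sup>+z. indicator W2 z * F (snd z) \<partial>unif_simplex)
     = (\<integral>\<^sup>+z. (\<lambda>z. indicator W1 z * F (fst z)) (prod.swap z) \<partial>unif_simplex)"
    by (rule nn_integral_cong) (auto simp: W2_def indicator_def)
  also have "\<dots> = (\<integral>\<^sup>+z. indicator W1 z * F (fst z) \<partial>unif_simplex)"
    by (rule nn_integral_unif_simplex_swap) measurable
  finally show ?thesis using nn_integral_W1[OF assms] by simp
qed

text \<open>The two sets differ by a null slice. The closed version at \<open>u = \<delta>\<close>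
  measures the whole wedge; the open one enters \<open>uncaught\<close>, which cuts the wedges off
  strictly below the extremal points.\<close>

lemma emeasure_W1_below:
  assumes "0 \<le> u" "u \<le> \<delta>"
  shows "emeasure unif_simplex {z \<in> W1. fst z \<le> m + u} = ennreal (a * u\<^sup>2)"
    and "emeasure unif_simplex {z \<in> W1. fst z < m + u} = ennreal (a * u\<^sup>2)"
proof -
  have "{z \<in> space borel. z \<in> W1 \<and> fst z \<le> m + u} \<in> sets borel" "{z \<in> space borel. z \<in> W1 \<and> fst z < m + u} \<in> sets borel"
    by measurable
  then have [measurable]: "{z \<in> W1. fst z \<le> m + u} \<in> sets borel" "{z \<in> W1. fst z < m + u} \<in> sets borel"
    by simp_all
  have *: "(\<integral>\<^sup>+v. ennreal (2 * a * v) * indicator {0..u} v \<partial>lborel) = ennreal (a * u\<^sup>2)"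
    using assms a_pos
    by (subst nn_integral_FTC_Icc[where F = "\<lambda>v. a * v\<^sup>2"]) (auto intro!: derivative_eq_intros)
  have "emeasure unif_simplex {z \<in> W1. fst z \<le> m + u} = (\<integral>\<^sup>+z. indicator {z \<in> W1. fst z \<le> m + u} z \<partial>unif_simplex)"
    by simp
  also have "\<dots> = (\<integral>\<^sup>+z. indicator W1 z * indicator {..m + u} (fst z) \<partial>unif_simplex)"
    by (rule nn_integral_cong) (auto simp: indicator_def)
  also have "\<dots> = (\<integral>\<^sup>+v. ennreal (indicator {0<..\<delta>} v * (2 * a * v)) * indicator {..m + u} (m + v) \<partial>lborel)"
    by (rule nn_integral_W1) simp
  also have "\<dots> = (\<integral>\<^sup>+v. ennreal (2 * a * v) * indicator {0..u} v \<partial>lborel)"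
    by (rule nn_integral_cong) (use assms in \<open>auto simp: indicator_def\<close>)
  finally show "emeasure unif_simplex {z \<in> W1. fst z \<le> m + u} = ennreal (a * u\<^sup>2)" using * by simp
  have "emeasure unif_simplex {z \<in> W1. fst z < m + u} = (\<integral>\<^sup>+z. indicator {z \<in> W1. fst z < m + u} z \<partial>unif_simplex)"
    by simp
  also have "\<dots> = (\<integral>\<^sup>+z. indicator W1 z * indicator {..<m + u} (fst z) \<partial>unif_simplex)"
    by (rule nn_integral_cong) (auto simp: indicator_def)
  also have "\<dots> = (\<integral>\<^sup>+v. ennreal (indicator {0<..\<delta>} v * (2 * a * v)) * indicator {..<m + u} (m + v) \<partial>lborel)"
    by (rule nn_integral_W1) simp
  also have "\<dots> = (\<integral>\<^sup>+v. ennreal (2 * a * v) * indicator {0..u} v \<partial>lborel)"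
  proof (rule nn_integral_cong_AE)
    show "AE v in lborel. ennreal (indicator {0<..\<delta>} v * (2 * a * v)) * indicator {..<m + u} (m + v) = ennreal (2 * a * v) * indicator {0..u} v"
      using AE_lborel_singleton[of u] by eventually_elim (use assms in \<open>auto simp: indicator_def\<close>)
  qed
  finally show "emeasure unif_simplex {z \<in> W1. fst z < m + u} = ennreal (a * u\<^sup>2)" using * by simp
qed

lemma emeasure_W1: "emeasure unif_simplex W1 = ennreal (a * \<delta>\<^sup>2)"
proof -
  have "{z \<in> W1. fst z \<le> m + \<delta>} = W1" by (auto simp: W1_def)
  with emeasure_W1_below(1)[of \<delta>] \<delta>_pos show ?thesis by simp
qed

text \<open>
  The points that no other sample point may be if \<open>z1\<close> and \<open>z2\<close> are to be the extremal points of
  \<open>W1\<close> and \<open>W2\<close> and to dominate together.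
\<close>

definition uncaught :: "real \<times> real \<Rightarrow> real \<times> real \<Rightarrow> (real \<times> real) set" where
  "uncaught z1 z2 = {p \<in> W1. fst p < fst z1} \<union> {p \<in> W2. snd p < snd z2}
     \<union> {p. fst p < r * (fst z1 - m) \<and> snd p < r * (snd z2 - m)}"

lemma pred_uncaught [measurable]:
  "Measurable.pred ((borel \<Otimes>\<^sub>M borel) \<Otimes>\<^sub>M borel) (\<lambda>q. snd q \<in> uncaught (fst (fst q)) (snd (fst q)))"
  unfolding uncaught_def by simp

lemma uncaught_sets [measurable]: "uncaught z1 z2 \<in> sets borel"
proof -
  have "(\<lambda>p. ((z1, z2), p)) \<in> borel \<rightarrow>\<^sub>M (borel \<Otimes>\<^sub>M borel) \<Otimes>\<^sub>M borel"
    by (intro measurable_Pair measurable_const measurable_ident) auto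
  from measurable_compose[OF this pred_uncaught]
  have "Measurable.pred borel (\<lambda>p. p \<in> uncaught z1 z2)" by simp
  then show ?thesis by (simp add: pred_def)
qed

text \<open>The three pieces are disjoint: the wedges lie on opposite sides of the diagonal, and
  each has a coordinate above \<open>m\<close>, whereas both coordinates are below \<open>m\<close>
  in the parallelogram. Their masses are the three terms of \<open>uncaught_mass\<close>.\<close>

lemma emeasure_uncaught:
  assumes "z1 \<in> W1" "z2 \<in> W2"
  shows "emeasure unif_simplex (uncaught z1 z2) = ennreal (uncaught_mass r (fst z1 - m) (snd z2 - m))"
proof -
  define u v where "u = fst z1 - m" and "v = snd z2 - m"
  have u: "0 < u" "u \<le> \<delta>" and v: "0 < v" "v \<le> \<delta>"
    using W1_fst[OF assms(1)] W2_snd[OF assms(2)] by (auto simp: u_def v_def)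
  have ru: "r * u < m" "r * v < m"
  proof -
    have "r * u \<le> r * \<delta>" "r * v \<le> r * \<delta>" using u v r1 by auto
    with r_\<delta>(2) show "r * u < m" "r * v < m" by auto
  qed
  let ?A = "{p \<in> W1. fst p < m + u}" and ?B = "{p \<in> W2. snd p < m + v}" and ?C = "{p :: real \<times> real. fst p < r * u \<and> snd p < r * v}"
  have eq: "uncaught z1 z2 = ?A \<union> ?B \<union> ?C" by (simp add: uncaught_def u_def v_def)
  have "{p \<in> space borel. p \<in> W1 \<and> fst p < m + u} \<in> sets borel" "{p \<in> space borel. p \<in> W2 \<and> snd p < m + v} \<in> sets borel"
    "{p \<in> space borel. fst p < r * u \<and> snd p < r * v} \<in> sets borel"
    by measurable
  then have [measurable]: "?A \<in> sets borel" "?B \<in> sets borel" "?C \<in> sets borel" by simp_all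
  have "?A \<inter> ?B = {}" by (auto simp: W2_def W1_def C1_def)
  moreover have "(?A \<union> ?B) \<inter> ?C = {}"
    using ru W1_fst W2_snd by fastforce
  ultimately have "emeasure unif_simplex (uncaught z1 z2) = emeasure unif_simplex ?A + emeasure unif_simplex ?B + emeasure unif_simplex ?C"
    unfolding eq by (subst plus_emeasure[symmetric], simp, simp, simp, subst plus_emeasure[symmetric]) auto
  also have "emeasure unif_simplex ?A = ennreal (a * u\<^sup>2)"
    using u by (intro emeasure_W1_below) auto
  also have "emeasure unif_simplex ?B = ennreal (a * v\<^sup>2)"
  proof -
    have "?B = prod.swap -` {p \<in> W1. fst p < m + v}" by (auto simp: W2_def)
    moreover have "{p \<in> W1. fst p < m + v} = W1 \<inter> {z. fst z < m + v}" by auto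
    ultimately show ?thesis
      using v emeasure_W1_below(2)[of v] by (subst (asm) emeasure_unif_simplex_swap[symmetric]) simp_all
  qed
  also have "emeasure unif_simplex ?C = ennreal (2 * r\<^sup>2 * u * v)"
  proof -
    \<comment> \<open>\<open>?C\<close> is unbounded below; inside the simplex it is a full
      rectangle, as \<open>r * u + r * v < 2 * m < 1\<close>.\<close>
    have "?C \<inter> std_simplex = {0..<r * u} \<times> {0..<r * v}"
      using ru m_less by (auto simp: std_simplex_def)
    then have "emeasure unif_simplex ?C = 2 * (ennreal (r * u) * ennreal (r * v))"
      using u v r1 by (simp add: emeasure_unif_simplex emeasure_lborel_Times)
    also have "\<dots> = ennreal (2 * ((r * u) * (r * v)))"
      using u v r1 by (simp add: ennreal_mult)
    finally show ?thesis by (simp add: power2_eq_square mult_ac)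
  qed
  also have "ennreal (a * u\<^sup>2) + ennreal (a * v\<^sup>2) + ennreal (2 * r\<^sup>2 * u * v) = ennreal (uncaught_mass r u v)"
  proof -
    have "0 \<le> a * u\<^sup>2" "0 \<le> a * v\<^sup>2" "0 \<le> 2 * r\<^sup>2 * u * v"
      using u v r1 a_pos by auto
    then show ?thesis
      unfolding uncaught_mass_def a_def[symmetric] by (metis add_nonneg_nonneg ennreal_plus)
  qed
  finally show ?thesis by (simp only: u_def v_def)
qed

lemma emeasure_not_uncaught:
  assumes "z1 \<in> W1" "z2 \<in> W2"
  shows "emeasure unif_simplex {p. p \<notin> uncaught z1 z2} = ennreal (1 - uncaught_mass r (fst z1 - m) (snd z2 - m))"
proof -
  have "emeasure unif_simplex {p. p \<notin> uncaught z1 z2} = emeasure unif_simplex (space unif_simplex - uncaught z1 z2)"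
    by (intro arg_cong[where f = "emeasure unif_simplex"]) auto
  also have "\<dots> = emeasure unif_simplex (space unif_simplex) - emeasure unif_simplex (uncaught z1 z2)"
    by (rule emeasure_compl) (simp_all add: uncaught_sets)
  also have "\<dots> = 1 - ennreal (uncaught_mass r (fst z1 - m) (snd z2 - m))"
    unfolding emeasure_uncaught[OF assms] unif_simplex.emeasure_space_1 ..
  also have "\<dots> = ennreal (1 - uncaught_mass r (fst z1 - m) (snd z2 - m))"
  proof -
    have "0 \<le> uncaught_mass r (fst z1 - m) (snd z2 - m)"
      using W1_fst[OF assms(1)] W2_snd[OF assms(2)] r1 by (intro uncaught_mass_nonneg) auto
    from ennreal_minus[OF this, of 1] show ?thesis by simp
  qed
  finally show ?thesis .
qed

text \<open>The value is a probability: midpoints of wedge slices supply points \<open>z1\<close>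
  and \<open>z2\<close> with the prescribed excesses.\<close>

lemma uncaught_mass_le_1:
  assumes "0 < u" "u \<le> \<delta>" "0 < v" "v \<le> \<delta>"
  shows "uncaught_mass r u v \<le> 1"
proof -
  have x: "(m + u, (1 - (m + u) / (r - 1) + (m + u)) / 2) \<in> W1" if "0 < u" "u \<le> \<delta>" for u
  proof -
    have "m + u - (1 - (m + u) / (r - 1)) = a * u"
      using r1 by (simp add: a_def m_def field_simps)
    moreover have "0 < a * u" using a_pos that by simp
    ultimately have less: "1 - (m + u) / (r - 1) < m + u" by linarith
    have mid: "x < (x + y) / 2 \<and> (x + y) / 2 < y" if "x < y" for x y :: real
      using that by simp
    show ?thesis unfolding W1_iff using mid[OF less] that(2) by simp
  qed
  define z1 z2 where "z1 = (m + u, (1 - (m + u) / (r - 1) + (m + u)) / 2)"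
    and "z2 = prod.swap (m + v, (1 - (m + v) / (r - 1) + (m + v)) / 2)"
  have "z1 \<in> W1" "z2 \<in> W2"
    using x[of u] x[of v] assms by (auto simp: z1_def z2_def W2_def)
  from emeasure_uncaught[OF this] unif_simplex.emeasure_le_1[of "uncaught z1 z2"]
  have "ennreal (uncaught_mass r u v) \<le> ennreal 1"
    by (simp add: z1_def z2_def)
  then show ?thesis by (subst (asm) ennreal_le_iff) auto
qed

end

section \<open>Asymptotics for independent uniform points\<close>

lemma null_vertical_line: "emeasure unif_simplex {z. fst z = c} = 0"
proof -
  have 1: "{z :: real \<times> real. fst z = c} = {c} \<times> UNIV" by auto
  have "emeasure lborel {z :: real \<times> real. fst z = c} = 0"
    unfolding 1 by (simp add: emeasure_lborel_Times)
  moreover have "{z \<in> space (borel :: (real \<times> real) measure). fst z = c} \<in> sets borel"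
    by measurable
  ultimately have "emeasure lborel ({z. fst z = c} \<inter> std_simplex) \<le> 0"
    by (metis (no_types, lifting) Int_lower1 UNIV_I emeasure_mono mem_Collect_eq sets_lborel space_borel Collect_cong)
  with \<open>{z \<in> space (borel :: (real \<times> real) measure). fst z = c} \<in> sets borel\<close>
  show ?thesis by (simp add: emeasure_unif_simplex)
qed

context pe_window
begin

text \<open>A box of points that neither \<open>z \<in> W1\<close> nor any point of \<open>C3\<close> catches.\<close>

definition strip :: "real \<times> real \<Rightarrow> (real \<times> real) set" where
  "strip z = {p. 0 < fst p \<and> fst p < r * (fst z - m) \<and> 2 * r - 2 < snd p \<and> snd p < 1 - r * \<delta>}"

lemma pred_strip [measurable]: "Measurable.pred (borel \<Otimes>\<^sub>M borel) (\<lambda>q. snd q \<in> strip (fst q))"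
  unfolding strip_def by simp

end

locale pe_iid = pe_window r \<delta> + prob_space P
  for r \<delta> and P :: "'a measure" +
  fixes Z :: "nat \<Rightarrow> 'a \<Rightarrow> real \<times> real"
  assumes indep_Z: "indep_vars (\<lambda>_. borel) Z UNIV"
    and law_Z: "\<And>i. distr P borel (Z i) = unif_simplex"
begin

lemma Z_measurable [measurable]: "Z i \<in> borel_measurable P"
  using indep_Z by (simp add: indep_vars_def)

text \<open>Exchanging the labels \<open>p\<close> and \<open>q\<close> gives another sample of the
  same kind, so results on first coordinates also hold for second coordinates.\<close>

lemma pe_iid_swap: "pe_iid r \<delta> P (\<lambda>i \<omega>. prod.swap (Z i \<omega>))"
proof unfold_locales
  show "indep_vars (\<lambda>_. borel) (\<lambda>i \<omega>. prod.swap (Z i \<omega>)) UNIV"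
    by (rule indep_vars_compose2[OF indep_Z]) simp
  show "distr P borel (\<lambda>\<omega>. prod.swap (Z i \<omega>)) = unif_simplex" for i
  proof -
    have "distr P borel (\<lambda>\<omega>. prod.swap (Z i \<omega>)) = distr (distr P borel (Z i)) borel prod.swap"
      by (subst distr_distr) (auto simp: comp_def)
    then show ?thesis by (simp add: law_Z distr_swap_unif_simplex)
  qed
qed

lemma emeasure_single:
  assumes "Q \<in> sets borel" "B \<in> sets (borel \<Otimes>\<^sub>M borel)" "finite J" "i \<notin> J"
  shows "emeasure P {\<omega>\<in>space P. Z i \<omega> \<in> Q \<and> (\<forall>j\<in>J. (Z i \<omega>, Z j \<omega>) \<in> B)}
    = (\<integral>\<^sup>+z. indicator Q z * emeasure unif_simplex {p. (z, p) \<in> B} ^ card J \<partial>unif_simplex)"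
  using emeasure_indep_all_in[OF indep_Z law_Z _ _ _ _ assms(1,2), where I = "{i}" and J = J and g = "\<lambda>f. f i"] assms(3,4)
  by (simp add: law_Z)

lemma emeasure_none_in:
  assumes A [measurable]: "A \<in> sets borel"
  shows "emeasure P {\<omega>\<in>space P. \<forall>j<n. Z j \<omega> \<notin> A} = emeasure unif_simplex (- A) ^ n"
proof -
  have B: "UNIV \<times> (- A) \<in> sets (borel \<Otimes>\<^sub>M borel)"
    by (intro pair_measureI) (use A in \<open>auto simp: borel_comp\<close>)
  \<comment> \<open>\<open>emeasure_single\<close> singles out one index; \<open>n\<close> lies
    outside \<open>{..<n}\<close> and acts as a dummy with the trivial condition
    \<open>UNIV\<close>.\<close>
  have "emeasure P {\<omega>\<in>space P. Z n \<omega> \<in> UNIV \<and> (\<forall>j\<in>{..<n}. (Z n \<omega>, Z j \<omega>) \<in> UNIV \<times> (- A))}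
      = (\<integral>\<^sup>+z. indicator UNIV z * emeasure unif_simplex {p. (z, p) \<in> UNIV \<times> (- A)} ^ card {..<n} \<partial>unif_simplex)"
    by (rule emeasure_single) (use B in auto)
  then show ?thesis
    by (simp add: unif_simplex.emeasure_space_1[simplified] Compl_eq Ball_def)
qed

text \<open>Each point falls into \<open>W1\<close> with fixed probability
  \<open>a * \<delta>\<^sup>2\<close>, so avoidance decays geometrically. This justifies looking
  only at points inside the window.\<close>

lemma prob_none_in_W1_tendsto: "(\<lambda>n. prob {\<omega>\<in>space P. \<forall>j<n. Z j \<omega> \<notin> W1}) \<longlonglongrightarrow> 0"
proof -
  define q where "q = unif_simplex.prob (- W1)"
  have "unif_simplex.prob W1 = a * \<delta>\<^sup>2"
    using emeasure_W1 a_pos by (simp add: measure_def)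
  then have "q = 1 - a * \<delta>\<^sup>2"
    using unif_simplex.prob_compl[of W1] by (simp add: q_def Compl_eq_Diff_UNIV)
  moreover have "0 < a * \<delta>\<^sup>2" using a_pos \<delta>_pos by simp
  ultimately have "q < 1" by simp
  moreover have "0 \<le> q" by (simp only: q_def measure_nonneg)
  ultimately have q: "0 \<le> q" "q < 1" by simp_all
  have "prob {\<omega>\<in>space P. \<forall>j<n. Z j \<omega> \<notin> W1} = q ^ n" for n
  proof -
    have "emeasure P {\<omega>\<in>space P. \<forall>j<n. Z j \<omega> \<notin> W1} = ennreal (q ^ n)"
      unfolding emeasure_none_in[OF W1_sets] q_def unif_simplex.emeasure_eq_measure
      by (simp add: ennreal_power)
    then show ?thesis using q by (simp add: measure_def)
  qed
  then show ?thesis using q by (simp add: LIMSEQ_power_zero)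
qed

lemma law_pair:
  assumes "i \<noteq> k"
  shows "distr P (borel \<Otimes>\<^sub>M borel) (\<lambda>\<omega>. (Z i \<omega>, Z k \<omega>)) = unif_simplex \<Otimes>\<^sub>M unif_simplex"
proof (rule pair_measure_eqI[symmetric])
  show "sigma_finite_measure unif_simplex" "sigma_finite_measure unif_simplex"
    by unfold_locales
  show "sets (unif_simplex \<Otimes>\<^sub>M unif_simplex) = sets (distr P (borel \<Otimes>\<^sub>M borel) (\<lambda>\<omega>. (Z i \<omega>, Z k \<omega>)))"
    by (simp cong: sets_pair_measure_cong)
  fix A B assume "A \<in> sets unif_simplex" "B \<in> sets unif_simplex"
  then have [measurable]: "A \<in> sets borel" "B \<in> sets borel" by simp_all
  have "emeasure (distr P (borel \<Otimes>\<^sub>M borel) (\<lambda>\<omega>. (Z i \<omega>, Z k \<omega>))) (A \<times> B)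
     = emeasure P {\<omega>\<in>space P. Z i \<omega> \<in> A \<and> (\<forall>j\<in>{k}. (Z i \<omega>, Z j \<omega>) \<in> UNIV \<times> B)}"
    by (subst emeasure_distr) (auto intro!: arg_cong[where f = "emeasure P"])
  also have "\<dots> = (\<integral>\<^sup>+z. indicator A z * emeasure unif_simplex {p. (z, p) \<in> UNIV \<times> B} ^ card {k} \<partial>unif_simplex)"
    by (rule emeasure_single) (use assms in auto)
  also have "\<dots> = emeasure unif_simplex A * emeasure unif_simplex B"
    by (simp add: nn_integral_multc)
  finally show "emeasure unif_simplex A * emeasure unif_simplex B
     = emeasure (distr P (borel \<Otimes>\<^sub>M borel) (\<lambda>\<omega>. (Z i \<omega>, Z k \<omega>))) (A \<times> B)" ..
qed

lemma emeasure_pair: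
  assumes "Q \<in> sets (borel \<Otimes>\<^sub>M borel)" "B \<in> sets ((borel \<Otimes>\<^sub>M borel) \<Otimes>\<^sub>M borel)" "finite J" "i \<notin> J" "k \<notin> J" "i \<noteq> k"
  shows "emeasure P {\<omega>\<in>space P. (Z i \<omega>, Z k \<omega>) \<in> Q \<and> (\<forall>j\<in>J. ((Z i \<omega>, Z k \<omega>), Z j \<omega>) \<in> B)}
    = (\<integral>\<^sup>+z. indicator Q z * emeasure unif_simplex {p. (z, p) \<in> B} ^ card J \<partial>(unif_simplex \<Otimes>\<^sub>M unif_simplex))"
  using emeasure_indep_all_in[OF indep_Z law_Z _ _ _ _ assms(1,2), where I = "{i, k}" and J = J and g = "\<lambda>f. (f i, f k)"] assms(3-)
  by (simp add: law_pair)

lemma AE_fst_neq: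
  assumes "i \<noteq> k"
  shows "AE \<omega> in P. fst (Z i \<omega>) \<noteq> fst (Z k \<omega>)"
proof -
  let ?B = "{q \<in> space (borel \<Otimes>\<^sub>M borel). fst (fst q :: real \<times> real) = fst (snd q :: real \<times> real)}"
  have B: "?B \<in> sets (borel \<Otimes>\<^sub>M borel)" by measurable
  have "emeasure P {\<omega>\<in>space P. Z i \<omega> \<in> UNIV \<and> (\<forall>j\<in>{k}. (Z i \<omega>, Z j \<omega>) \<in> ?B)}
      = (\<integral>\<^sup>+z. indicator UNIV z * emeasure unif_simplex {p. (z, p) \<in> ?B} ^ card {k} \<partial>unif_simplex)"
    by (rule emeasure_single) (use B assms in auto)
  also have "\<dots> = 0"
  proof -
    have "{p. (z, p) \<in> ?B} = {p. fst p = fst z}" for z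
      by (auto simp: space_pair_measure)
    then show ?thesis by (simp add: null_vertical_line)
  qed
  finally have "emeasure P {\<omega>\<in>space P. fst (Z i \<omega>) = fst (Z k \<omega>)} = 0"
    by (simp add: space_pair_measure)
  moreover have "{\<omega>\<in>space P. fst (Z i \<omega>) = fst (Z k \<omega>)} \<in> sets P" by measurable
  ultimately show ?thesis
    by (subst AE_iff_measurable[OF _ refl]) auto
qed

section \<open>Strips containing no other sample point\<close>

definition missed_strip :: "nat \<Rightarrow> 'a set" where
  "missed_strip n = {\<omega>\<in>space P. \<exists>i<n. Z i \<omega> \<in> W1 \<and> (\<forall>j\<in>{..<n} - {i}. Z j \<omega> \<notin> strip (Z i \<omega>))}"

lemma missed_strip_sets [measurable]: "missed_strip n \<in> sets P"
  unfolding missed_strip_def strip_def by measurable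

text \<open>A union bound over all points of \<open>W1\<close>, rather than the law of the lowest
  one, gives \<open>n\<close> times the integral of
  \<open>2 * a * u * (1 - \<kappa> * u) ^ (n - 1)\<close>. The density vanishes linearly at 0 while
  the power confines \<open>u\<close> to order \<open>1 / n\<close>, which outweighs the factor
  \<open>n\<close>.\<close>

lemma prob_missed_strip_tendsto: "(\<lambda>n. prob (missed_strip n)) \<longlonglongrightarrow> 0"
proof -
  \<comment> \<open>\<open>\<kappa> * u\<close> is the mass of the strip at excess \<open>u\<close>:
    width \<open>r * u\<close>, height \<open>(1 - r * \<delta>) - (2 * r - 2)\<close>, doubled by
    the uniform density.\<close>
  define \<kappa> where "\<kappa> = 2 * r * (3 - 2 * r - r * \<delta>)"
  have pos: "0 < 3 - 2 * r - r * \<delta>" using \<delta>2 r2 by simp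
  then have \<kappa>: "0 < \<kappa>" using r1 by (simp add: \<kappa>_def)
  have strip: "emeasure unif_simplex {p. p \<notin> strip z} = ennreal (1 - \<kappa> * (fst z - m))" "\<kappa> * (fst z - m) \<le> 1" if z: "z \<in> W1" for z
  proof -
    have u: "0 < fst z - m" "fst z - m \<le> \<delta>" using W1_fst[OF z] by auto
    then have ru: "r * (fst z - m) \<le> r * \<delta>" using r1 by (intro mult_left_mono) auto
    have s: "strip z = {0<..<r * (fst z - m)} \<times> {2 * r - 2<..<1 - r * \<delta>}"
      by (auto simp: strip_def)
    have [measurable]: "strip z \<in> sets borel" unfolding s by (intro borel_open open_Times) auto
    have "strip z \<subseteq> std_simplex"
    proof
      fix p assume "p \<in> strip z"
      then have "0 < fst p" "fst p < r * (fst z - m)" "2 * r - 2 < snd p" "snd p < 1 - r * \<delta>"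
        by (auto simp: strip_def)
      then show "p \<in> std_simplex"
        using ru r1 unfolding std_simplex_def by (intro CollectI conjI) linarith+
    qed
    then have "strip z \<inter> std_simplex = strip z" by auto
    then have "emeasure unif_simplex (strip z) = 2 * (ennreal (r * (fst z - m)) * ennreal (3 - 2 * r - r * \<delta>))"
      using u r1 pos by (simp add: emeasure_unif_simplex) (simp add: s emeasure_lborel_Times algebra_simps)
    also have "\<dots> = ennreal (2 * ((r * (fst z - m)) * (3 - 2 * r - r * \<delta>)))"
      using u r1 pos by (simp add: ennreal_mult)
    also have "2 * ((r * (fst z - m)) * (3 - 2 * r - r * \<delta>)) = \<kappa> * (fst z - m)"
      by (simp add: \<kappa>_def)
    finally have e: "emeasure unif_simplex (strip z) = ennreal (\<kappa> * (fst z - m))" .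
    then have mm: "unif_simplex.prob (strip z) = \<kappa> * (fst z - m)"
      using u \<kappa> by (simp add: measure_def)
    then show "\<kappa> * (fst z - m) \<le> 1" using unif_simplex.prob_le_1[of "strip z"] by simp
    have "{p. p \<notin> strip z} = space unif_simplex - strip z" by auto
    then have "unif_simplex.prob {p. p \<notin> strip z} = 1 - \<kappa> * (fst z - m)"
      using unif_simplex.prob_compl[of "strip z"] mm by simp
    then show "emeasure unif_simplex {p. p \<notin> strip z} = ennreal (1 - \<kappa> * (fst z - m))"
      by (simp add: unif_simplex.emeasure_eq_measure)
  qed
  have le1: "\<kappa> * u \<le> 1" if "0 < u" "u \<le> \<delta>" for u
  proof -
    have "(m + u, m + u - a * u / 2) \<in> W1"
    proof -
      have "m + u - (1 - (m + u) / (r - 1)) = a * u"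
        using r1 by (simp add: a_def m_def field_simps)
      moreover have "0 < a * u" using a_pos that by simp
      ultimately show ?thesis unfolding W1_iff using that by auto
    qed
    from strip(2)[OF this] show ?thesis by simp
  qed
  define f where "f n u = real n * (indicator {0<..\<delta>} u * (2 * a * u) * (1 - \<kappa> * u) ^ (n - 1))" for n u
  have f_nonneg: "0 \<le> f n u" for n u
    using a_pos le1[of u] by (auto simp: f_def indicator_def)
  have bound: "emeasure P (missed_strip n) \<le> (\<integral>\<^sup>+u. ennreal (f n u) \<partial>lborel)" for n
  proof -
    let ?B = "{q \<in> space (borel \<Otimes>\<^sub>M borel). snd q \<notin> strip (fst q)}"
    have B: "?B \<in> sets (borel \<Otimes>\<^sub>M borel)" by measurable
    let ?A = "\<lambda>i. {\<omega>\<in>space P. Z i \<omega> \<in> W1 \<and> (\<forall>j\<in>{..<n} - {i}. (Z i \<omega>, Z j \<omega>) \<in> ?B)}"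
    have "missed_strip n = (\<Union>i\<in>{..<n}. ?A i)"
      by (auto simp: missed_strip_def space_pair_measure)
    moreover have [measurable]: "?A i \<in> sets P" for i
      using B by measurable
    ultimately have "emeasure P (missed_strip n) \<le> (\<Sum>i<n. emeasure P (?A i))"
      using emeasure_subadditive_finite[of "{..<n}" ?A P] by auto
    also have "\<dots> = (\<Sum>i<n. \<integral>\<^sup>+u. ennreal (indicator {0<..\<delta>} u * (2 * a * u) * (1 - \<kappa> * u) ^ (n - 1)) \<partial>lborel)"
    proof (rule sum.cong[OF refl])
      fix i assume i: "i \<in> {..<n}"
      have "emeasure P (?A i) = (\<integral>\<^sup>+z. indicator W1 z * emeasure unif_simplex {p. (z, p) \<in> ?B} ^ card ({..<n} - {i}) \<partial>unif_simplex)"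
        by (rule emeasure_single) (use B in auto)
      also have "\<dots> = (\<integral>\<^sup>+z. indicator W1 z * ennreal ((1 - \<kappa> * (fst z - m)) ^ (n - 1)) \<partial>unif_simplex)"
      proof (rule nn_integral_cong)
        fix z
        show "indicator W1 z * emeasure unif_simplex {p. (z, p) \<in> ?B} ^ card ({..<n} - {i}) = indicator W1 z * ennreal ((1 - \<kappa> * (fst z - m)) ^ (n - 1))"
        proof (cases "z \<in> W1")
          case True
          with strip[OF True] i show ?thesis by (simp add: space_pair_measure ennreal_power)
        qed simp
      qed
      also have "\<dots> = (\<integral>\<^sup>+u. ennreal (indicator {0<..\<delta>} u * (2 * a * u)) * ennreal ((1 - \<kappa> * (m + u - m)) ^ (n - 1)) \<partial>lborel)"
        by (rule nn_integral_W1[where F = "\<lambda>x. ennreal ((1 - \<kappa> * (x - m)) ^ (n - 1))"]) measurable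
      also have "\<dots> = (\<integral>\<^sup>+u. ennreal (indicator {0<..\<delta>} u * (2 * a * u) * (1 - \<kappa> * u) ^ (n - 1)) \<partial>lborel)"
        by (rule nn_integral_cong) (use a_pos le1 in \<open>auto simp: indicator_def ennreal_mult\<close>)
      finally show "emeasure P (?A i) = (\<integral>\<^sup>+u. ennreal (indicator {0<..\<delta>} u * (2 * a * u) * (1 - \<kappa> * u) ^ (n - 1)) \<partial>lborel)" .
    qed
    also have "\<dots> = (\<integral>\<^sup>+u. ennreal (f n u) \<partial>lborel)"
      by (simp add: f_def ennreal_mult' nn_integral_cmult ennreal_of_nat_eq_real_of_nat)
    finally show ?thesis .
  qed
  have f_le: "f n u \<le> (2 * a) * (1 / \<kappa> + \<delta>) * indicator {0..\<delta>} u" for n u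
  proof (cases "0 < u \<and> u \<le> \<delta> \<and> 0 < n")
    case True
    let ?q = "(1 - \<kappa> * u) ^ (n - 1)"
    have k: "0 < \<kappa> * u" "\<kappa> * u \<le> 1" using True \<kappa> le1 by auto
    \<comment> \<open>\<open>(1 + (n - 1) t) (1 - t)\<^sup>n\<^sup>-\<^sup>1 \<le> (1 + t)\<^sup>n\<^sup>-\<^sup>1 (1 - t)\<^sup>n\<^sup>-\<^sup>1 \<le> 1\<close> makes \<open>f n\<close> bounded uniformly in \<open>n\<close>\<close>
    have "(1 + real (n - 1) * (\<kappa> * u)) * ?q \<le> (1 + \<kappa> * u) ^ (n - 1) * ?q"
      using k by (intro mult_right_mono Bernoulli_inequality) auto
    also have "\<dots> = (1 - (\<kappa> * u)\<^sup>2) ^ (n - 1)"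
      by (simp add: power_mult_distrib[symmetric] algebra_simps power2_eq_square)
    also have "\<dots> \<le> 1"
      using k by (intro power_le_one) (auto simp: power_le_one abs_square_le_1)
    finally have "?q + real (n - 1) * (\<kappa> * u) * ?q \<le> 1"
      by (simp only: distrib_right mult_1_left)
    moreover have "0 \<le> ?q" using k by simp
    ultimately have "real (n - 1) * (\<kappa> * u) * ?q \<le> 1" by linarith
    then have "real (n - 1) * u * ?q \<le> 1 / \<kappa>" using \<kappa> by (simp add: field_simps)
    moreover have "u * ?q \<le> \<delta> * 1"
      using True k by (intro mult_mono power_le_one) auto
    ultimately have "real n * u * ?q \<le> 1 / \<kappa> + \<delta>"
      using True by (simp add: of_nat_diff algebra_simps)
    then have "(2 * a) * (real n * u * ?q) \<le> (2 * a) * (1 / \<kappa> + \<delta>)"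
      using a_pos by (intro mult_left_mono) auto
    then show ?thesis using True by (simp add: f_def mult_ac)
  next
    case False
    then have "f n u = 0" by (auto simp: f_def)
    then show ?thesis using a_pos \<kappa> \<delta>_pos by simp
  qed
  have "(\<lambda>n. \<integral>\<^sup>+u. ennreal (f n u) \<partial>lborel) \<longlonglongrightarrow> (\<integral>\<^sup>+u. 0 \<partial>(lborel :: real measure))"
  proof (rule nn_integral_dominated_convergence[where w = "\<lambda>u. ennreal ((2 * a) * (1 / \<kappa> + \<delta>)) * indicator {0..\<delta>} u"])
    show "(\<lambda>u. ennreal (f n u)) \<in> borel_measurable lborel" for n
      unfolding f_def by measurable
    show "AE u in lborel. ennreal (f n u) \<le> ennreal ((2 * a) * (1 / \<kappa> + \<delta>)) * indicator {0..\<delta>} u" for n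
    proof (intro AE_I2)
      fix u
      show "ennreal (f n u) \<le> ennreal ((2 * a) * (1 / \<kappa> + \<delta>)) * indicator {0..\<delta>} u"
        using ennreal_leI[OF f_le[of n u]] by (auto simp: indicator_def split: if_splits)
    qed
    show "(\<integral>\<^sup>+u. ennreal ((2 * a) * (1 / \<kappa> + \<delta>)) * indicator {0..\<delta>} u \<partial>lborel) < \<infinity>"
      using \<delta>_pos by (simp add: nn_integral_cmult ennreal_mult_less_top)
    show "AE u in lborel. (\<lambda>n. ennreal (f n u)) \<longlonglongrightarrow> 0"
    proof (intro AE_I2)
      fix u
      have "(\<lambda>n. f n u) \<longlonglongrightarrow> 0"
      proof (cases "0 < u \<and> u \<le> \<delta>")
        case True
        define q where "q = 1 - \<kappa> * u"
        have q: "0 \<le> q" "q < 1" using True \<kappa> le1[of u] by (auto simp: q_def)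
        have "(\<lambda>n. real (Suc n) * q ^ n) \<longlonglongrightarrow> 0"
        proof -
          have "(\<lambda>n. real n * q ^ n) \<longlonglongrightarrow> 0" "(\<lambda>n. q ^ n) \<longlonglongrightarrow> 0"
            using q by (auto intro: powser_times_n_limit_0 LIMSEQ_power_zero)
          from tendsto_add[OF this] show ?thesis by (simp add: algebra_simps)
        qed
        then have "(\<lambda>n. (2 * a * u) * (real (Suc n) * q ^ n)) \<longlonglongrightarrow> (2 * a * u) * 0"
          by (intro tendsto_intros)
        then have "(\<lambda>n. f (Suc n) u) \<longlonglongrightarrow> 0"
          using True by (simp add: f_def q_def mult_ac)
        then show ?thesis by (rule LIMSEQ_imp_Suc)
      next
        case False
        then show ?thesis by (auto simp: f_def indicator_def)
      qed
      from tendsto_ennrealI[OF this] show "(\<lambda>n. ennreal (f n u)) \<longlonglongrightarrow> 0" by simp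
    qed
  qed auto
  then have "(\<lambda>n. \<integral>\<^sup>+u. ennreal (f n u) \<partial>lborel) \<longlonglongrightarrow> 0" by simp
  then have "(\<lambda>n. emeasure P (missed_strip n)) \<longlonglongrightarrow> ennreal 0"
    using tendsto_sandwich[of "\<lambda>_. 0" "\<lambda>n. emeasure P (missed_strip n)" sequentially "\<lambda>n. \<integral>\<^sup>+u. ennreal (f n u) \<partial>lborel" 0]
    by (simp add: bound)
  then have "(\<lambda>n. enn2real (emeasure P (missed_strip n))) \<longlonglongrightarrow> 0"
    by (rule tendsto_enn2real) simp
  then show ?thesis by (simp add: measure_def)
qed

section \<open>Extremal pairs and their exact probability\<close>

definition pair_event :: "nat \<Rightarrow> nat \<times> nat \<Rightarrow> 'a set" where
  "pair_event n = (\<lambda>(i, k). {\<omega>\<in>space P. Z i \<omega> \<in> W1 \<and> Z k \<omega> \<in> W2 \<and>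
     (\<forall>j\<in>{..<n} - {i, k}. Z j \<omega> \<notin> uncaught (Z i \<omega>) (Z k \<omega>))})"

definition index_pairs :: "nat \<Rightarrow> (nat \<times> nat) set" where
  "index_pairs n = (SIGMA i:{..<n}. {..<n} - {i})"

definition some_pair :: "nat \<Rightarrow> 'a set" where
  "some_pair n = (\<Union>q\<in>index_pairs n. pair_event n q)"

lemma finite_index_pairs [simp]: "finite (index_pairs n)"
  by (simp add: index_pairs_def)

lemma card_index_pairs: "card (index_pairs n) = n * (n - 1)"
  by (simp add: index_pairs_def)

lemma pair_event_sets [measurable]: "pair_event n q \<in> sets P"
  unfolding pair_event_def uncaught_def by (cases q) simp

lemma some_pair_sets [measurable]: "some_pair n \<in> sets P"
  unfolding some_pair_def by (intro sets.finite_UN) auto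

text \<open>For fixed indices, extremality and joint domination are one condition: the other
  \<open>n - 2\<close> points avoid \<open>uncaught\<close>. Its mass depends on one coordinate of
  each chosen point, so \<open>nn_integral_W1\<close> and \<open>nn_integral_W2\<close> integrate
  out the other ones.\<close>

lemma emeasure_pair_event:
  assumes ik: "i < n" "k < n" "i \<noteq> k"
  shows "emeasure P (pair_event n (i, k)) = (\<integral>\<^sup>+u. \<integral>\<^sup>+v. ennreal (pair_integrand r \<delta> n (u, v)) \<partial>lborel \<partial>lborel)"
proof -
  let ?B = "{q \<in> space ((borel \<Otimes>\<^sub>M borel) \<Otimes>\<^sub>M borel). snd q \<notin> uncaught (fst (fst q)) (snd (fst q))}"
  let ?J = "{..<n} - {i, k}"
  define G where "G x y = ennreal ((1 - uncaught_mass r (x - m) (y - m)) ^ (n - 2))" for x y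
  define w where "w u = indicator {0<..\<delta>} u * (2 * a * u)" for u
  have w_nonneg: "0 \<le> w u" for u using a_pos by (simp add: w_def indicator_def)
  have [measurable]: "w \<in> borel_measurable borel" unfolding w_def by measurable
  have G_meas: "(\<lambda>q. G (f q) (g q)) \<in> borel_measurable N" if "f \<in> borel_measurable N" "g \<in> borel_measurable N" for f g and N :: "'y measure"
    using that unfolding G_def uncaught_mass_def by measurable
  have B: "?B \<in> sets ((borel \<Otimes>\<^sub>M borel) \<Otimes>\<^sub>M borel)" by measurable
  have cardJ: "card ?J = n - 2"
    using ik by (subst card_Diff_subset) auto
  have "pair_event n (i, k) = {\<omega>\<in>space P. (Z i \<omega>, Z k \<omega>) \<in> W1 \<times> W2 \<and> (\<forall>j\<in>?J. ((Z i \<omega>, Z k \<omega>), Z j \<omega>) \<in> ?B)}"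
    by (auto simp: pair_event_def space_pair_measure)
  also have "emeasure P \<dots> = (\<integral>\<^sup>+z. indicator (W1 \<times> W2) z * emeasure unif_simplex {p. (z, p) \<in> ?B} ^ card ?J \<partial>(unif_simplex \<Otimes>\<^sub>M unif_simplex))"
    by (rule emeasure_pair) (use B ik in auto)
  also have "\<dots> = (\<integral>\<^sup>+z. indicator W1 (fst z) * indicator W2 (snd z) * G (fst (fst z)) (snd (snd z)) \<partial>(unif_simplex \<Otimes>\<^sub>M unif_simplex))"
  proof (rule nn_integral_cong)
    fix z :: "(real \<times> real) \<times> real \<times> real"
    show "indicator (W1 \<times> W2) z * emeasure unif_simplex {p. (z, p) \<in> ?B} ^ card ?J
       = indicator W1 (fst z) * indicator W2 (snd z) * G (fst (fst z)) (snd (snd z))"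
    proof (cases "fst z \<in> W1 \<and> snd z \<in> W2")
      case True
      then have "{p. (z, p) \<in> ?B} = {p. p \<notin> uncaught (fst z) (snd z)}"
        by (auto simp: space_pair_measure)
      moreover have "uncaught_mass r (fst (fst z) - m) (snd (snd z) - m) \<le> 1"
        using True W1_fst[of "fst z"] W2_snd[of "snd z"] by (intro uncaught_mass_le_1) auto
      ultimately show ?thesis
        using True emeasure_not_uncaught[of "fst z" "snd z"] cardJ
        by (simp add: G_def ennreal_power indicator_def mem_Times_iff)
    qed (auto simp: indicator_def mem_Times_iff)
  qed
  also have "\<dots> = (\<integral>\<^sup>+z1. \<integral>\<^sup>+z2. indicator W1 z1 * indicator W2 z2 * G (fst z1) (snd z2) \<partial>unif_simplex \<partial>unif_simplex)"
  proof -
    have "(\<lambda>z. indicator W1 (fst z) * indicator W2 (snd z) * G (fst (fst z)) (snd (snd z))) \<in> borel_measurable (unif_simplex \<Otimes>\<^sub>M unif_simplex)"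
      by (intro borel_measurable_times_ennreal borel_measurable_indicator' G_meas) measurable
    from unif_simplex.nn_integral_fst[OF this] show ?thesis by simp
  qed
  also have "\<dots> = (\<integral>\<^sup>+z1. indicator W1 z1 * (\<integral>\<^sup>+v. ennreal (w v) * G (fst z1) (m + v) \<partial>lborel) \<partial>unif_simplex)"
  proof (rule nn_integral_cong)
    fix z1 :: "real \<times> real"
    have meas: "(\<lambda>y. G (fst z1) y) \<in> borel_measurable borel" by (intro G_meas) auto
    have meas2: "(\<lambda>z2. G (fst z1) (snd z2)) \<in> borel_measurable unif_simplex" by (intro G_meas) auto
    have "(\<integral>\<^sup>+z2. indicator W1 z1 * indicator W2 z2 * G (fst z1) (snd z2) \<partial>unif_simplex)
        = indicator W1 z1 * (\<integral>\<^sup>+z2. indicator W2 z2 * G (fst z1) (snd z2) \<partial>unif_simplex)"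
      using meas2 by (subst nn_integral_cmult[symmetric]) (auto simp: mult.assoc)
    also have "(\<integral>\<^sup>+z2. indicator W2 z2 * G (fst z1) (snd z2) \<partial>unif_simplex) = (\<integral>\<^sup>+v. ennreal (w v) * G (fst z1) (m + v) \<partial>lborel)"
      unfolding w_def by (rule nn_integral_W2[OF meas])
    finally show "(\<integral>\<^sup>+z2. indicator W1 z1 * indicator W2 z2 * G (fst z1) (snd z2) \<partial>unif_simplex)
      = indicator W1 z1 * (\<integral>\<^sup>+v. ennreal (w v) * G (fst z1) (m + v) \<partial>lborel)" .
  qed
  also have "\<dots> = (\<integral>\<^sup>+u. ennreal (w u) * (\<integral>\<^sup>+v. ennreal (w v) * G (m + u) (m + v) \<partial>lborel) \<partial>lborel)"
    unfolding w_def
  proof (rule nn_integral_W1)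
    have "(\<lambda>q. ennreal (w (snd q)) * G (fst q) (m + snd q)) \<in> borel_measurable (borel \<Otimes>\<^sub>M lborel)"
      by (intro borel_measurable_times_ennreal G_meas) measurable
    then have "(\<lambda>x. \<integral>\<^sup>+v. ennreal (w v) * G x (m + v) \<partial>lborel) \<in> borel_measurable borel"
      by (intro lborel.borel_measurable_nn_integral) (simp add: case_prod_beta)
    then show "(\<lambda>x. \<integral>\<^sup>+v. ennreal (indicator {0<..\<delta>} v * (2 * a * v)) * G x (m + v) \<partial>lborel) \<in> borel_measurable borel"
      unfolding w_def .
  qed
  also have "\<dots> = (\<integral>\<^sup>+u. \<integral>\<^sup>+v. ennreal (pair_integrand r \<delta> n (u, v)) \<partial>lborel \<partial>lborel)"
  proof (rule nn_integral_cong)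
    fix u :: real
    have "(\<lambda>v. ennreal (w v) * G (m + u) (m + v)) \<in> borel_measurable lborel"
      by (intro borel_measurable_times_ennreal G_meas) measurable
    then have "ennreal (w u) * (\<integral>\<^sup>+v. ennreal (w v) * G (m + u) (m + v) \<partial>lborel)
       = (\<integral>\<^sup>+v. ennreal (w u) * (ennreal (w v) * G (m + u) (m + v)) \<partial>lborel)"
      by (simp add: nn_integral_cmult)
    also have "\<dots> = (\<integral>\<^sup>+v. ennreal (pair_integrand r \<delta> n (u, v)) \<partial>lborel)"
    proof (rule nn_integral_cong)
      fix v :: real
      have "pair_integrand r \<delta> n (u, v) = w u * (w v * (1 - uncaught_mass r u v) ^ (n - 2))"
        by (simp add: pair_integrand_def w_def a_def indicator_def)
      then show "ennreal (w u) * (ennreal (w v) * G (m + u) (m + v)) = ennreal (pair_integrand r \<delta> n (u, v))"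
        using w_nonneg by (simp add: G_def ennreal_mult')
    qed
    finally show "ennreal (w u) * (\<integral>\<^sup>+v. ennreal (w v) * G (m + u) (m + v) \<partial>lborel)
      = (\<integral>\<^sup>+v. ennreal (pair_integrand r \<delta> n (u, v)) \<partial>lborel)" .
  qed
  finally show ?thesis .
qed

lemma AE_snd_neq:
  assumes "i \<noteq> k"
  shows "AE \<omega> in P. snd (Z i \<omega>) \<noteq> snd (Z k \<omega>)"
  using pe_iid.AE_fst_neq[OF pe_iid_swap assms] by simp

lemma AE_no_ties: "AE \<omega> in P. inj (\<lambda>i. fst (Z i \<omega>)) \<and> inj (\<lambda>i. snd (Z i \<omega>))"
proof -
  have "AE \<omega> in P. \<forall>i k. i \<noteq> k \<longrightarrow> fst (Z i \<omega>) \<noteq> fst (Z k \<omega>) \<and> snd (Z i \<omega>) \<noteq> snd (Z k \<omega>)"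
    using AE_fst_neq AE_snd_neq by (simp add: AE_all_countable)
  then show ?thesis by eventually_elim (auto simp: inj_def)
qed

text \<open>Off ties the events are disjoint: two distinct indices extremal in \<open>W1\<close>
  would each lie not below the other and so share the first coordinate; likewise in
  \<open>W2\<close>. The measure of the union is therefore a sum of equal terms.\<close>

lemma emeasure_some_pair:
  "emeasure P (some_pair n) = ennreal (real n * (real n - 1)) *
     (\<integral>\<^sup>+u. \<integral>\<^sup>+v. ennreal (pair_integrand r \<delta> n (u, v)) \<partial>lborel \<partial>lborel)"
proof -
  define T where "T = {\<omega>\<in>space P. \<forall>i k. i \<noteq> k \<longrightarrow> fst (Z i \<omega>) \<noteq> fst (Z k \<omega>) \<and> snd (Z i \<omega>) \<noteq> snd (Z k \<omega>)}"
  have [measurable]: "T \<in> sets P" unfolding T_def by measurable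
  have T: "AE \<omega> in P. \<omega> \<in> T"
    using AE_no_ties AE_space by eventually_elim (auto simp: T_def inj_def)
  have disj: "disjoint_family_on (\<lambda>q. pair_event n q \<inter> T) (index_pairs n)"
    unfolding disjoint_family_on_def
  proof (intro ballI impI)
    fix q q' assume q: "q \<in> index_pairs n" "q' \<in> index_pairs n" "q \<noteq> q'"
    obtain i k i' k' where [simp]: "q = (i, k)" "q' = (i', k')" by (cases q, cases q') auto
    show "(pair_event n q \<inter> T) \<inter> (pair_event n q' \<inter> T) = {}"
    proof (rule ccontr)
      assume "(pair_event n q \<inter> T) \<inter> (pair_event n q' \<inter> T) \<noteq> {}"
      then obtain \<omega> where \<omega>: "\<omega> \<in> pair_event n (i, k)" "\<omega> \<in> pair_event n (i', k')" "\<omega> \<in> T" by auto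
      have W: "Z i \<omega> \<in> W1" "Z k \<omega> \<in> W2" "Z i' \<omega> \<in> W1" "Z k' \<omega> \<in> W2"
        using \<omega> by (auto simp: pair_event_def)
      have ne: "p \<notin> W2" if "p \<in> W1" for p using that by (auto simp: W2_def W1_def C1_def)
      have idx: "i < n" "k < n" "i' < n" "k' < n" using q by (auto simp: index_pairs_def)
      have "i = i'"
      proof (rule ccontr)
        assume neq: "i \<noteq> i'"
        \<comment> \<open>\<open>W1\<close> and \<open>W2\<close> are disjoint, so neither index is
          exempted from the avoidance condition of the other pair.\<close>
        moreover have "i' \<noteq> k" "i \<noteq> k'" using W ne by metis+
        ultimately have "Z i' \<omega> \<notin> uncaught (Z i \<omega>) (Z k \<omega>)" "Z i \<omega> \<notin> uncaught (Z i' \<omega>) (Z k' \<omega>)"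
          using \<omega> idx by (auto simp: pair_event_def)
        then have "fst (Z i \<omega>) = fst (Z i' \<omega>)"
          using W by (auto simp: uncaught_def)
        with \<omega>(3) neq show False by (auto simp: T_def)
      qed
      moreover have "k = k'"
      proof (rule ccontr)
        assume neq: "k \<noteq> k'"
        moreover have "k' \<noteq> i" "k \<noteq> i'" using W ne by metis+
        ultimately have "Z k' \<omega> \<notin> uncaught (Z i \<omega>) (Z k \<omega>)" "Z k \<omega> \<notin> uncaught (Z i' \<omega>) (Z k' \<omega>)"
          using \<omega> idx by (auto simp: pair_event_def)
        then have "snd (Z k \<omega>) = snd (Z k' \<omega>)"
          using W by (auto simp: uncaught_def)
        with \<omega>(3) neq show False by (auto simp: T_def)
      qed
      ultimately show False using q by simp
    qed
  qed
  have T_eq: "emeasure P A = emeasure P (A \<inter> T)" if [measurable]: "A \<in> sets P" for A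
    by (rule emeasure_eq_AE) (use T in auto)
  have "emeasure P (some_pair n) = emeasure P (some_pair n \<inter> T)" by (rule T_eq) simp
  also have "some_pair n \<inter> T = (\<Union>q\<in>index_pairs n. pair_event n q \<inter> T)" by (auto simp: some_pair_def)
  also have "emeasure P \<dots> = (\<Sum>q\<in>index_pairs n. emeasure P (pair_event n q \<inter> T))"
    by (rule sum_emeasure[symmetric]) (use disj in auto)
  also have "\<dots> = (\<Sum>q\<in>index_pairs n. emeasure P (pair_event n q))"
    by (intro sum.cong refl T_eq[symmetric]) simp
  also have "\<dots> = (\<Sum>q\<in>index_pairs n. (\<integral>\<^sup>+u. \<integral>\<^sup>+v. ennreal (pair_integrand r \<delta> n (u, v)) \<partial>lborel \<partial>lborel))"
    by (intro sum.cong refl) (auto simp: index_pairs_def intro!: emeasure_pair_event)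
  also have "\<dots> = of_nat (n * (n - 1)) * (\<integral>\<^sup>+u. \<integral>\<^sup>+v. ennreal (pair_integrand r \<delta> n (u, v)) \<partial>lborel \<partial>lborel)"
    by (simp add: card_index_pairs)
  \<comment> \<open>At \<open>n = 0\<close> the truncated and the real \<open>n - 1\<close> differ,
    but both products vanish.\<close>
  also have "of_nat (n * (n - 1)) = ennreal (real n * (real n - 1))"
  proof -
    have "real (n * (n - 1)) = real n * (real n - 1)" by (cases n) (auto simp: algebra_simps)
    then show ?thesis by (metis ennreal_of_nat_eq_real_of_nat)
  qed
  finally show ?thesis .
qed

lemma prob_some_pair_tendsto: "(\<lambda>n. prob (some_pair n)) \<longlonglongrightarrow> limit_prob r"
proof -
  have "(\<lambda>n. emeasure P (some_pair n)) \<longlonglongrightarrow> ennreal (limit_prob r)"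
    unfolding emeasure_some_pair using r1 \<delta>_pos uncaught_mass_le_1 by (rule tendsto_pair_integrand)
  then have "(\<lambda>n. enn2real (emeasure P (some_pair n))) \<longlonglongrightarrow> limit_prob r"
    by (rule tendsto_enn2real) (use limit_prob_pos[OF r1] in simp)
  then show ?thesis by (simp add: measure_def)
qed

end

section \<open>Dominating pairs\<close>

lemma null_line:
  fixes \<alpha> \<beta> c :: real
  assumes "\<alpha> \<noteq> 0 \<or> \<beta> \<noteq> 0"
  shows "AE z in unif_simplex. \<alpha> * fst z + \<beta> * snd z \<noteq> c"
proof -
  let ?L = "{z \<in> space (borel :: (real \<times> real) measure). \<alpha> * fst z + \<beta> * snd z = c}"
  have m: "?L \<in> sets borel" by measurable
  have "negligible {z :: real \<times> real. (\<alpha>, \<beta>) \<bullet> z = c}"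
    using assms by (intro negligible_hyperplane) (auto simp: zero_prod_def)
  then have "?L \<in> null_sets lebesgue"
    by (simp add: negligible_iff_null_sets inner_prod_def)
  then have "emeasure lborel ?L = 0"
    using m by (simp add: null_sets_def)
  moreover have "emeasure lborel (?L \<inter> std_simplex) \<le> emeasure lborel ?L"
    by (rule emeasure_mono) (use m in simp_all)
  ultimately have "emeasure unif_simplex ?L = 0"
    using m by (simp add: emeasure_unif_simplex)
  then show ?thesis using m by (subst AE_iff_measurable[OF _ refl]) auto
qed

lemma AE_in_std_simplex: "AE z in unif_simplex. z \<in> std_simplex"
  unfolding unif_simplex_def by (rule AE_uniform_measureI) auto

context pe_window
begin

text \<open>
  \<open>z' \<in> N\<^sub>P\<^sub>E(z)\<close> in coordinates. Ties between the vertex regions, where the vertex choice is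
  arbitrary, have no arcs here.
\<close>

definition arc :: "real \<times> real \<Rightarrow> real \<times> real \<Rightarrow> bool" where
  "arc z z' \<longleftrightarrow> (z \<in> C1 \<and> 1 - fst z' \<le> r * (1 - fst z)) \<or> (z \<in> C2 \<and> 1 - snd z' \<le> r * (1 - snd z))
     \<or> (z \<in> C3 \<and> fst z' + snd z' \<le> r * (fst z + snd z))"

lemma arc_swap: "arc (prod.swap z) (prod.swap z') \<longleftrightarrow> arc z z'"
  by (auto simp: arc_def C2_def C3_def algebra_simps)

lemma C_disjoint: "C1 \<inter> C2 = {}" "C1 \<inter> C3 = {}" "C2 \<inter> C3 = {}"
  by (auto simp: C1_def C2_def C3_def)

text \<open>The regions are bounded by the three cevians through \<open>M\<close>, which are null
  lines.\<close>

lemma AE_C: "AE z in unif_simplex. z \<in> C1 \<union> C2 \<union> C3"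
proof -
  have "AE z in unif_simplex. 1 * fst z + (- 1) * snd z \<noteq> 0" by (rule null_line) simp
  moreover have "AE z in unif_simplex. 1 * fst z + (r - 1) * snd z \<noteq> r - 1" by (rule null_line) simp
  moreover have "AE z in unif_simplex. (r - 1) * fst z + 1 * snd z \<noteq> r - 1" by (rule null_line) simp
  ultimately show ?thesis
  proof eventually_elim
    case (elim z)
    \<comment> \<open>Since \<open>2 - r > 0\<close>, the two cevian forms are ordered like the
      coordinates: if the larger form is below \<open>r - 1\<close>, so is the other, and the point
      is in \<open>C3\<close>.\<close>
    have *: "(2 - r) * (fst z - snd z) = (fst z + (r - 1) * snd z) - (snd z + (r - 1) * fst z)"
      by (simp add: algebra_simps)
    consider "snd z < fst z" | "fst z < snd z" using elim by force
    then show ?case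
    proof cases
      case 1
      then have "0 < (2 - r) * (fst z - snd z)" using r2 by simp
      then show ?thesis using elim 1 * by (auto simp: C1_def C3_def)
    next
      case 2
      then have "0 < (2 - r) * (snd z - fst z)" using r2 by simp
      then have "(2 - r) * (fst z - snd z) < 0" by (simp add: algebra_simps)
      then show ?thesis using elim 2 * by (auto simp: C1_def C2_def C3_def)
    qed
  qed
qed

text \<open>The condition of \<open>missed_strip\<close> for a deterministic sequence; the
  combinatorial argument then needs no probability space and applies to the swapped points
  too.\<close>

definition missed :: "nat \<Rightarrow> (nat \<Rightarrow> real \<times> real) \<Rightarrow> bool" where
  "missed n z \<longleftrightarrow> (\<exists>i<n. z i \<in> W1 \<and> (\<forall>j\<in>{..<n} - {i}. z j \<notin> strip (z i)))"

text \<open>A minimum over \<open>W1\<close> is a minimum over all of \<open>C1\<close>, because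
  points of \<open>C1\<close> outside \<open>W1\<close> lie above the window.\<close>

lemma W1_minimizer:
  fixes z :: "nat \<Rightarrow> real \<times> real"
  assumes "\<exists>i<n. z i \<in> W1"
  obtains i where "i < n" "z i \<in> W1" "\<And>j. j < n \<Longrightarrow> z j \<in> C1 \<Longrightarrow> fst (z i) \<le> fst (z j)"
proof -
  let ?I = "{i \<in> {..<n}. z i \<in> W1}"
  define i where "i = arg_min_on (\<lambda>i. fst (z i)) ?I"
  have fin: "finite ?I" by simp
  have ne: "?I \<noteq> {}" using assms by blast
  have i1: "i \<in> ?I" unfolding i_def by (rule arg_min_if_finite(1)[OF fin ne])
  have i2: "\<forall>j\<in>?I. fst (z i) \<le> fst (z j)"
    unfolding i_def by (intro ballI arg_min_least[OF fin ne])
  note i = i1 i2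
  have "fst (z i) \<le> fst (z j)" if "j < n" "z j \<in> C1" for j
  proof (cases "z j \<in> W1")
    case True
    then show ?thesis using i that by auto
  next
    case False
    then have "m + \<delta> < fst (z j)" using that by (auto simp: W1_def)
    moreover have "fst (z i) \<le> m + \<delta>" using i by (auto simp: W1_def)
    ultimately show ?thesis by simp
  qed
  with i that show thesis by auto
qed

text \<open>One witness defeats both regions at once. It lies in the strip of the lowest point of
  \<open>W1\<close>, and strips widen with the excess; its second coordinate exceeds
  \<open>2 * r - 2\<close>, out of reach of \<open>C3\<close>.\<close>

lemma not_dominated_by_C1_C3:
  assumes W: "\<exists>i<n. z i \<in> W1" and nm: "\<not> missed n z"
  obtains j where "j < n" "\<And>i. i < n \<Longrightarrow> z i \<in> C1 \<union> C3 \<Longrightarrow> \<not> arc (z i) (z j)"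
proof -
  obtain i0 where i0: "i0 < n" "z i0 \<in> W1" "\<And>j. j < n \<Longrightarrow> z j \<in> C1 \<Longrightarrow> fst (z i0) \<le> fst (z j)"
    using W1_minimizer[OF W] by metis
  then obtain j where j: "j < n" "z j \<in> strip (z i0)"
    using nm by (auto simp: missed_def)
  have "\<not> arc (z i) (z j)" if i: "i < n" "z i \<in> C1 \<union> C3" for i
  proof (cases "z i \<in> C1")
    case True
    then have "r * fst (z i0) \<le> r * fst (z i)" using i0(3)[of i] i r1 by simp
    moreover have "fst (z j) < r * fst (z i0) - (r - 1)"
      using j r_m by (auto simp: strip_def algebra_simps)
    moreover have "z i \<notin> C2" "z i \<notin> C3" using True C_disjoint by auto
    ultimately show ?thesis by (auto simp: arc_def algebra_simps)
  next
    case False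
    then have 3: "z i \<in> C3" using i by auto
    \<comment> \<open>This is the sum of the two inequalities of \<open>C3\<close>, and the origin
      of the bound \<open>2 * r - 2\<close> in \<open>strip\<close>.\<close>
    then have "r * (fst (z i) + snd (z i)) < 2 * (r - 1)" by (simp add: C3_def algebra_simps)
    moreover have "2 * r - 2 < fst (z j) + snd (z j)" using j by (auto simp: strip_def)
    moreover have "z i \<notin> C2" using 3 C_disjoint by auto
    ultimately show ?thesis using False by (auto simp: arc_def)
  qed
  with j that show thesis by blast
qed

text \<open>All points of \<open>C1\<close> and \<open>C3\<close> miss \<open>j1\<close>, all points
  of \<open>C2\<close> and \<open>C3\<close> miss \<open>j2\<close>. So one point never suffices,
  and a dominating pair needs a point of \<open>C2\<close> for \<open>j1\<close> and a point of
  \<open>C1\<close> for \<open>j2\<close>.\<close>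

lemma two_dominate_iff:
  assumes S: "\<And>i. i < n \<Longrightarrow> z i \<in> std_simplex" and C: "\<And>i. i < n \<Longrightarrow> z i \<in> C1 \<union> C2 \<union> C3"
    and W1: "\<exists>i<n. z i \<in> W1" and W2: "\<exists>i<n. z i \<in> W2"
    and nm1: "\<not> missed n z" and nm2: "\<not> missed n (\<lambda>i. prod.swap (z i))"
  shows "(\<not> (\<exists>i<n. \<forall>j<n. arc (z i) (z j)) \<and> (\<exists>i<n. \<exists>k<n. \<forall>j<n. arc (z i) (z j) \<or> arc (z k) (z j)))
    \<longleftrightarrow> (\<exists>i<n. \<exists>k<n. i \<noteq> k \<and> z i \<in> W1 \<and> z k \<in> W2 \<and> (\<forall>j\<in>{..<n} - {i, k}. z j \<notin> uncaught (z i) (z k)))"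
    (is "?L \<longleftrightarrow> ?R")
proof -
  have W2': "\<exists>i<n. prod.swap (z i) \<in> W1" using W2 by (simp add: W2_def)
  obtain j1 where j1: "j1 < n" "\<And>i. i < n \<Longrightarrow> z i \<in> C1 \<union> C3 \<Longrightarrow> \<not> arc (z i) (z j1)"
    using not_dominated_by_C1_C3[OF W1 nm1] by metis
  have sw3: "prod.swap p \<in> C3 \<longleftrightarrow> p \<in> C3" for p by (auto simp: C3_def)
  obtain j2 where j2_swap: "j2 < n" "\<And>i. i < n \<Longrightarrow> prod.swap (z i) \<in> C1 \<union> C3 \<Longrightarrow> \<not> arc (prod.swap (z i)) (prod.swap (z j2))"
    using not_dominated_by_C1_C3[OF W2' nm2] by metis
  have j2: "j2 < n" "\<And>i. i < n \<Longrightarrow> z i \<in> C2 \<union> C3 \<Longrightarrow> \<not> arc (z i) (z j2)"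
    using j2_swap unfolding C2_def arc_swap by (simp_all add: sw3)
  have single: "\<not> (\<exists>i<n. \<forall>j<n. arc (z i) (z j))"
    using j1 j2 C by blast
  \<comment> \<open>Needed because avoidance of \<open>uncaught\<close> says nothing about the
    indices \<open>i\<close> and \<open>k\<close> themselves.\<close>
  have refl: "arc (z i) (z i)" if "i < n" for i
  proof -
    have "1 * (1 - fst (z i)) \<le> r * (1 - fst (z i))" "1 * (1 - snd (z i)) \<le> r * (1 - snd (z i))"
      "1 * (fst (z i) + snd (z i)) \<le> r * (fst (z i) + snd (z i))"
      using S[OF that] r1 by (intro mult_right_mono; simp add: std_simplex_def)+
    then show ?thesis using C[OF that] by (auto simp: arc_def)
  qed
  have "(\<exists>i<n. \<exists>k<n. \<forall>j<n. arc (z i) (z j) \<or> arc (z k) (z j)) \<longleftrightarrow> ?R"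
  proof
    assume ?R
    then obtain i k where ik: "i < n" "k < n" "z i \<in> W1" "z k \<in> W2"
      and un: "\<And>j. j \<in> {..<n} - {i, k} \<Longrightarrow> z j \<notin> uncaught (z i) (z k)" by blast
    have c: "z i \<in> C1" "z k \<in> C2" using ik by (auto simp: W1_def W2_def C2_def)
    have "arc (z i) (z j) \<or> arc (z k) (z j)" if "j < n" for j
    proof (cases "j = i \<or> j = k")
      case True
      then show ?thesis using refl ik by auto
    next
      case False
      then have "\<not> (fst (z j) < r * (fst (z i) - m) \<and> snd (z j) < r * (snd (z k) - m))"
        using un[of j] that by (auto simp: uncaught_def)
      then show ?thesis using c r_m by (auto simp: arc_def algebra_simps)
    qed
    with ik show "\<exists>i<n. \<exists>k<n. \<forall>j<n. arc (z i) (z j) \<or> arc (z k) (z j)" by blast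
  next
    assume "\<exists>i<n. \<exists>k<n. \<forall>j<n. arc (z i) (z j) \<or> arc (z k) (z j)"
    then obtain i k where ik: "i < n" "k < n" and dom: "\<And>j. j < n \<Longrightarrow> arc (z i) (z j) \<or> arc (z k) (z j)" by blast
    have "(z i \<in> C1 \<and> z k \<in> C2) \<or> (z k \<in> C1 \<and> z i \<in> C2)"
      using j1 j2 C[OF ik(1)] C[OF ik(2)] dom ik by blast
    then obtain i' k' where ik': "i' < n" "k' < n" "z i' \<in> C1" "z k' \<in> C2"
      and dom': "\<And>j. j < n \<Longrightarrow> arc (z i') (z j) \<or> arc (z k') (z j)"
      using ik dom by blast
    obtain i0 where i0: "i0 < n" "z i0 \<in> W1" "\<And>j. j < n \<Longrightarrow> z j \<in> C1 \<Longrightarrow> fst (z i0) \<le> fst (z j)"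
      using W1_minimizer[OF W1] by metis
    obtain k0 where k0: "k0 < n" "prod.swap (z k0) \<in> W1" "\<And>j. j < n \<Longrightarrow> prod.swap (z j) \<in> C1 \<Longrightarrow> fst (prod.swap (z k0)) \<le> fst (prod.swap (z j))"
      using W1_minimizer[OF W2'] by metis
    have k0': "z k0 \<in> W2" "\<And>j. j < n \<Longrightarrow> z j \<in> C2 \<Longrightarrow> snd (z k0) \<le> snd (z j)"
      using k0 by (auto simp: W2_def C2_def)
    have "i0 \<noteq> k0" using i0 k0' by (auto simp: W1_def W2_def C1_def)
    moreover have "z j \<notin> uncaught (z i0) (z k0)" if "j < n" for j
    proof -
      have "\<not> (z j \<in> W1 \<and> fst (z j) < fst (z i0))" using i0(3)[OF that] by (auto simp: W1_def)
      moreover have "\<not> (z j \<in> W2 \<and> snd (z j) < snd (z k0))" using k0'(2)[OF that] by (auto simp: W1_def W2_def C2_def)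
      moreover have "\<not> (fst (z j) < r * (fst (z i0) - m) \<and> snd (z j) < r * (snd (z k0) - m))"
      proof
        assume *: "fst (z j) < r * (fst (z i0) - m) \<and> snd (z j) < r * (snd (z k0) - m)"
        \<comment> \<open>The extremal points \<open>i0\<close> and \<open>k0\<close> have the
          narrowest strips, so what both of them miss is also missed by \<open>i'\<close> and
          \<open>k'\<close>.\<close>
        have "r * fst (z i0) \<le> r * fst (z i')" "r * snd (z k0) \<le> r * snd (z k')"
          using i0(3)[of i'] k0'(2)[of k'] ik' r1 by auto
        with * r_m have "fst (z j) < r * fst (z i') - (r - 1)" "snd (z j) < r * snd (z k') - (r - 1)"
          by (auto simp: algebra_simps)
        moreover have "z i' \<notin> C2" "z i' \<notin> C3" "z k' \<notin> C1" "z k' \<notin> C3" using ik' C_disjoint by auto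
        ultimately show False using dom'[OF that] by (auto simp: arc_def algebra_simps)
      qed
      ultimately show ?thesis by (auto simp: uncaught_def)
    qed
    ultimately show ?R using i0 k0 k0' by blast
  qed
  with single show ?thesis by blast
qed

end

context pe_iid
begin

lemma AE_Z:
  assumes "AE z in unif_simplex. Q z"
  shows "AE \<omega> in P. Q (Z i \<omega>)"
proof -
  have "AE z in distr P borel (Z i). Q z" unfolding law_Z by (rule assms)
  then show ?thesis by (rule AE_distrD[OF Z_measurable])
qed

text \<open>A measurable substitute for the event that the domination number is 2:
  \<open>arc\<close> is built from the open regions and does not mention \<open>v\<close>.\<close>

definition two_dominated :: "nat \<Rightarrow> 'a set" where
  "two_dominated n = {\<omega>\<in>space P. \<not> (\<exists>i<n. \<forall>j<n. arc (Z i \<omega>) (Z j \<omega>))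
     \<and> (\<exists>i<n. \<exists>k<n. \<forall>j<n. arc (Z i \<omega>) (Z j \<omega>) \<or> arc (Z k \<omega>) (Z j \<omega>))}"

lemma two_dominated_sets [measurable]: "two_dominated n \<in> sets P"
  unfolding two_dominated_def arc_def by measurable

text \<open>Off a null set and \<open>err\<close>, \<open>two_dominate_iff\<close> identifies the
  event with \<open>some_pair\<close>. The error collects, for each of the labels \<open>p\<close>
  and \<open>q\<close>, a wedge without sample points and a strip without other sample
  points.\<close>

lemma prob_two_dominated_tendsto: "(\<lambda>n. prob (two_dominated n)) \<longlonglongrightarrow> limit_prob r"
proof -
  interpret sw: pe_iid r \<delta> P "\<lambda>i \<omega>. prod.swap (Z i \<omega>)" by (rule pe_iid_swap)
  define N1 where "N1 n = {\<omega>\<in>space P. \<forall>j<n. Z j \<omega> \<notin> W1}" for n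
  define N2 where "N2 n = {\<omega>\<in>space P. \<forall>j<n. prod.swap (Z j \<omega>) \<notin> W1}" for n
  define err where "err n = (N1 n \<union> N2 n) \<union> (missed_strip n \<union> sw.missed_strip n)" for n
  have [measurable]: "N1 n \<in> sets P" "N2 n \<in> sets P" for n
    unfolding N1_def N2_def by measurable
  have [measurable]: "err n \<in> sets P" for n
    unfolding err_def using sw.missed_strip_sets by auto
  have err_le: "prob (err n) \<le> (prob (N1 n) + prob (N2 n)) + (prob (missed_strip n) + prob (sw.missed_strip n))" for n
  proof -
    have "prob (err n) \<le> prob (N1 n \<union> N2 n) + prob (missed_strip n \<union> sw.missed_strip n)"
      unfolding err_def by (rule measure_Un_le) (use sw.missed_strip_sets in auto)
    also have "\<dots> \<le> (prob (N1 n) + prob (N2 n)) + (prob (missed_strip n) + prob (sw.missed_strip n))"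
      by (intro add_mono measure_Un_le) (use sw.missed_strip_sets in auto)
    finally show ?thesis .
  qed
  have err_lim: "(\<lambda>n. (prob (N1 n) + prob (N2 n)) + (prob (missed_strip n) + prob (sw.missed_strip n))) \<longlonglongrightarrow> 0"
  proof -
    have "(\<lambda>n. (prob (N1 n) + prob (N2 n)) + (prob (missed_strip n) + prob (sw.missed_strip n))) \<longlonglongrightarrow> (0 + 0) + (0 + 0)"
      unfolding N1_def N2_def
      by (intro tendsto_add prob_none_in_W1_tendsto sw.prob_none_in_W1_tendsto
            prob_missed_strip_tendsto sw.prob_missed_strip_tendsto)
    then show ?thesis by simp
  qed
  have err0: "(\<lambda>n. prob (err n)) \<longlonglongrightarrow> 0"
    by (rule tendsto_sandwich[OF _ _ tendsto_const err_lim])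
       (intro always_eventually allI measure_nonneg err_le)+
  have AE: "AE \<omega> in P. \<forall>i. Z i \<omega> \<in> std_simplex \<and> Z i \<omega> \<in> C1 \<union> C2 \<union> C3"
    using AE_Z[OF AE_in_std_simplex] AE_Z[OF AE_C] by (simp add: AE_all_countable)
  have iff: "AE \<omega> in P. \<omega> \<notin> err n \<longrightarrow> (\<omega> \<in> two_dominated n \<longleftrightarrow> \<omega> \<in> some_pair n)" for n
    using AE AE_space
  proof eventually_elim
    case (elim \<omega>)
    show ?case
    proof
      assume e: "\<omega> \<notin> err n"
      have "(\<not> (\<exists>i<n. \<forall>j<n. arc (Z i \<omega>) (Z j \<omega>)) \<and> (\<exists>i<n. \<exists>k<n. \<forall>j<n. arc (Z i \<omega>) (Z j \<omega>) \<or> arc (Z k \<omega>) (Z j \<omega>)))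
        \<longleftrightarrow> (\<exists>i<n. \<exists>k<n. i \<noteq> k \<and> Z i \<omega> \<in> W1 \<and> Z k \<omega> \<in> W2 \<and> (\<forall>j\<in>{..<n} - {i, k}. Z j \<omega> \<notin> uncaught (Z i \<omega>) (Z k \<omega>)))"
      proof (rule two_dominate_iff)
        show "\<exists>i<n. Z i \<omega> \<in> W1" "\<exists>i<n. Z i \<omega> \<in> W2"
          using e elim by (auto simp: err_def N1_def N2_def W2_def)
        show "\<not> missed n (\<lambda>i. Z i \<omega>)" "\<not> missed n (\<lambda>i. prod.swap (Z i \<omega>))"
          using e elim by (auto simp: err_def missed_strip_def sw.missed_strip_def missed_def)
      qed (use elim in auto)
      then show "\<omega> \<in> two_dominated n \<longleftrightarrow> \<omega> \<in> some_pair n"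
        using elim by (auto simp: two_dominated_def some_pair_def index_pairs_def pair_event_def)
    qed
  qed
  have "norm (prob (two_dominated n) - prob (some_pair n)) \<le> prob (err n)" for n
  proof -
    have "prob (two_dominated n) \<le> prob (some_pair n \<union> err n)"
      by (rule finite_measure_mono_AE) (use iff[of n] in \<open>auto elim: eventually_mono\<close>)
    also have "\<dots> \<le> prob (some_pair n) + prob (err n)" by (rule measure_Un_le) auto
    finally have 1: "prob (two_dominated n) \<le> prob (some_pair n) + prob (err n)" .
    have "prob (some_pair n) \<le> prob (two_dominated n \<union> err n)"
      by (rule finite_measure_mono_AE) (use iff[of n] in \<open>auto elim: eventually_mono\<close>)
    also have "\<dots> \<le> prob (two_dominated n) + prob (err n)" by (rule measure_Un_le) auto
    finally show ?thesis using 1 by simp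
  qed
  then have "(\<lambda>n. prob (two_dominated n) - prob (some_pair n)) \<longlonglongrightarrow> 0"
    by (intro Lim_null_comparison[OF _ err0] always_eventually allI)
  from tendsto_add[OF this prob_some_pair_tendsto] show ?thesis by simp
qed

end

section \<open>Barycentric coordinates\<close>

locale noncollinear_triangle =
  fixes y :: "3 \<Rightarrow> real^2"
  assumes noncollinear: "\<not> collinear (range y)"
begin

text \<open>After elimination of \<open>d 3\<close>, a nonzero coefficient would make one of
  \<open>y 1 - y 3\<close>, \<open>y 2 - y 3\<close> a multiple of the other or zero, which
  \<open>collinear_lemma\<close> turns into collinearity.\<close>

lemma affine_combination_unique:
  assumes "(\<Sum>j\<in>UNIV. d j) = 0" "(\<Sum>j\<in>UNIV. d j *\<^sub>R y j) = 0"
  shows "d = (\<lambda>_. 0)"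
proof -
  have nc: "\<not> collinear {0, y 1 - y 3, y 2 - y 3}"
  proof -
    have "range y = {y 1, y 3, y 2}" by (auto simp: UNIV_3)
    then show ?thesis using noncollinear collinear_3[of "y 1" "y 3" "y 2"] by simp
  qed
  have "d 1 + d 2 + d 3 = 0" using assms(1) unfolding sum_3 .
  then have d3: "d 3 = - d 1 - d 2" by linarith
  have "d 1 *\<^sub>R y 1 + d 2 *\<^sub>R y 2 + d 3 *\<^sub>R y 3 = 0" using assms(2) unfolding sum_3 .
  then have eq: "d 1 *\<^sub>R (y 1 - y 3) + d 2 *\<^sub>R (y 2 - y 3) = 0"
    unfolding d3 by (simp add: algebra_simps)
  have d2: "d 2 = 0"
  proof (rule ccontr)
    assume "d 2 \<noteq> 0"
    have "d 2 *\<^sub>R (y 2 - y 3) = (- d 1) *\<^sub>R (y 1 - y 3)"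
      using eq by (simp only: scaleR_minus_left eq_neg_iff_add_eq_0 add.commute)
    then have "(1 / d 2) *\<^sub>R (d 2 *\<^sub>R (y 2 - y 3)) = (1 / d 2) *\<^sub>R ((- d 1) *\<^sub>R (y 1 - y 3))"
      by (simp only:)
    then have "y 2 - y 3 = (- d 1 / d 2) *\<^sub>R (y 1 - y 3)"
      using \<open>d 2 \<noteq> 0\<close> by (simp only: scaleR_scaleR) simp
    then show False using nc unfolding collinear_lemma by blast
  qed
  moreover have "d 1 = 0"
  proof (rule ccontr)
    assume "d 1 \<noteq> 0"
    then have "y 1 - y 3 = 0" using eq d2 by simp
    then show False using nc by (simp add: collinear_lemma)
  qed
  ultimately show ?thesis using d3 by (simp add: fun_eq_iff forall_3)
qed

lemma barycentric_eqI:
  assumes "(\<Sum>j\<in>UNIV. b j) = 1" "x = (\<Sum>j\<in>UNIV. b j *\<^sub>R y j)"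
  shows "barycentric y x = b"
  unfolding barycentric_def
proof (rule the_equality)
  show "(\<Sum>j\<in>UNIV. b j) = 1 \<and> x = (\<Sum>j\<in>UNIV. b j *\<^sub>R y j)" using assms by blast
  fix b' assume b': "(\<Sum>j\<in>UNIV. b' j) = 1 \<and> x = (\<Sum>j\<in>UNIV. b' j *\<^sub>R y j)"
  have "(\<lambda>j. b' j - b j) = (\<lambda>_. 0)"
    using b' assms by (intro affine_combination_unique) (simp_all add: sum_subtractf scaleR_left_diff_distrib)
  then show "b' = b" by (simp add: fun_eq_iff)
qed

end

text \<open>An arbitrary labelling of the vertices, so that one argument covers all three choices of
  \<open>M\<close>.\<close>

locale labelled_triangle = noncollinear_triangle y for y :: "3 \<Rightarrow> real^2" +
  fixes p q c :: 3
  assumes labels: "p \<noteq> q" "p \<noteq> c" "q \<noteq> c"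
begin

lemma UNIV_labels: "UNIV = {p, q, c}"
proof -
  have "card {p, q, c} = CARD(3)" using labels by simp
  then show ?thesis by (metis card_subset_eq finite top_greatest)
qed

lemma sum_labels: "(\<Sum>j\<in>UNIV. f j) = f p + f q + (f c :: 'z :: comm_monoid_add)"
  unfolding UNIV_labels using labels by (simp add: add.assoc)

lemma other_label: "UNIV - {k :: 3} \<noteq> {}"
proof -
  have "p \<in> UNIV - {k} \<or> q \<in> UNIV - {k}" using labels by auto
  then show ?thesis by blast
qed

definition point :: "real \<times> real \<Rightarrow> real^2" where
  "point z = y c + (fst z *\<^sub>R (y p - y c) + snd z *\<^sub>R (y q - y c))"

definition coords :: "real^2 \<Rightarrow> real \<times> real" where
  "coords x = (barycentric y x p, barycentric y x q)"

text \<open>The linear part of \<open>point\<close>, placed on \<open>real^2\<close>, where its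
  effect on area is given by a determinant.\<close>

definition lin :: "real^2 \<Rightarrow> real^2" where
  "lin x = x $ 1 *\<^sub>R (y p - y c) + x $ 2 *\<^sub>R (y q - y c)"

lemma linear_lin: "linear lin"
  unfolding lin_def by (rule linearI) (simp_all add: algebra_simps)

lemma barycentric_point:
  "barycentric y (point z) = (\<lambda>j. if j = p then fst z else if j = q then snd z else 1 - fst z - snd z)"
  by (rule barycentric_eqI) (use labels in \<open>auto simp: sum_labels point_def algebra_simps\<close>)

lemma coords_point [simp]: "coords (point z) = z"
  using labels by (simp add: coords_def barycentric_point)

lemma inj_lin: "inj lin"
  unfolding linear_injective_0[OF linear_lin]
proof safe
  fix x assume "lin x = 0"
  then have "point (x $ 1, x $ 2) = point (0, 0)" by (simp add: point_def lin_def)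
  then have "coords (point (x $ 1, x $ 2)) = coords (point (0, 0))" by simp
  then show "x = 0" by (simp add: vec_eq_iff forall_2)
qed

lemma surj_lin: "surj lin"
  using linear_injective_imp_surjective[OF linear_lin inj_lin] by simp

lemma point_eq_lin: "point z = y c + lin (vector [fst z, snd z])"
  by (simp add: point_def lin_def)

lemma point_coords [simp]: "point (coords x) = x"
proof -
  obtain w where w: "x - y c = lin w" using surj_lin by (metis surjD)
  then have "x = point (w $ 1, w $ 2)" by (simp add: point_def lin_def algebra_simps)
  then show ?thesis by simp
qed

lemma barycentric_coords:
  "barycentric y x p = fst (coords x)" "barycentric y x q = snd (coords x)"
  "barycentric y x c = 1 - fst (coords x) - snd (coords x)"
proof -
  show "barycentric y x p = fst (coords x)" "barycentric y x q = snd (coords x)" by (simp_all add: coords_def)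
  show "barycentric y x c = 1 - fst (coords x) - snd (coords x)"
    using barycentric_point[of "coords x"] labels by simp
qed

lemma sum_barycentric: "(\<Sum>j\<in>UNIV. barycentric y x j) = 1"
  by (simp add: sum_labels barycentric_coords)

lemma sum_barycentric_scaleR: "(\<Sum>j\<in>UNIV. barycentric y x j *\<^sub>R y j) = x"
proof -
  have "(\<Sum>j\<in>UNIV. barycentric y x j *\<^sub>R y j) = point (coords x)"
    by (simp add: sum_labels barycentric_coords point_def algebra_simps)
  then show ?thesis by simp
qed

lemma barycentric_affine:
  assumes "s + t = 1"
  shows "barycentric y (s *\<^sub>R x + t *\<^sub>R x') = (\<lambda>j. s * barycentric y x j + t * barycentric y x' j)"
proof (rule barycentric_eqI)
  show "(\<Sum>j\<in>UNIV. s * barycentric y x j + t * barycentric y x' j) = 1"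
    using assms by (simp add: sum.distrib sum_distrib_left[symmetric] sum_barycentric)
  have "(\<Sum>j\<in>UNIV. (s * barycentric y x j + t * barycentric y x' j) *\<^sub>R y j)
    = s *\<^sub>R (\<Sum>j\<in>UNIV. barycentric y x j *\<^sub>R y j) + t *\<^sub>R (\<Sum>j\<in>UNIV. barycentric y x' j *\<^sub>R y j)"
    by (simp add: scaleR_left_distrib sum.distrib scaleR_sum_right)
  then show "s *\<^sub>R x + t *\<^sub>R x' = (\<Sum>j\<in>UNIV. (s * barycentric y x j + t * barycentric y x' j) *\<^sub>R y j)"
    by (simp add: sum_barycentric_scaleR)
qed

lemma barycentric_vertex: "barycentric y (y k) = (\<lambda>j. if j = k then 1 else 0)"
  by (rule barycentric_eqI) (auto simp: if_distrib[of "\<lambda>s. s *\<^sub>R _"] cong: if_cong)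

lemma convex_barycentric_halfplane: "convex {x. \<alpha> * barycentric y x i \<le> \<beta> * barycentric y x j}"
proof (rule convexI)
  fix x x' and s t :: real
  assume "x \<in> {x. \<alpha> * barycentric y x i \<le> \<beta> * barycentric y x j}" "x' \<in> {x. \<alpha> * barycentric y x i \<le> \<beta> * barycentric y x j}"
    and st: "0 \<le> s" "0 \<le> t" "s + t = 1"
  then have "s * (\<alpha> * barycentric y x i) + t * (\<alpha> * barycentric y x' i) \<le> s * (\<beta> * barycentric y x j) + t * (\<beta> * barycentric y x' j)"
    by (intro add_mono mult_left_mono) auto
  then show "s *\<^sub>R x + t *\<^sub>R x' \<in> {x. \<alpha> * barycentric y x i \<le> \<beta> * barycentric y x j}"
    by (simp add: barycentric_affine[OF st(3)] algebra_simps)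
qed

section \<open>Cevian feet and vertex regions\<close>

lemma edge_opposite_barycentric: "x \<in> edge_opposite y k \<Longrightarrow> barycentric y x k = 0"
proof -
  assume x: "x \<in> edge_opposite y k"
  have "convex {x. barycentric y x k = 0}"
    by (rule convexI) (simp add: barycentric_affine)
  moreover have "y ` (UNIV - {k}) \<subseteq> {x. barycentric y x k = 0}"
    by (auto simp: barycentric_vertex)
  ultimately have "edge_opposite y k \<subseteq> {x. barycentric y x k = 0}"
    unfolding edge_opposite_def by (intro hull_minimal)
  with x show ?thesis by auto
qed

text \<open>Deleting the \<open>k\<close>-th weight of \<open>M\<close> and renormalising gives a
  point of the edge on the cevian. It is unique: the \<open>k\<close>-th coordinate of
  \<open>s *\<^sub>R y k + t *\<^sub>R M\<close> is \<open>s + t * w k\<close>, which with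
  \<open>s + t = 1\<close> vanishes only at \<open>t = 1 / (1 - w k)\<close>.\<close>

lemma cevian_foot_eq:
  assumes w: "\<And>j. 0 < barycentric y M j"
  defines "foot k \<equiv> (\<Sum>j\<in>UNIV - {k}. (barycentric y M j / (1 - barycentric y M k)) *\<^sub>R y j)"
  shows "cevian_foot y M k = foot k"
proof -
  define w where "w = barycentric y M"
  have sum: "(\<Sum>j\<in>UNIV - {k}. w j) = 1 - w k"
    using sum_barycentric[of M] by (simp add: w_def sum.remove[of UNIV k])
  have "UNIV - {k} \<noteq> {}" by (rule other_label)
  then have "0 < (\<Sum>j\<in>UNIV - {k}. w j)" by (intro sum_pos) (auto simp: w_def assms)
  then have pos: "0 < 1 - w k" using sum by simp
  have M: "M = w k *\<^sub>R y k + (\<Sum>j\<in>UNIV - {k}. w j *\<^sub>R y j)"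
    using sum_barycentric_scaleR[of M] by (simp add: w_def sum.remove[of UNIV k])
  have foot: "foot k = (1 / (1 - w k)) *\<^sub>R (\<Sum>j\<in>UNIV - {k}. w j *\<^sub>R y j)"
    by (simp add: foot_def w_def scaleR_sum_right)
  have "(\<Sum>j\<in>UNIV - {k}. w j *\<^sub>R y j) = M - w k *\<^sub>R y k" using M by simp
  then have foot2: "foot k = (- w k / (1 - w k)) *\<^sub>R y k + (1 / (1 - w k)) *\<^sub>R M"
    unfolding foot by (simp add: scaleR_diff_right)
  have one: "- w k / (1 - w k) + 1 / (1 - w k) = 1" using pos by (simp add: divide_simps)
  show ?thesis unfolding cevian_foot_def
  proof (rule the_equality)
    have "foot k \<in> affine hull {y k, M}"
      unfolding affine_hull_2 using foot2 one by blast
    moreover have "foot k \<in> edge_opposite y k"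
      unfolding edge_opposite_def foot_def
    proof (rule convex_sum)
      show "(\<Sum>j\<in>UNIV - {k}. barycentric y M j / (1 - barycentric y M k)) = 1"
        using sum pos by (simp add: w_def sum_divide_distrib[symmetric])
    qed (use pos assms in \<open>auto simp: w_def less_imp_le hull_inc\<close>)
    ultimately show "foot k \<in> affine hull {y k, M} \<and> foot k \<in> edge_opposite y k" by blast
  next
    fix x assume x: "x \<in> affine hull {y k, M} \<and> x \<in> edge_opposite y k"
    then obtain s t where st: "x = s *\<^sub>R y k + t *\<^sub>R M" "s + t = 1" by (auto simp: affine_hull_2)
    have "s * 1 + t * w k = 0"
      using edge_opposite_barycentric[of x k] x
      unfolding st(1) barycentric_affine[OF st(2)] by (simp add: barycentric_vertex w_def)
    then have "t * (1 - w k) = 1" using st(2) by (simp add: algebra_simps)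
    then have "t = 1 / (1 - w k)" using pos by (simp add: field_simps)
    moreover have "s = - w k / (1 - w k)" using one st(2) calculation by simp
    ultimately show "x = foot k" using st(1) foot2 by simp
  qed
qed

lemma barycentric_cevian_foot:
  assumes w: "\<And>j. 0 < barycentric y M j"
  shows "barycentric y (cevian_foot y M k) = (\<lambda>j. if j = k then 0 else barycentric y M j / (1 - barycentric y M k))"
proof (rule barycentric_eqI)
  have sum: "(\<Sum>j\<in>UNIV - {k}. barycentric y M j) = 1 - barycentric y M k"
    using sum_barycentric[of M] by (simp add: sum.remove[of UNIV k])
  have "UNIV - {k} \<noteq> {}" by (rule other_label)
  then have "0 < (\<Sum>j\<in>UNIV - {k}. barycentric y M j)" by (intro sum_pos) (auto simp: w)
  then have "0 < 1 - barycentric y M k" using sum by simp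
  then show "(\<Sum>j\<in>UNIV. if j = k then 0 else barycentric y M j / (1 - barycentric y M k)) = 1"
    using sum by (simp add: sum.remove[of UNIV k] sum_divide_distrib[symmetric])
  show "cevian_foot y M k = (\<Sum>j\<in>UNIV. (if j = k then 0 else barycentric y M j / (1 - barycentric y M k)) *\<^sub>R y j)"
    unfolding cevian_foot_eq[OF w] by (simp add: sum.remove[of UNIV k])
qed

text \<open>The generators of the quadrilateral satisfy the inequality and half-planes are convex. A
  necessary condition suffices, as \<open>vertex_choice_eq\<close> finds \<open>v x\<close> by
  excluding the other two regions.\<close>

lemma vertex_region_barycentric:
  assumes w: "\<And>j. 0 < barycentric y M j" and x: "x \<in> vertex_region y M j"
  shows "barycentric y M j * barycentric y x k \<le> barycentric y M k * barycentric y x j"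
proof -
  have "vertex_region y M j \<subseteq> {x. barycentric y M j * barycentric y x k \<le> barycentric y M k * barycentric y x j}"
    unfolding vertex_region_def
  proof (rule hull_minimal)
    have lt1: "barycentric y M l < 1" for l
    proof -
      have "UNIV - {l} \<noteq> {}" by (rule other_label)
      then have "0 < (\<Sum>j\<in>UNIV - {l}. barycentric y M j)" by (intro sum_pos) (auto simp: w)
      then show ?thesis using sum_barycentric[of M] by (simp add: sum.remove[of UNIV l])
    qed
    show "{y j, M} \<union> cevian_foot y M ` (UNIV - {j}) \<subseteq> {x. barycentric y M j * barycentric y x k \<le> barycentric y M k * barycentric y x j}"
      using w lt1 by (auto simp: barycentric_vertex barycentric_cevian_foot[OF w] less_imp_le mult.commute)
  qed (rule convex_barycentric_halfplane)
  with x show ?thesis by auto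
qed

section \<open>The uniform law in affine coordinates\<close>

lemma point_in_triangle_iff: "point z \<in> closed_triangle y \<longleftrightarrow> z \<in> std_simplex"
proof -
  have "range y = {y c, y p, y q}" using UNIV_labels by auto
  then have "closed_triangle y = {y c + u *\<^sub>R (y p - y c) + v *\<^sub>R (y q - y c) | u v. 0 \<le> u \<and> 0 \<le> v \<and> u + v \<le> 1}"
    by (simp add: closed_triangle_def convex_hull_3_alt)
  also have "\<dots> = point ` std_simplex"
    by (auto simp: point_def std_simplex_def image_def add.assoc)
  finally have "closed_triangle y = point ` std_simplex" .
  moreover have "inj point" by (metis coords_point injI)
  ultimately show ?thesis by (simp add: inj_image_mem_iff)
qed

lemma triangle_iff_coords: "x \<in> closed_triangle y \<longleftrightarrow> coords x \<in> std_simplex"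
  using point_in_triangle_iff[of "coords x"] by simp

lemma coords_measurable [measurable]: "coords \<in> borel_measurable borel"
proof -
  obtain L where L: "linear L" "L \<circ> lin = id"
    using linear_injective_left_inverse[OF linear_lin inj_lin] by blast
  have coords_eq: "coords x = (L (x - y c) $ 1, L (x - y c) $ 2)" for x
  proof -
    obtain w where w: "x - y c = lin w" using surj_lin by (metis surjD)
    then have "x = point (w $ 1, w $ 2)" by (simp add: point_def lin_def algebra_simps)
    then have cx: "coords x = (w $ 1, w $ 2)" by (metis coords_point)
    have "L (lin w) = w" using L(2) by (simp add: fun_eq_iff)
    then show ?thesis by (simp add: cx w)
  qed
  have "continuous_on UNIV (\<lambda>x. L (x - y c))"
    by (rule bounded_linear.continuous_on[OF linear_conv_bounded_linear[THEN iffD1, OF L(1)]])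
       (intro continuous_intros)
  then have "continuous_on UNIV (\<lambda>x. (L (x - y c) $ 1, L (x - y c) $ 2))"
    by (intro continuous_on_Pair continuous_on_component)
  then have "continuous_on UNIV coords"
    unfolding coords_eq[abs_def, symmetric] .
  then show ?thesis by (rule borel_measurable_continuous_onI)
qed

lemma borel_measurable_vector2 [measurable]:
  "(\<lambda>z :: real \<times> real. vector [fst z, snd z] :: real^2) \<in> borel_measurable borel"
proof (rule borel_measurable_continuous_onI)
  have eq: "(\<lambda>z :: real \<times> real. vector [fst z, snd z] :: real^2) = (\<lambda>z. fst z *\<^sub>R axis 1 1 + snd z *\<^sub>R axis 2 1)"
    by (simp add: fun_eq_iff vec_eq_iff forall_2 axis_def)
  show "continuous_on UNIV (\<lambda>z :: real \<times> real. vector [fst z, snd z] :: real^2)"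
    unfolding eq by (intro continuous_intros)
qed

text \<open>Carries area from pairs, where masses are computed, to \<open>real^2\<close>, where the
  sample lives; it is enough to compare boxes.\<close>

lemma distr_vector_lborel: "distr lborel borel (\<lambda>z. vector [fst z, snd z] :: real^2) = lborel"
proof (rule lborel_eqI[symmetric])
  fix l u :: "real^2"
  assume le: "\<And>b. b \<in> Basis \<Longrightarrow> l \<bullet> b \<le> u \<bullet> b"
  have le12: "l $ 1 \<le> u $ 1" "l $ 2 \<le> u $ 2"
    using le[of "axis 1 1"] le[of "axis 2 1"] by (auto simp: inner_axis)
  have "(\<lambda>z :: real \<times> real. vector [fst z, snd z] :: real^2) -` box l u = {l $ 1<..<u $ 1} \<times> {l $ 2<..<u $ 2}"
    by (auto simp: mem_box_cart forall_2)
  then have "emeasure (distr lborel borel (\<lambda>z. vector [fst z, snd z] :: real^2)) (box l u) = ennreal ((u $ 1 - l $ 1) * (u $ 2 - l $ 2))"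
    using le12 by (subst emeasure_distr) (auto simp: emeasure_lborel_Times ennreal_mult)
  also have "(u $ 1 - l $ 1) * (u $ 2 - l $ 2) = (\<Prod>b\<in>Basis. (u - l) \<bullet> b)"
  proof -
    have B: "(Basis :: (real^2) set) = {axis 1 1, axis 2 1}" by (auto simp: Basis_vec_def UNIV_2)
    have ne: "axis 1 1 \<noteq> (axis 2 1 :: real^2)" by (simp add: axis_eq_axis)
    have "(\<Prod>b\<in>Basis. (u - l) \<bullet> b) = ((u - l) \<bullet> axis 1 1) * ((u - l) \<bullet> axis 2 1)"
      unfolding B using ne by simp
    then show ?thesis by (simp add: inner_axis)
  qed
  finally show "emeasure (distr lborel borel (\<lambda>z. vector [fst z, snd z] :: real^2)) (box l u) = (\<Prod>b\<in>Basis. (u - l) \<bullet> b)" .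
qed simp

text \<open>\<open>K\<close> is the absolute determinant of \<open>lin\<close> and cancels in the
  uniform law. The determinant formula concerns sets of finite \<open>lebesgue\<close> measure,
  hence the restriction to subsets of the simplex and the detour from \<open>lborel\<close>.\<close>

lemma emeasure_point_image:
  obtains K where "0 < K" "\<And>B. B \<in> sets borel \<Longrightarrow> B \<subseteq> std_simplex \<Longrightarrow>
     emeasure lborel {x. coords x \<in> B} = ennreal K * emeasure lborel B"
proof
  define K where "K = \<bar>det (matrix lin)\<bar>"
  show "0 < K" unfolding K_def
    using inj_lin linear_lin by (metis abs_ge_zero abs_eq_0_iff det_nz_iff_inj order_less_le)
  fix B assume B: "B \<in> sets borel" "B \<subseteq> std_simplex"
  let ?V = "\<lambda>z :: real \<times> real. vector [fst z, snd z] :: real^2"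
  have cont: "continuous_on UNIV (\<lambda>x :: real^2. (x $ 1, x $ 2))" by (intro continuous_intros)
  have m: "(\<lambda>x :: real^2. (x $ 1, x $ 2)) \<in> borel_measurable borel"
    by (rule borel_measurable_continuous_onI[OF cont])
  have VB_eq: "?V ` B = (\<lambda>x. (x $ 1, x $ 2)) -` B"
  proof safe
    fix x :: "real^2" assume "(x $ 1, x $ 2) \<in> B"
    then have "?V (x $ 1, x $ 2) \<in> ?V ` B" by blast
    moreover have "?V (x $ 1, x $ 2) = x" by (simp add: vec_eq_iff forall_2)
    ultimately show "x \<in> ?V ` B" by simp
  qed auto
  have VB: "?V ` B \<in> sets borel"
    unfolding VB_eq using measurable_sets[OF m B(1)] by simp
  have injV: "inj ?V" by (rule injI) (auto simp: vec_eq_iff forall_2 prod_eq_iff)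
  have "emeasure lborel (?V ` B) = emeasure (distr lborel borel ?V) (?V ` B)"
    by (simp add: distr_vector_lborel)
  also have "\<dots> = emeasure lborel B"
    using VB injV by (subst emeasure_distr) (auto simp: inj_vimage_image_eq)
  finally have eV: "emeasure lborel (?V ` B) = emeasure lborel B" .
  have finB: "emeasure lborel B < \<infinity>"
  proof -
    have "emeasure lborel B \<le> emeasure lborel std_simplex" using B by (intro emeasure_mono) auto
    also have "\<dots> < \<infinity>" by (simp only: emeasure_std_simplex infinity_ennreal_def ennreal_less_top)
    finally show ?thesis .
  qed
  have lm: "?V ` B \<in> lmeasurable"
    using VB finB eV by (auto simp: fmeasurable_def)
  have lm2: "lin ` ?V ` B \<in> lmeasurable" "measure lebesgue (lin ` ?V ` B) = K * measure lebesgue (?V ` B)"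
    using measurable_linear_image[OF linear_lin lm] measure_linear_image[OF linear_lin lm] by (auto simp: K_def)
  have lm3: "(+) (y c) ` lin ` ?V ` B \<in> lmeasurable"
    using lm2(1) by (rule measurable_translation)
  have set_eq: "{x. coords x \<in> B} = (+) (y c) ` lin ` ?V ` B"
  proof -
    have "(+) (y c) ` lin ` ?V ` B = point ` B" by (auto simp: image_image point_eq_lin)
    moreover have "{x. coords x \<in> B} = point ` B"
      by (auto simp: image_iff intro!: bexI[of _ "coords _"])
    ultimately show ?thesis by simp
  qed
  have borelx: "{x. coords x \<in> B} \<in> sets borel"
    using measurable_sets[OF coords_measurable B(1)] by (simp add: vimage_def)
  have "emeasure lborel {x. coords x \<in> B} = emeasure lebesgue {x. coords x \<in> B}"
    using borelx by simp
  also have "\<dots> = ennreal (measure lebesgue {x. coords x \<in> B})"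
    using lm3 unfolding set_eq by (simp add: emeasure_eq_measure2 fmeasurableD2)
  also have "measure lebesgue {x. coords x \<in> B} = K * measure lebesgue (?V ` B)"
    unfolding set_eq measure_translation lm2(2) ..
  also have "ennreal (K * measure lebesgue (?V ` B)) = ennreal K * emeasure lebesgue (?V ` B)"
    using lm \<open>0 < K\<close> by (simp add: ennreal_mult emeasure_eq_measure2 fmeasurableD2)
  also have "emeasure lebesgue (?V ` B) = emeasure lborel B"
    using VB eV by simp
  finally show "emeasure lborel {x. coords x \<in> B} = ennreal K * emeasure lborel B" .
qed

lemma distr_coords_uniform:
  "distr (uniform_measure lborel (closed_triangle y)) borel coords = unif_simplex"
proof (rule measure_eqI)
  obtain K where K: "0 < K" "\<And>B. B \<in> sets borel \<Longrightarrow> B \<subseteq> std_simplex \<Longrightarrow>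
     emeasure lborel {x. coords x \<in> B} = ennreal K * emeasure lborel B"
    using emeasure_point_image by metis
  fix A assume "A \<in> sets (distr (uniform_measure lborel (closed_triangle y)) borel coords)"
  then have A [measurable]: "A \<in> sets borel" by simp
  have T: "closed_triangle y = {x. coords x \<in> std_simplex}" by (auto simp: triangle_iff_coords)
  have [measurable]: "closed_triangle y \<in> sets borel" "coords -` A \<in> sets borel"
    unfolding T using measurable_sets[OF coords_measurable std_simplex_sets] measurable_sets[OF coords_measurable A]
    by (simp_all add: vimage_def)
  have "emeasure (distr (uniform_measure lborel (closed_triangle y)) borel coords) A
      = emeasure (uniform_measure lborel (closed_triangle y)) (coords -` A)"
    by (subst emeasure_distr) auto
  also have "\<dots> = emeasure lborel (closed_triangle y \<inter> coords -` A) / emeasure lborel (closed_triangle y)"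
    by (rule emeasure_uniform_measure) auto
  also have "closed_triangle y \<inter> coords -` A = {x. coords x \<in> std_simplex \<inter> A}" by (auto simp: T)
  also have "emeasure lborel \<dots> = ennreal K * emeasure lborel (std_simplex \<inter> A)"
    by (rule K(2)) auto
  also have "emeasure lborel (closed_triangle y) = ennreal K * emeasure lborel std_simplex"
    unfolding T by (rule K(2)) auto
  also have "ennreal K * emeasure lborel (std_simplex \<inter> A) / (ennreal K * emeasure lborel std_simplex)
     = emeasure lborel (std_simplex \<inter> A) / emeasure lborel std_simplex"
  proof -
    have "emeasure lborel (std_simplex \<inter> A) \<le> emeasure lborel std_simplex" by (rule emeasure_mono) auto
    also have "\<dots> < \<infinity>" by (simp only: emeasure_std_simplex infinity_ennreal_def ennreal_less_top)
    finally obtain s where s: "0 \<le> s" "emeasure lborel (std_simplex \<inter> A) = ennreal s"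
      by (cases "emeasure lborel (std_simplex \<inter> A)") auto
    have "ennreal K * ennreal s / (ennreal K * ennreal (1 / 2)) = ennreal (K * s) / ennreal (K * (1 / 2))"
      using K(1) s(1) by (subst (1 2) ennreal_mult) auto
    also have "\<dots> = ennreal ((K * s) / (K * (1 / 2)))"
      by (rule divide_ennreal) (use K(1) s(1) in auto)
    also have "(K * s) / (K * (1 / 2)) = s / (1 / 2)" using K(1) by simp
    also have "ennreal (s / (1 / 2)) = ennreal s / ennreal (1 / 2)"
      by (rule divide_ennreal[symmetric]) (use s(1) in auto)
    finally show ?thesis unfolding s(2) emeasure_std_simplex .
  qed
  also have "\<dots> = emeasure unif_simplex A"
    unfolding unif_simplex_def by (rule emeasure_uniform_measure[symmetric]) auto
  finally show "emeasure (distr (uniform_measure lborel (closed_triangle y)) borel coords) A = emeasure unif_simplex A" .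
qed simp

end

section \<open>Domination number of the digraph\<close>

text \<open>\<open>R\<close> is the closed out-neighbourhood relation. The two dominators on the
  right might formally coincide, which the first conjunct rules out; for empty \<open>V\<close> both
  sides fail.\<close>

lemma domination_number_eq_2_iff:
  assumes fin: "finite V" and verts: "verts G = V"
    and dom: "\<And>S. dominating_set G S \<longleftrightarrow> S \<subseteq> V \<and> (\<forall>w\<in>V. \<exists>u\<in>S. R u w)"
    and refl: "\<And>u. u \<in> V \<Longrightarrow> R u u"
  shows "domination_number G = 2 \<longleftrightarrow>
    \<not> (\<exists>u\<in>V. \<forall>w\<in>V. R u w) \<and> (\<exists>u\<in>V. \<exists>u'\<in>V. \<forall>w\<in>V. R u w \<or> R u' w)"
proof
  let ?Q = "\<lambda>k. \<exists>S. dominating_set G S \<and> card S = k"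
  assume two: "domination_number G = 2"
  \<comment> \<open>Reflexivity makes \<open>V\<close> itself dominating, so the
    \<open>LEAST\<close> is attained.\<close>
  have ex: "?Q (card V)" using dom refl by blast
  have "?Q 2" using LeastI[of ?Q, OF ex] two unfolding domination_number_def by simp
  then obtain S where S: "dominating_set G S" "card S = 2" by blast
  then obtain u u' where "S = {u, u'}" by (auto simp: card_2_iff)
  then have "u \<in> V" "u' \<in> V" "\<forall>w\<in>V. R u w \<or> R u' w"
    using S dom by auto
  moreover have "\<not> (\<exists>u\<in>V. \<forall>w\<in>V. R u w)"
  proof
    assume "\<exists>u\<in>V. \<forall>w\<in>V. R u w"
    then obtain u where "u \<in> V" "\<forall>w\<in>V. R u w" by blast
    then have "dominating_set G {u}" using dom by auto
    then have "?Q 1" by (intro exI[of _ "{u}"]) simp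
    then have "domination_number G \<le> 1" unfolding domination_number_def by (rule Least_le)
    with two show False by simp
  qed
  ultimately show "\<not> (\<exists>u\<in>V. \<forall>w\<in>V. R u w) \<and> (\<exists>u\<in>V. \<exists>u'\<in>V. \<forall>w\<in>V. R u w \<or> R u' w)" by blast
next
  assume a: "\<not> (\<exists>u\<in>V. \<forall>w\<in>V. R u w) \<and> (\<exists>u\<in>V. \<exists>u'\<in>V. \<forall>w\<in>V. R u w \<or> R u' w)"
  then obtain u u' where u: "u \<in> V" "u' \<in> V" "\<forall>w\<in>V. R u w \<or> R u' w" by blast
  then have "u \<noteq> u'" using a by blast
  show "domination_number G = 2" unfolding domination_number_def
  proof (rule Least_equality)
    have "dominating_set G {u, u'}" using u dom by auto
    then show "\<exists>S. dominating_set G S \<and> card S = 2"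
      using \<open>u \<noteq> u'\<close> by (intro exI[of _ "{u, u'}"]) simp
  next
    fix k assume "\<exists>S. dominating_set G S \<and> card S = k"
    then obtain S where S: "S \<subseteq> V" "\<forall>w\<in>V. \<exists>u\<in>S. R u w" "card S = k" using dom by auto
    \<comment> \<open>An infinite set has \<open>card\<close> 0, so \<open>k \<noteq> 0\<close>
      needs finiteness besides nonemptiness.\<close>
    have "finite S" using S fin finite_subset by blast
    have "S \<noteq> {}" using S(2) u(1) by blast
    then have "k \<noteq> 0" using S(3) \<open>finite S\<close> by auto
    moreover have "k \<noteq> 1"
    proof
      assume "k = 1"
      then obtain s where "S = {s}" using S(3) by (auto simp: card_1_singleton_iff)
      then show False using S a by auto
    qed
    ultimately show "2 \<le> k" by simp
  qed
qed

lemma dominating_set_PE_digraph_iff: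
  assumes "\<And>u. u \<in> V \<Longrightarrow> u \<in> PE_region y r v u"
  shows "dominating_set (PE_digraph y r v V) S \<longleftrightarrow> S \<subseteq> V \<and> (\<forall>w\<in>V. \<exists>u\<in>S. w \<in> PE_region y r v u)"
proof -
  have "(u, w) \<in> arcs_ends (PE_digraph y r v V) \<longleftrightarrow> u \<in> V \<and> w \<in> V \<and> u \<noteq> w \<and> w \<in> PE_region y r v u" for u w
    by (auto simp: arcs_ends_def arc_to_ends_def PE_digraph_def image_iff)
  note arcs = this
  have dominated: "w \<in> S \<or> (\<exists>u\<in>S. (u, w) \<in> arcs_ends (PE_digraph y r v V)) \<longleftrightarrow> (\<exists>u\<in>S. w \<in> PE_region y r v u)"
    if "S \<subseteq> V" "w \<in> V" for w
  proof (cases "w \<in> S")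
    case True
    then show ?thesis using assms[OF that(2)] by blast
  next
    case False
    then show ?thesis using that unfolding arcs by blast
  qed
  have verts: "verts (PE_digraph y r v V) = V" by (simp add: PE_digraph_def)
  show ?thesis unfolding dominating_set_def verts
    by (intro conj_cong ball_cong refl dominated)
qed

section \<open>Proximity regions in coordinates\<close>

locale pe_triangle = labelled_triangle y p q c + pe_window r \<delta>
  for y p q c r \<delta> +
  fixes M :: "real^2" and v :: "real^2 \<Rightarrow> 3"
  assumes M_eq: "M = tr_vertex y r c" and choice: "vertex_choice y M v"
begin

lemma barycentric_M:
  "barycentric y M p = m" "barycentric y M q = m" "barycentric y M c = 2 / r - 1"
proof -
  have U: "UNIV - {c} = {p, q}" using UNIV_labels labels by auto
  have "barycentric y M = (\<lambda>j. if j = c then 2 / r - 1 else m)"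
    by (rule barycentric_eqI) (use labels in \<open>simp_all add: sum_labels M_eq tr_vertex_def U m_def\<close>)
  then show "barycentric y M p = m" "barycentric y M q = m" "barycentric y M c = 2 / r - 1"
    using labels by auto
qed

lemma barycentric_M_pos: "0 < barycentric y M j"
proof -
  have "j \<in> {p, q, c}" using UNIV_labels by auto
  moreover have "0 < 2 / r - 1" using r1 r2 by (simp add: field_simps)
  ultimately show ?thesis using m_pos barycentric_M by auto
qed

text \<open>By exclusion: the weak inequalities of the other two closed regions contradict the
  strict ones of the open region.\<close>

lemma vertex_choice_eq:
  assumes T: "x \<in> closed_triangle y - range y"
  shows "coords x \<in> C1 \<Longrightarrow> v x = p" "coords x \<in> C2 \<Longrightarrow> v x = q" "coords x \<in> C3 \<Longrightarrow> v x = c"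
proof -
  have reg: "barycentric y M (v x) * barycentric y x k \<le> barycentric y M k * barycentric y x (v x)" for k
    using choice T by (intro vertex_region_barycentric barycentric_M_pos) (auto simp: vertex_choice_def)
  define X Y where "X = fst (coords x)" and "Y = snd (coords x)"
  have bary: "barycentric y x p = X" "barycentric y x q = Y" "barycentric y x c = 1 - X - Y"
    by (simp_all add: barycentric_coords X_def Y_def)
  \<comment> \<open>\<open>m = (r - 1) / r\<close> and \<open>2 / r - 1 = (2 - r) / r\<close>;
    clearing \<open>r\<close> leads to the coefficients in \<open>C1\<close> and
    \<open>C3\<close>.\<close>
  have scale: "m * t \<le> (2 / r - 1) * s \<longleftrightarrow> (r - 1) * t \<le> (2 - r) * s"
    "(2 / r - 1) * s \<le> m * t \<longleftrightarrow> (2 - r) * s \<le> (r - 1) * t" for s t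
  proof -
    have "m * t = (r - 1) * t / r" "(2 / r - 1) * s = (2 - r) * s / r"
      using r1 by (simp_all add: m_def field_simps)
    then show "m * t \<le> (2 / r - 1) * s \<longleftrightarrow> (r - 1) * t \<le> (2 - r) * s"
      "(2 / r - 1) * s \<le> m * t \<longleftrightarrow> (2 - r) * s \<le> (r - 1) * t"
      using r1 by (simp_all only: divide_le_cancel) auto
  qed
  have vx: "v x \<in> {p, q, c}" using UNIV_labels by auto
  show "v x = p" if C: "coords x \<in> C1"
  proof -
    have C': "Y < X" "r - 1 < X + (r - 1) * Y" using C by (auto simp: C1_def X_def Y_def)
    have "v x \<noteq> q"
    proof
      assume "v x = q"
      then have "m * X \<le> m * Y" using reg[of p] bary barycentric_M by simp
      then show False using m_pos C' by simp
    qed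
    moreover have "v x \<noteq> c"
    proof
      assume "v x = c"
      then have "(2 - r) * X \<le> (r - 1) * (1 - X - Y)" using reg[of p] bary barycentric_M scale by simp
      then show False using C' by (simp add: algebra_simps)
    qed
    ultimately show ?thesis using vx by auto
  qed
  show "v x = q" if C: "coords x \<in> C2"
  proof -
    have C': "X < Y" "r - 1 < Y + (r - 1) * X" using C by (auto simp: C1_def C2_def X_def Y_def)
    have "v x \<noteq> p"
    proof
      assume "v x = p"
      then have "m * Y \<le> m * X" using reg[of q] bary barycentric_M by simp
      then show False using m_pos C' by simp
    qed
    moreover have "v x \<noteq> c"
    proof
      assume "v x = c"
      then have "(2 - r) * Y \<le> (r - 1) * (1 - X - Y)" using reg[of q] bary barycentric_M scale by simp
      then show False using C' by (simp add: algebra_simps)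
    qed
    ultimately show ?thesis using vx by auto
  qed
  show "v x = c" if C: "coords x \<in> C3"
  proof -
    have C': "X + (r - 1) * Y < r - 1" "Y + (r - 1) * X < r - 1" using C by (auto simp: C3_def X_def Y_def)
    have "v x \<noteq> p"
    proof
      assume "v x = p"
      then have "(r - 1) * (1 - X - Y) \<le> (2 - r) * X" using reg[of c] bary barycentric_M scale by simp
      then show False using C' by (simp add: algebra_simps)
    qed
    moreover have "v x \<noteq> q"
    proof
      assume "v x = q"
      then have "(r - 1) * (1 - X - Y) \<le> (2 - r) * Y" using reg[of c] bary barycentric_M scale by simp
      then show False using C' by (simp add: algebra_simps)
    qed
    ultimately show ?thesis using vx by auto
  qed
qed

lemma PE_region_iff_arc:
  assumes x: "x \<in> closed_triangle y - range y" and C: "coords x \<in> C1 \<union> C2 \<union> C3" and z: "z \<in> closed_triangle y"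
  shows "z \<in> PE_region y r v x \<longleftrightarrow> arc (coords x) (coords z)"
proof -
  have reg: "z \<in> PE_region y r v x \<longleftrightarrow> 1 - barycentric y z (v x) \<le> r * (1 - barycentric y x (v x))"
    using x z by (simp add: PE_region_def)
  consider "coords x \<in> C1" | "coords x \<in> C2" | "coords x \<in> C3" using C by blast
  then show ?thesis
  proof cases
    case 1
    moreover have "coords x \<notin> C2" "coords x \<notin> C3" using 1 C_disjoint by auto
    ultimately show ?thesis using reg vertex_choice_eq(1)[OF x] by (simp add: arc_def barycentric_coords)
  next
    case 2
    moreover have "coords x \<notin> C1" "coords x \<notin> C3" using 2 C_disjoint by auto
    ultimately show ?thesis using reg vertex_choice_eq(2)[OF x] by (simp add: arc_def barycentric_coords)
  next
    case 3
    moreover have "coords x \<notin> C1" "coords x \<notin> C2" using 3 C_disjoint by auto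
    ultimately show ?thesis using reg vertex_choice_eq(3)[OF x] by (simp add: arc_def barycentric_coords)
  qed
qed

lemma domination_number_PE_eq_2_iff:
  fixes x :: "nat \<Rightarrow> real^2"
  assumes x: "\<And>i. i < n \<Longrightarrow> x i \<in> closed_triangle y - range y"
    and C: "\<And>i. i < n \<Longrightarrow> coords (x i) \<in> C1 \<union> C2 \<union> C3"
  shows "domination_number (PE_digraph y r v (x ` {..<n})) = 2 \<longleftrightarrow>
    \<not> (\<exists>i<n. \<forall>j<n. arc (coords (x i)) (coords (x j)))
     \<and> (\<exists>i<n. \<exists>k<n. \<forall>j<n. arc (coords (x i)) (coords (x j)) \<or> arc (coords (x k)) (coords (x j)))"
proof -
  have iff: "x j \<in> PE_region y r v (x i) \<longleftrightarrow> arc (coords (x i)) (coords (x j))" if "i < n" "j < n" for i j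
    using x[OF that(1)] C[OF that(1)] x[OF that(2)] by (intro PE_region_iff_arc) auto
  have refl: "u \<in> PE_region y r v u" if "u \<in> x ` {..<n}" for u
  proof -
    have u: "u \<in> closed_triangle y" "u \<notin> range y" using that x by auto
    then have S: "coords u \<in> std_simplex" by (simp add: triangle_iff_coords)
    have "v u \<in> {p, q, c}" using UNIV_labels by auto
    moreover have "barycentric y u k \<le> 1" if "k \<in> {p, q, c}" for k
      using that S by (auto simp: barycentric_coords std_simplex_def)
    ultimately have "0 \<le> 1 - barycentric y u (v u)" by simp
    then have "1 * (1 - barycentric y u (v u)) \<le> r * (1 - barycentric y u (v u))"
      using r1 by (intro mult_right_mono) auto
    then show ?thesis using u by (simp add: PE_region_def)
  qed
  have "domination_number (PE_digraph y r v (x ` {..<n})) = 2 \<longleftrightarrow>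
     \<not> (\<exists>u\<in>x ` {..<n}. \<forall>w\<in>x ` {..<n}. w \<in> PE_region y r v u)
      \<and> (\<exists>u\<in>x ` {..<n}. \<exists>u'\<in>x ` {..<n}. \<forall>w\<in>x ` {..<n}. w \<in> PE_region y r v u \<or> w \<in> PE_region y r v u')"
  proof (rule domination_number_eq_2_iff[where R = "\<lambda>u w. w \<in> PE_region y r v u"])
    show "verts (PE_digraph y r v (x ` {..<n})) = x ` {..<n}" by (simp add: PE_digraph_def)
  qed (simp_all only: finite_imageI finite_lessThan refl dominating_set_PE_digraph_iff)
  also have "(\<exists>u\<in>x ` {..<n}. \<forall>w\<in>x ` {..<n}. w \<in> PE_region y r v u)
      \<longleftrightarrow> (\<exists>i<n. \<forall>j<n. x j \<in> PE_region y r v (x i))"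
    by blast
  also have "\<dots> \<longleftrightarrow> (\<exists>i<n. \<forall>j<n. arc (coords (x i)) (coords (x j)))"
    using iff by blast
  also have "(\<exists>u\<in>x ` {..<n}. \<exists>u'\<in>x ` {..<n}. \<forall>w\<in>x ` {..<n}. w \<in> PE_region y r v u \<or> w \<in> PE_region y r v u')
      \<longleftrightarrow> (\<exists>i<n. \<exists>k<n. \<forall>j<n. x j \<in> PE_region y r v (x i) \<or> x j \<in> PE_region y r v (x k))"
    by blast
  also have "\<dots> \<longleftrightarrow> (\<exists>i<n. \<exists>k<n. \<forall>j<n. arc (coords (x i)) (coords (x j)) \<or> arc (coords (x k)) (coords (x j)))"
    by (simp add: iff cong: conj_cong imp_cong)
  finally show ?thesis .
qed

lemma AE_unif_simplex_interior: "AE z in unif_simplex. fst z \<noteq> 0 \<and> snd z \<noteq> 0"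
proof -
  have "AE z in unif_simplex. 1 * fst z + 0 * snd z \<noteq> 0" "AE z in unif_simplex. 0 * fst z + 1 * snd z \<noteq> 0"
    by (rule null_line; simp)+
  then show ?thesis by eventually_elim simp
qed

text \<open>All three vertices lie on the coordinate axes, so almost surely no sample point is a
  vertex.\<close>

lemma coords_vertex: "x \<in> range y \<Longrightarrow> fst (coords x) = 0 \<or> snd (coords x) = 0"
  using labels by (auto simp: coords_def barycentric_vertex)

end

text \<open>\<open>A\<close> may fail to be an event of \<open>M\<close>, but it differs from
  \<open>D\<close> only inside a null set. This is how an arbitrary \<open>v\<close> is
  accommodated.\<close>

lemma (in prob_space) measure_completion_AE_eq:
  assumes [measurable]: "D \<in> events" and "A \<subseteq> space M" and AE: "AE \<omega> in M. \<omega> \<in> A \<longleftrightarrow> \<omega> \<in> D"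
  shows "measure (completion M) A = prob D"
proof -
  have "Measurable.pred (completion M) (\<lambda>\<omega>. \<not> (\<omega> \<in> A \<longleftrightarrow> \<omega> \<in> D))"
    by (rule sets_completion_AE) (use AE in simp)
  then have "{\<omega>\<in>space M. \<not> (\<omega> \<in> A \<longleftrightarrow> \<omega> \<in> D)} \<in> sets (completion M)"
    by (simp add: pred_def)
  moreover have "D \<in> sets (completion M)" by simp
  \<comment> \<open>\<open>A\<close> is recovered as the symmetric difference of \<open>D\<close>
    and the exceptional set.\<close>
  ultimately have "(D - {\<omega>\<in>space M. \<not> (\<omega> \<in> A \<longleftrightarrow> \<omega> \<in> D)}) \<union> ({\<omega>\<in>space M. \<not> (\<omega> \<in> A \<longleftrightarrow> \<omega> \<in> D)} - D) \<in> sets (completion M)"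
    by blast
  moreover have "(D - {\<omega>\<in>space M. \<not> (\<omega> \<in> A \<longleftrightarrow> \<omega> \<in> D)}) \<union> ({\<omega>\<in>space M. \<not> (\<omega> \<in> A \<longleftrightarrow> \<omega> \<in> D)} - D) = A"
    using assms(2) sets.sets_into_space[OF assms(1)] by auto
  ultimately have "A \<in> sets (completion M)" by simp
  then have "measure (completion M) A = measure (completion M) D"
    by (intro measure_eq_AE AE_completion AE) auto
  then show ?thesis by simp
qed

theorem theorem9:
  fixes y :: "3 \<Rightarrow> real^2" and r :: real and M :: "real^2" and v :: "real^2 \<Rightarrow> 3"
    and P :: "'a measure" and X :: "nat \<Rightarrow> 'a \<Rightarrow> real^2"
  assumes "\<not> collinear (range y)"
    and "1 < r" and "r < 3/2"
    and "M \<in> range (tr_vertex y r)"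
    and "vertex_choice y M v"
    and "prob_space P"
    and "prob_space.indep_vars P (\<lambda>_. borel) X UNIV"
    and "\<And>i. distr P borel (X i) = uniform_measure lborel (closed_triangle y)"
  shows "((\<lambda>n. measure (completion P)
            {\<omega> \<in> space P. domination_number (PE_digraph y r v ((\<lambda>i. X i \<omega>) ` {..<n})) = 2})
          \<longlonglongrightarrow> limit_prob r)
         \<and> 0 < limit_prob r \<and> limit_prob r < 1"
proof -
  interpret P: prob_space P by fact
  obtain c where c: "M = tr_vertex y r c" using assms(4) by auto
  have "c = 1 \<or> c = 2 \<or> c = 3" by (rule exhaust_3)
  then obtain p q :: 3 where "p \<noteq> q" "p \<noteq> c" "q \<noteq> c"
    by (elim disjE) (auto intro: that[of 2 3] that[of 1 3] that[of 1 2])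
  \<comment> \<open>The largest window that both bounds of \<open>pe_window\<close> allow; it is
    positive because \<open>1 < r < 3/2\<close>.\<close>
  define \<delta> where "\<delta> = min ((1 - 1 / r)\<^sup>2) ((3 - 2 * r) / (2 * r))"
  have "0 < \<delta>" using assms(2,3) by (auto simp: \<delta>_def field_simps)
  moreover have "r * \<delta> \<le> (3 - 2 * r) / 2"
  proof -
    have "r * \<delta> \<le> r * ((3 - 2 * r) / (2 * r))"
      using assms(2) by (intro mult_left_mono) (auto simp: \<delta>_def)
    then show ?thesis using assms(2) by simp
  qed
  ultimately interpret pe_triangle y p q c r \<delta> M v
    using assms(1-5) c \<open>p \<noteq> q\<close> \<open>p \<noteq> c\<close> \<open>q \<noteq> c\<close> by unfold_locales (auto simp: \<delta>_def)
  have X [measurable]: "X i \<in> borel_measurable P" for i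
    using assms(7) by (simp add: P.indep_vars_def)
  interpret Z: pe_iid r \<delta> P "\<lambda>i \<omega>. coords (X i \<omega>)"
  proof unfold_locales
    show "P.indep_vars (\<lambda>_. borel) (\<lambda>i \<omega>. coords (X i \<omega>)) UNIV"
      by (rule P.indep_vars_compose2[OF assms(7)]) simp
    show "distr P borel (\<lambda>\<omega>. coords (X i \<omega>)) = unif_simplex" for i
    proof -
      have "distr P borel (\<lambda>\<omega>. coords (X i \<omega>)) = distr (distr P borel (X i)) borel coords"
        by (subst distr_distr) (auto simp: comp_def)
      then show ?thesis by (simp add: assms(8) distr_coords_uniform)
    qed
  qed
  have AE: "AE \<omega> in P. \<forall>i. X i \<omega> \<in> closed_triangle y - range y \<and> coords (X i \<omega>) \<in> C1 \<union> C2 \<union> C3"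
  proof -
    have "AE \<omega> in P. X i \<omega> \<in> closed_triangle y - range y \<and> coords (X i \<omega>) \<in> C1 \<union> C2 \<union> C3" for i
      using Z.AE_Z[OF AE_in_std_simplex, of i] Z.AE_Z[OF AE_C, of i] Z.AE_Z[OF AE_unif_simplex_interior, of i]
    proof eventually_elim
      case (elim \<omega>)
      then show ?case using coords_vertex[of "X i \<omega>"] by (auto simp: triangle_iff_coords)
    qed
    then show ?thesis unfolding AE_all_countable by blast
  qed
  have "measure (completion P) {\<omega> \<in> space P. domination_number (PE_digraph y r v ((\<lambda>i. X i \<omega>) ` {..<n})) = 2}
      = P.prob (Z.two_dominated n)" for n
  proof (rule P.measure_completion_AE_eq)
    show "AE \<omega> in P. \<omega> \<in> {\<omega> \<in> space P. domination_number (PE_digraph y r v ((\<lambda>i. X i \<omega>) ` {..<n})) = 2} \<longleftrightarrow> \<omega> \<in> Z.two_dominated n"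
      using AE
    proof eventually_elim
      case (elim \<omega>)
      then have "domination_number (PE_digraph y r v ((\<lambda>i. X i \<omega>) ` {..<n})) = 2 \<longleftrightarrow>
        \<not> (\<exists>i<n. \<forall>j<n. arc (coords (X i \<omega>)) (coords (X j \<omega>)))
         \<and> (\<exists>i<n. \<exists>k<n. \<forall>j<n. arc (coords (X i \<omega>)) (coords (X j \<omega>)) \<or> arc (coords (X k \<omega>)) (coords (X j \<omega>)))"
        by (intro domination_number_PE_eq_2_iff) blast+
      then show ?case unfolding Z.two_dominated_def by blast
    qed
  qed auto
  then show ?thesis
    using Z.prob_two_dominated_tendsto limit_prob_pos[OF assms(2)] limit_prob_less_1[OF assms(2)] by simp
qed

end
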